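(* Let $\mathscr{H}:=L^2([0,1])\otimes L^2([0,1])=L^2([0,1]^2)$. Let $P=P_U$ and $Q=Q_V$ be the selfadjoint extensions of $\frac{1}{i2\pi}\frac{\partial}{\partial x}$ and $\frac{1}{i2\pi}\frac{\partial}{\partial y}$ corresponding to boundary unitary operators $U$ on $L^2([0,1])$ (functions of $y$) and $V$ on $L^2([0,1])$ (functions of $x$), respectively. Then $P$ and $Q$ commute if and only if there are $\alpha\in[0,1)$ and $\beta_m\in[0,1)$ ($m\in\mathbb{Z}$) such that either $$Ve_{\alpha+m}=e(\beta_m)e_{\alpha+m}\ \text{ for all } m\in\mathbb{Z},\quad\text{and}\quad U=e(\alpha)I,$$ or $$V=e(\alpha)I,\quad\text{and}\quad Ue_{\alpha+m}=e(\beta_m)e_{\alpha+m}\ \text{ for all } m\in\mathbb{Z}.$$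
   Context: All Hilbert spaces are complex; $e(r):=e^{i2\pi r}$, $e_\lambda(t):=e(\lambda t)$ for $t\in[0,1]$, and $I$ is the identity on $L^2([0,1])$. $P_U=\frac{1}{i2\pi}\partial_x$ (distributional) with domain $\{f\in\mathscr{H}\mid\partial_xf\in\mathscr{H},\ f(1,\cdot)=Uf(0,\cdot)\}$, and $Q_V=\frac{1}{i2\pi}\partial_y$ with domain $\{f\in\mathscr{H}\mid\partial_yf\in\mathscr{H},\ f(\cdot,1)=Vf(\cdot,0)\}$; the boundary values are well-defined elements of $L^2([0,1])$ and both operators are selfadjoint. Two (unbounded) selfadjoint operators $A,B$ commute if their spectral measures commute, equivalently $e(aA)e(bB)=e(bB)e(aA)$ for all $a,b\in\mathbb{R}$. *)

theory Defs
  imports "HOL-Analysis.Analysis"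
begin

section \<open>The complex Hilbert space of square integrable functions on the unit cube\<close>

text \<open>
  The type \<open>'a L2\<close> is $L^2$ of the unit cube of the Euclidean space \<open>'a\<close>: below,
  \<open>real L2\<close> is $L^2([0,1])$ and \<open>(real \<times> real) L2\<close> is $L^2([0,1]^2)$. Its elements are
  classes, modulo equality almost everywhere on the cube, of functions on all of \<open>'a\<close>
  whose values outside of the cube are irrelevant.
\<close>

definition unit_cube :: "'a::euclidean_space measure" where
  "unit_cube = restrict_space lborel (cbox 0 One)"

lemma unit_cube_real: "(unit_cube :: real measure) = restrict_space lborel {0..1}"
  by (simp add: unit_cube_def)

lemma unit_cube_prod:
  "(unit_cube :: (real \<times> real) measure) = restrict_space lborel ({0..1} \<times> {0..1})"
proof -
  have "(One :: real \<times> real) = (1, 1)"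
    by (simp add: Basis_prod_def sum.union_disjoint image_iff fst_sum snd_sum prod_eq_iff)
  then have "cbox 0 (One :: real \<times> real) = {0..1} \<times> {0..1}"
    by (simp add: zero_prod_def cbox_Pair_eq)
  then show ?thesis by (simp add: unit_cube_def)
qed

definition sq_int :: "('a::euclidean_space \<Rightarrow> complex) \<Rightarrow> bool" where
  "sq_int f \<longleftrightarrow> f \<in> borel_measurable unit_cube \<and> integrable unit_cube (\<lambda>x. (cmod (f x))\<^sup>2)"

definition L2_eq :: "('a::euclidean_space \<Rightarrow> complex) \<Rightarrow> ('a \<Rightarrow> complex) \<Rightarrow> bool" where
  "L2_eq f g \<longleftrightarrow> sq_int f \<and> sq_int g \<and> (AE x in unit_cube. f x = g x)"

lemma sq_int_zero [simp]: "sq_int (\<lambda>x. 0)"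
  by (simp add: sq_int_def)

lemma sq_int_mult_integrable:
  assumes "sq_int f" "sq_int g"
  shows "integrable unit_cube (\<lambda>x. f x * cnj (g x))"
proof (rule Bochner_Integration.integrable_bound)
  show "integrable unit_cube (\<lambda>x. (cmod (f x))\<^sup>2 + (cmod (g x))\<^sup>2)"
    using assms by (simp add: sq_int_def)
  have [measurable]: "f \<in> borel_measurable unit_cube" "g \<in> borel_measurable unit_cube"
    using assms by (simp_all add: sq_int_def)
  have "(\<lambda>x. cnj (g x)) \<in> borel_measurable unit_cube"
    by (rule borel_measurable_continuous_on[OF _ \<open>g \<in> _\<close>]) (intro continuous_intros)
  then show "(\<lambda>x. f x * cnj (g x)) \<in> borel_measurable unit_cube"
    by (intro borel_measurable_times) simp_all
  have "norm (a * cnj b) \<le> norm ((cmod a)\<^sup>2 + (cmod b)\<^sup>2)" for a b :: complex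
  proof -
    have "2 * (cmod a * cmod b) \<le> (cmod a)\<^sup>2 + (cmod b)\<^sup>2"
      using sum_squares_bound[of "cmod a" "cmod b"] by (simp add: mult.assoc)
    moreover have "0 \<le> cmod a * cmod b" by simp
    ultimately have "cmod a * cmod b \<le> (cmod a)\<^sup>2 + (cmod b)\<^sup>2" by linarith
    then show ?thesis by (simp add: norm_mult)
  qed
  then show "AE x in unit_cube. norm (f x * cnj (g x)) \<le> norm ((cmod (f x))\<^sup>2 + (cmod (g x))\<^sup>2)"
    by simp
qed

lemma sq_int_add:
  assumes "sq_int f" "sq_int g"
  shows "sq_int (\<lambda>x. f x + g x)"
  unfolding sq_int_def
proof (intro conjI)
  have [measurable]: "f \<in> borel_measurable unit_cube" "g \<in> borel_measurable unit_cube"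
    using assms by (simp_all add: sq_int_def)
  show "(\<lambda>x. f x + g x) \<in> borel_measurable unit_cube" by measurable
  show "integrable unit_cube (\<lambda>x. (cmod (f x + g x))\<^sup>2)"
  proof (rule Bochner_Integration.integrable_bound)
    show "integrable unit_cube (\<lambda>x. 2 * (cmod (f x))\<^sup>2 + 2 * (cmod (g x))\<^sup>2)"
      using assms by (simp add: sq_int_def)
    show "(\<lambda>x. (cmod (f x + g x))\<^sup>2) \<in> borel_measurable unit_cube" by measurable
    have "norm ((cmod (a + b))\<^sup>2) \<le> norm (2 * (cmod a)\<^sup>2 + 2 * (cmod b)\<^sup>2)" for a b :: complex
    proof -
      have "(cmod (a + b))\<^sup>2 \<le> (cmod a + cmod b)\<^sup>2"
        by (intro power_mono norm_triangle_ineq) simp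
      also have "\<dots> \<le> 2 * (cmod a)\<^sup>2 + 2 * (cmod b)\<^sup>2"
        using sum_squares_bound[of "cmod a" "cmod b"] by (simp add: power2_sum)
      finally show ?thesis by simp
    qed
    then show "AE x in unit_cube.
        norm ((cmod (f x + g x))\<^sup>2) \<le> norm (2 * (cmod (f x))\<^sup>2 + 2 * (cmod (g x))\<^sup>2)"
      by simp
  qed
qed

lemma sq_int_cmult:
  assumes "sq_int f"
  shows "sq_int (\<lambda>x. c * f x)"
  using assms by (auto simp: sq_int_def norm_mult power_mult_distrib)

quotient_type (overloaded) 'a L2 = "'a::euclidean_space \<Rightarrow> complex" / partial: L2_eq
proof (rule part_equivpI)
  show "\<exists>f. L2_eq f (f :: 'a \<Rightarrow> complex)"
    by (rule exI[of _ "\<lambda>x. 0"]) (simp add: L2_eq_def)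
  show "symp (L2_eq :: ('a \<Rightarrow> complex) \<Rightarrow> _)"
    by (rule sympI) (auto simp: L2_eq_def elim: eventually_mono)
  show "transp (L2_eq :: ('a \<Rightarrow> complex) \<Rightarrow> _)"
    by (rule transpI) (auto simp: L2_eq_def elim: eventually_elim2)
qed

lift_definition scaleC :: "complex \<Rightarrow> 'a::euclidean_space L2 \<Rightarrow> 'a L2" (infixr "*\<^sub>C" 75)
  is "\<lambda>c f x. c * f x"
  by (auto simp: L2_eq_def sq_int_cmult elim: eventually_mono)

lift_definition cinner :: "'a::euclidean_space L2 \<Rightarrow> 'a L2 \<Rightarrow> complex"
  is "\<lambda>f g. LINT x|unit_cube. f x * cnj (g x)"
proof -
  fix f f' g g' :: "'a \<Rightarrow> complex"
  assume "L2_eq f f'" "L2_eq g g'"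
  then have "integrable unit_cube (\<lambda>x. f x * cnj (g x))" "integrable unit_cube (\<lambda>x. f' x * cnj (g' x))"
    and "AE x in unit_cube. f x * cnj (g x) = f' x * cnj (g' x)"
    by (auto simp: L2_eq_def sq_int_mult_integrable elim: eventually_elim2)
  then show "(LINT x|unit_cube. f x * cnj (g x)) = (LINT x|unit_cube. f' x * cnj (g' x))"
    by (intro integral_cong_AE) auto
qed

text \<open>The norm and the topology of \<open>L2\<close> come from its underlying real inner product.\<close>

instantiation L2 :: (euclidean_space) real_inner
begin

lift_definition zero_L2 :: "'a L2" is "\<lambda>x. 0"
  by (simp add: L2_eq_def)

lift_definition plus_L2 :: "'a L2 \<Rightarrow> 'a L2 \<Rightarrow> 'a L2" is "\<lambda>f g x. f x + g x"
  by (auto simp: L2_eq_def sq_int_add elim: eventually_elim2)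

definition scaleR_L2 :: "real \<Rightarrow> 'a L2 \<Rightarrow> 'a L2" where
  "scaleR_L2 r f = complex_of_real r *\<^sub>C f"

definition uminus_L2 :: "'a L2 \<Rightarrow> 'a L2" where
  "uminus_L2 f = (- 1) *\<^sub>C f"

definition minus_L2 :: "'a L2 \<Rightarrow> 'a L2 \<Rightarrow> 'a L2" where
  "minus_L2 f g = f + (- g)"

definition inner_L2 :: "'a L2 \<Rightarrow> 'a L2 \<Rightarrow> real" where
  "inner_L2 f g = Re (cinner f g)"

definition norm_L2 :: "'a L2 \<Rightarrow> real" where
  "norm_L2 f = sqrt (inner f f)"

definition sgn_L2 :: "'a L2 \<Rightarrow> 'a L2" where
  "sgn_L2 f = inverse (norm f) *\<^sub>R f"

definition dist_L2 :: "'a L2 \<Rightarrow> 'a L2 \<Rightarrow> real" where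
  "dist_L2 f g = norm (f - g)"

definition uniformity_L2 :: "('a L2 \<times> 'a L2) filter" where
  "uniformity_L2 = (INF e\<in>{0<..}. principal {(f, g). dist f g < e})"

definition open_L2 :: "'a L2 set \<Rightarrow> bool" where
  "open_L2 S \<longleftrightarrow> (\<forall>f\<in>S. \<forall>\<^sub>F (f', g) in uniformity. f' = f \<longrightarrow> g \<in> S)"

lemma L2_eq_if_eq:
  assumes "L2_eq f f" "\<And>x. f x = g x"
  shows "L2_eq f g"
proof -
  have "f = g" using assms(2) by auto
  then show ?thesis using assms(1) by simp
qed

instance
proof
  fix f g h :: "'a L2" and r s :: real
  show "f + g + h = f + (g + h)"
    by transfer (auto intro!: L2_eq_if_eq simp: L2_eq_def sq_int_add)
  show "f + g = g + f"
    by transfer (auto intro!: L2_eq_if_eq simp: L2_eq_def sq_int_add)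
  show "0 + f = f"
    by transfer (auto simp: L2_eq_def)
  show "- f + f = 0"
    unfolding uminus_L2_def by transfer (auto simp: L2_eq_def)
  show "f - g = f + - g"
    by (simp add: minus_L2_def)
  show "r *\<^sub>R (f + g) = r *\<^sub>R f + r *\<^sub>R g"
    unfolding scaleR_L2_def
    by transfer (auto intro!: L2_eq_if_eq simp: L2_eq_def sq_int_add sq_int_cmult distrib_left)
  show "(r + s) *\<^sub>R f = r *\<^sub>R f + s *\<^sub>R f"
    unfolding scaleR_L2_def
    by transfer (auto intro!: L2_eq_if_eq simp: L2_eq_def sq_int_add sq_int_cmult distrib_right)
  show "r *\<^sub>R s *\<^sub>R f = (r * s) *\<^sub>R f"
    unfolding scaleR_L2_def
    by transfer (auto intro!: L2_eq_if_eq simp: L2_eq_def sq_int_cmult)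
  show "1 *\<^sub>R f = f"
    unfolding scaleR_L2_def by transfer (auto simp: L2_eq_def)
  show "dist f g = norm (f - g)"
    by (simp add: dist_L2_def)
  show "sgn f = inverse (norm f) *\<^sub>R f"
    by (simp add: sgn_L2_def)
  show "uniformity = (INF e\<in>{0<..}. principal {(f, g :: 'a L2). dist f g < e})"
    by (simp add: uniformity_L2_def)
  show "open S \<longleftrightarrow> (\<forall>f\<in>S. \<forall>\<^sub>F (f', g) in uniformity. f' = f \<longrightarrow> g \<in> S)" for S :: "'a L2 set"
    by (simp add: open_L2_def)
  have "cinner f g = cnj (cinner g f)"
    by transfer (subst Bochner_Integration.integral_cnj[symmetric], simp add: mult.commute)
  then show "inner f g = inner g f"
    by (simp add: inner_L2_def)
  have "cinner (f + g) h = cinner f h + cinner g h"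
    by transfer (auto simp: L2_eq_def distrib_right sq_int_mult_integrable)
  then show "inner (f + g) h = inner f h + inner g h"
    by (simp add: inner_L2_def)
  have "cinner (c *\<^sub>C f) g = c * cinner f g" for c
    by transfer (simp add: mult.assoc)
  then show "inner (r *\<^sub>R f) g = r * inner f g"
    by (simp add: inner_L2_def scaleR_L2_def)
  have Re_self: "Re (LINT x|unit_cube. F x * cnj (F x)) = (LINT x|unit_cube. (cmod (F x))\<^sup>2)"
    for F :: "'a \<Rightarrow> complex"
  proof -
    have "(\<lambda>x. F x * cnj (F x)) = (\<lambda>x. complex_of_real ((cmod (F x))\<^sup>2))"
      by (simp only: complex_norm_square)
    then have "(LINT x|unit_cube. F x * cnj (F x))
        = (LINT x|unit_cube. complex_of_real ((cmod (F x))\<^sup>2))" by simp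
    also have "\<dots> = complex_of_real (LINT x|unit_cube. (cmod (F x))\<^sup>2)"
      by (rule integral_complex_of_real)
    finally show ?thesis by simp
  qed
  show "0 \<le> inner f f"
    unfolding inner_L2_def by transfer (simp add: Re_self)
  show "inner f f = 0 \<longleftrightarrow> f = 0"
    unfolding inner_L2_def
  proof transfer
    fix F :: "'a \<Rightarrow> complex"
    assume "L2_eq F F"
    then have F: "sq_int F" by (simp add: L2_eq_def)
    then have "(LINT x|unit_cube. (cmod (F x))\<^sup>2) = 0 \<longleftrightarrow> (AE x in unit_cube. (cmod (F x))\<^sup>2 = 0)"
      by (intro integral_nonneg_eq_0_iff_AE) (auto simp: sq_int_def)
    then show "Re (LINT x|unit_cube. F x * cnj (F x)) = 0 \<longleftrightarrow> L2_eq F (\<lambda>x. 0)"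
      using F by (simp add: L2_eq_def Re_self)
  qed
  show "norm f = sqrt (inner f f)"
    by (simp add: norm_L2_def)
qed

end


section \<open>Unitary operators and commuting selfadjoint operators\<close>

definition unitary_op :: "('a::euclidean_space L2 \<Rightarrow> 'a L2) \<Rightarrow> bool" where
  "unitary_op U \<longleftrightarrow>
     (\<forall>f g. U (f + g) = U f + U g) \<and> (\<forall>c f. U (c *\<^sub>C f) = c *\<^sub>C U f) \<and>
     (\<forall>f g. cinner (U f) (U g) = cinner f g) \<and> surj U"

text \<open>
  An unbounded operator is represented by its graph. For a selfadjoint operator \<open>A\<close>, the
  family $W(t) = e^{i2\pi tA}$ is by Stone's theorem the unique strongly continuous
  one-parameter unitary group with infinitesimal generator $i2\pi A$; here the domain of
  \<open>A\<close> consists of exactly those \<open>f\<close> for which the derivative at \<open>0\<close> exists in norm.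
\<close>

definition is_exp_group ::
  "('a::euclidean_space L2 \<times> 'a L2) set \<Rightarrow> (real \<Rightarrow> 'a L2 \<Rightarrow> 'a L2) \<Rightarrow> bool" where
  "is_exp_group A W \<longleftrightarrow>
     (\<forall>t. unitary_op (W t)) \<and> W 0 = id \<and> (\<forall>s t. W (s + t) = W s \<circ> W t) \<and>
     (\<forall>f. continuous_on UNIV (\<lambda>t. W t f)) \<and>
     A = {(f, g). ((\<lambda>t. W t f) has_vector_derivative (2 * pi * \<i>) *\<^sub>C g) (at 0)}"

text \<open>
  Selfadjoint operators \<open>A\<close> and \<open>B\<close> commute iff $e(aA)$ and $e(bB)$ commute for all real
  \<open>a\<close>, \<open>b\<close>; equivalently, iff their spectral measures commute.
\<close>

definition op_commute ::
  "('a::euclidean_space L2 \<times> 'a L2) set \<Rightarrow> ('a L2 \<times> 'a L2) set \<Rightarrow> bool" where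
  "op_commute A B \<longleftrightarrow>
     (\<exists>W Z. is_exp_group A W \<and> is_exp_group B Z \<and> (\<forall>a b. W a \<circ> Z b = Z b \<circ> W a))"


section \<open>Distributional partial derivatives and boundary values\<close>

definition dx :: "(real \<times> real \<Rightarrow> complex) \<Rightarrow> real \<times> real \<Rightarrow> complex" where
  "dx \<phi> = (\<lambda>(x, y). vector_derivative (\<lambda>s. \<phi> (s, y)) (at x))"

definition dy :: "(real \<times> real \<Rightarrow> complex) \<Rightarrow> real \<times> real \<Rightarrow> complex" where
  "dy \<phi> = (\<lambda>(x, y). vector_derivative (\<lambda>s. \<phi> (x, s)) (at y))"

text \<open>$C^\infty$: all iterated partial derivatives exist and are continuous.\<close>

coinductive smooth_fun :: "(real \<times> real \<Rightarrow> complex) \<Rightarrow> bool" where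
  "\<lbrakk> continuous_on UNIV \<phi>;
     \<forall>x y. (\<lambda>s. \<phi> (s, y)) differentiable (at x);
     \<forall>x y. (\<lambda>s. \<phi> (x, s)) differentiable (at y);
     smooth_fun (dx \<phi>); smooth_fun (dy \<phi>) \<rbrakk> \<Longrightarrow> smooth_fun \<phi>"

definition test_fun :: "(real \<times> real \<Rightarrow> complex) \<Rightarrow> bool" where
  "test_fun \<phi> \<longleftrightarrow> smooth_fun \<phi> \<and>
     (\<exists>K. compact K \<and> K \<subseteq> {0<..<1} \<times> {0<..<1} \<and> (\<forall>p. p \<notin> K \<longrightarrow> \<phi> p = 0))"

definition weak_dx :: "(real \<times> real) L2 \<Rightarrow> (real \<times> real) L2 \<Rightarrow> bool" where
  "weak_dx f g \<longleftrightarrow> (\<forall>\<phi>. test_fun \<phi> \<longrightarrow>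
     (LINT p|unit_cube. rep_L2 f p * dx \<phi> p) = - (LINT p|unit_cube. rep_L2 g p * \<phi> p))"

definition weak_dy :: "(real \<times> real) L2 \<Rightarrow> (real \<times> real) L2 \<Rightarrow> bool" where
  "weak_dy f g \<longleftrightarrow> (\<forall>\<phi>. test_fun \<phi> \<longrightarrow>
     (LINT p|unit_cube. rep_L2 f p * dy \<phi> p) = - (LINT p|unit_cube. rep_L2 g p * \<phi> p))"

text \<open>
  \<open>slice_x f a h\<close> expresses $f(a,\cdot) = h$ in $L^2([0,1])$. The slice is read off from a
  representative of \<open>f\<close> that is continuous in \<open>x\<close> on $[0,1]$ for almost every \<open>y\<close>. Any two
  such representatives have the same slices almost everywhere, and one exists whenever
  $\partial_x f$ is square integrable.
\<close>

definition slice_x :: "(real \<times> real) L2 \<Rightarrow> real \<Rightarrow> real L2 \<Rightarrow> bool" where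
  "slice_x f a h \<longleftrightarrow> (\<exists>F. sq_int F \<and> abs_L2 F = f \<and>
     (AE y in unit_cube. continuous_on {0..1} (\<lambda>x. F (x, y))) \<and>
     sq_int (\<lambda>y. F (a, y)) \<and> abs_L2 (\<lambda>y. F (a, y)) = h)"

definition slice_y :: "(real \<times> real) L2 \<Rightarrow> real \<Rightarrow> real L2 \<Rightarrow> bool" where
  "slice_y f b h \<longleftrightarrow> (\<exists>F. sq_int F \<and> abs_L2 F = f \<and>
     (AE x in unit_cube. continuous_on {0..1} (\<lambda>y. F (x, y))) \<and>
     sq_int (\<lambda>x. F (x, b)) \<and> abs_L2 (\<lambda>x. F (x, b)) = h)"


section \<open>The momentum operators with boundary unitaries\<close>

definition P_op :: "(real L2 \<Rightarrow> real L2) \<Rightarrow> ((real \<times> real) L2 \<times> (real \<times> real) L2) set" where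
  "P_op U = {(f, (1 / (2 * pi * \<i>)) *\<^sub>C g) | f g.
     weak_dx f g \<and> (\<exists>h. slice_x f 0 h \<and> slice_x f 1 (U h))}"

definition Q_op :: "(real L2 \<Rightarrow> real L2) \<Rightarrow> ((real \<times> real) L2 \<times> (real \<times> real) L2) set" where
  "Q_op V = {(f, (1 / (2 * pi * \<i>)) *\<^sub>C g) | f g.
     weak_dy f g \<and> (\<exists>h. slice_y f 0 h \<and> slice_y f 1 (V h))}"


section \<open>Exponential functions\<close>

definition unit_exp :: "real \<Rightarrow> complex" where
  "unit_exp r = exp (2 * pi * \<i> * r)"

definition exp_fun :: "real \<Rightarrow> real L2" where
  "exp_fun r = abs_L2 (\<lambda>t. unit_exp (r * t))"

end

theory Submission
  imports Defs
begin

text \<open>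
  The group generated by $P_U$ is translation in \<open>x\<close>, where a function leaving the interval
  through one end reenters through the other end after an application of \<open>U\<close>. In particular
  its value at time one is $I \otimes U$, and if $P_U$ and $Q_V$ commute, then $V \otimes I$
  preserves the domain of the symmetric operator $P_U$ and commutes with $P_U$. If $U = e(\alpha)I$,
  then $e_{\alpha+m} \otimes 1$ and $V e_{\alpha+m} \otimes 1$ are eigenvectors of $P_U$ for the
  eigenvalue $\alpha+m$, hence $V e_{\alpha+m}$ is orthogonal to all other $e_{\alpha+n}$. If \<open>U\<close>
  is not scalar, then symmetry of $P_U$ on sums $p \otimes v + q \otimes w$ forces
  every $e_\lambda$ with real $\lambda$ to be an eigenvector of \<open>V\<close>, and \<open>V\<close> is scalar because
  $e_\lambda$ and $e_\mu$ are not orthogonal unless $\lambda - \mu$ is a nonzero integer.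

  Conversely, if $U e_{\gamma+m} = e(\beta_m) e_{\gamma+m}$, then $P_U$ is the diagonal operator with
  eigenvectors $e_{\beta_m+n} \otimes e_{\gamma+m}$ and eigenvalues $\beta_m+n$: both operators have the
  same resolvent, which is given by an explicit solution of a first order linear equation. In
  either case of the theorem, the groups of $P_U$ and $Q_V$ are diagonal with respect to a common
  total family.
\<close>

section \<open>Square integrable functions on the unit cube\<close>

text \<open>\<open>op_commute\<close> quantifies over the groups, so the converse has to construct
  them, while the forward direction receives them and must recover the boundary unitaries. Time one
  is when a translated function has crossed the boundary completely, which separates the unitary
  from the translation. The obstacle is that \<open>P_op\<close> is given by weak derivatives and by
  boundary values read off from unspecified representatives. Identifying it with a diagonal operator
  needs uniqueness for a weak equation: if \<open>weak_dx f (\<kappa> *\<^sub>C f)\<close>, then f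
  is exponential in x, the boundary condition becomes \<open>U h = exp \<kappa> *\<^sub>C h\<close>,
  and isometry excludes h \<noteq> 0 unless \<kappa> is purely imaginary. A negative \<kappa>
  moreover makes the equation for the initial value contractive, hence the choice -1. In the
  nonscalar case \<open>U\<close> need not have any eigenvector, so elements of the domain have to
  be built for arbitrary \<open>U\<close>. Two exponentials whose frequencies differ by 1/2 agree at
  x = 0 and have opposite values at x = 1; their combinations allow both boundary values to be
  prescribed.\<close>

abbreviation I01 :: "real measure" where "I01 \<equiv> unit_cube"

lemma space_unit_cube: "space (unit_cube :: 'a::euclidean_space measure) = cbox 0 One"
  by (simp add: unit_cube_def space_restrict_space)

lemma space_I01 [simp]: "space I01 = {0..1}"
  by (simp add: space_unit_cube)

lemma emeasure_space_unit_cube: "emeasure (unit_cube :: 'a::euclidean_space measure) (space unit_cube) = 1"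
proof -
  have "emeasure lborel (cbox 0 (One :: 'a)) = 1"
    by (subst emeasure_lborel_cbox_eq) (auto simp: inner_sum_left_Basis)
  then show ?thesis
    by (simp add: unit_cube_def emeasure_restrict_space space_restrict_space)
qed

interpretation unit_cube: finite_measure "unit_cube :: 'a::euclidean_space measure"
  by standard (simp add: emeasure_space_unit_cube)

lemma measure_space_unit_cube: "measure (unit_cube :: 'a::euclidean_space measure) (space unit_cube) = 1"
  by (simp add: measure_def emeasure_space_unit_cube)

interpretation I01_pair: pair_sigma_finite I01 I01 ..

text \<open>Inclusion of sigma-algebras is measurability of the identity; in this form the
  measurability rules for products and restrictions can establish it.\<close>

lemma sets_subset_if_measurable_id:
  assumes "(\<lambda>x. x) \<in> M \<rightarrow>\<^sub>M N" "space M = space N"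
  shows "sets N \<subseteq> sets M"
proof
  fix A assume "A \<in> sets N"
  with measurable_sets[OF assms(1) this] sets.sets_into_space[OF this] assms(2)
  show "A \<in> sets M" by (simp add: vimage_def Int_absorb2)
qed

text \<open>Sigma-finite product measures are determined by rectangles, so it suffices to compare
  the sigma-algebras and the measures of rectangles. Every use of Fubini on the square rests on this
  identification.\<close>

lemma unit_cube_pair: "(unit_cube :: (real \<times> real) measure) = I01 \<Otimes>\<^sub>M I01"
proof (rule pair_measure_eqI[symmetric])
  show "sigma_finite_measure I01" "sigma_finite_measure I01" by unfold_locales
  let ?A = "{0..1} :: real set"
  have eq: "sets (I01 \<Otimes>\<^sub>M I01) = sets (restrict_space (lborel \<Otimes>\<^sub>M lborel) (?A \<times> ?A))"
    unfolding unit_cube_real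
  proof (intro antisym)
    have 1: "fst \<in> restrict_space (lborel \<Otimes>\<^sub>M lborel) (?A \<times> ?A) \<rightarrow>\<^sub>M restrict_space lborel ?A"
       "snd \<in> restrict_space (lborel \<Otimes>\<^sub>M lborel) (?A \<times> ?A) \<rightarrow>\<^sub>M restrict_space lborel ?A"
      by (auto intro!: measurable_restrict_space3)
    then have "(\<lambda>p. (fst p, snd p)) \<in> restrict_space (lborel \<Otimes>\<^sub>M lborel) (?A \<times> ?A) \<rightarrow>\<^sub>M
        restrict_space lborel ?A \<Otimes>\<^sub>M restrict_space lborel ?A"
      by (rule measurable_Pair)
    then have id: "(\<lambda>p. p) \<in> restrict_space (lborel \<Otimes>\<^sub>M lborel) (?A \<times> ?A) \<rightarrow>\<^sub>M
        restrict_space lborel ?A \<Otimes>\<^sub>M restrict_space lborel ?A" by simp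
    show "sets (restrict_space lborel ?A \<Otimes>\<^sub>M restrict_space lborel ?A)
       \<subseteq> sets (restrict_space (lborel \<Otimes>\<^sub>M lborel) (?A \<times> ?A))"
      using id by (rule sets_subset_if_measurable_id) (simp add: space_restrict_space space_pair_measure)
    have "(\<lambda>p. (fst p, snd p)) \<in> restrict_space lborel ?A \<Otimes>\<^sub>M restrict_space lborel ?A \<rightarrow>\<^sub>M
        lborel \<Otimes>\<^sub>M lborel"
      by (intro measurable_Pair measurable_compose[OF measurable_fst] measurable_compose[OF measurable_snd]
            measurable_restrict_space1) auto
    then have "(\<lambda>p. p) \<in> restrict_space lborel ?A \<Otimes>\<^sub>M restrict_space lborel ?A \<rightarrow>\<^sub>M
        restrict_space (lborel \<Otimes>\<^sub>M lborel) (?A \<times> ?A)"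
      by (intro measurable_restrict_space2) (auto simp: space_pair_measure space_restrict_space)
    then show "sets (restrict_space (lborel \<Otimes>\<^sub>M lborel) (?A \<times> ?A)) \<subseteq> 
        sets (restrict_space lborel ?A \<Otimes>\<^sub>M restrict_space lborel ?A)"
      by (rule sets_subset_if_measurable_id) (simp add: space_restrict_space space_pair_measure)
  qed
  show "sets (I01 \<Otimes>\<^sub>M I01) = sets (unit_cube :: (real \<times> real) measure)"
    unfolding eq by (simp add: unit_cube_prod lborel_prod)
  show "emeasure I01 A * emeasure I01 B = emeasure unit_cube (A \<times> B)"
    if "A \<in> sets I01" "B \<in> sets I01" for A B
  proof -
    have "{0..1} \<times> {0..1 :: real} \<in> sets (borel :: (real \<times> real) measure)"
      by (intro borel_closed closed_Times) auto
    moreover have "emeasure lborel (A \<times> B) = emeasure lborel A * emeasure lborel B"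
      using that lborel.emeasure_pair_measure_Times[of A lborel B]
      by (simp add: lborel_prod unit_cube_real sets_restrict_space_iff)
    ultimately show ?thesis using that
      by (simp add: unit_cube_real unit_cube_prod emeasure_restrict_space sets_restrict_space_iff
        Sigma_mono)
  qed
qed

section \<open>Passing between classes and representatives\<close>

lemma L2_eq_rep: "L2_eq (rep_L2 f) (rep_L2 f)"
  by (rule Quotient3_rep_reflp[OF Quotient3_L2])

lemma sq_int_rep [simp]: "sq_int (rep_L2 f)"
  using L2_eq_rep[of f] by (simp add: L2_eq_def)

lemma abs_rep_L2 [simp]: "abs_L2 (rep_L2 f) = f"
  by (rule Quotient3_abs_rep[OF Quotient3_L2])

lemma L2_cases: obtains F where "sq_int F" "f = abs_L2 F"
  by (metis abs_rep_L2 sq_int_rep)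

lemma abs_L2_eq_iff:
  assumes "sq_int f" "sq_int g"
  shows "abs_L2 f = abs_L2 g \<longleftrightarrow> (AE x in unit_cube. f x = g x)"
  using Quotient3_rel[OF Quotient3_L2, of f g] assms by (auto simp: L2_eq_def)

lemma rep_abs_L2: "sq_int f \<Longrightarrow> AE x in unit_cube. rep_L2 (abs_L2 f) x = f x"
  using abs_L2_eq_iff[of "rep_L2 (abs_L2 f)" f] by simp

lemma cinner_abs: "sq_int f \<Longrightarrow> sq_int g \<Longrightarrow>
    cinner (abs_L2 f) (abs_L2 g) = (LINT x|unit_cube. f x * cnj (g x))"
  by (rule cinner.abs_eq) (auto simp: L2_eq_def)

lemma plus_abs: "sq_int f \<Longrightarrow> sq_int g \<Longrightarrow> abs_L2 f + abs_L2 g = abs_L2 (\<lambda>x. f x + g x)"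
  by (rule plus_L2.abs_eq) (auto simp: L2_eq_def)

lemma scaleC_abs: "sq_int f \<Longrightarrow> c *\<^sub>C abs_L2 f = abs_L2 (\<lambda>x. c * f x)"
  by (rule scaleC.abs_eq) (auto simp: L2_eq_def)

lemma zero_abs: "0 = abs_L2 (\<lambda>x. 0)"
  by (simp add: zero_L2_def)

lemma minus_abs: "sq_int f \<Longrightarrow> sq_int g \<Longrightarrow> abs_L2 f - abs_L2 g = abs_L2 (\<lambda>x. f x - g x)"
  using sq_int_cmult[of g "-1"]
  by (simp add: minus_L2_def uminus_L2_def scaleC_abs plus_abs)

lemma sq_int_diff: "sq_int f \<Longrightarrow> sq_int g \<Longrightarrow> sq_int (\<lambda>x. f x - g x)"
  using sq_int_add[of f "\<lambda>x. -1 * g x"] sq_int_cmult[of g "-1"] by simp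

lemma sq_int_measurable [measurable_dest]: "sq_int f \<Longrightarrow> f \<in> borel_measurable unit_cube"
  by (simp add: sq_int_def)

lemma sq_int_bounded:
  assumes [measurable]: "f \<in> borel_measurable unit_cube"
    and "AE x in unit_cube. cmod (f x) \<le> B"
  shows "sq_int f"
  unfolding sq_int_def
proof (intro conjI unit_cube.integrable_const_bound)
  show "AE x in unit_cube. norm ((cmod (f x))\<^sup>2) \<le> B\<^sup>2"
    using assms(2) by (rule eventually_mono) (auto intro: power_mono)
qed auto

lemma sq_int_mult_bounded:
  assumes "sq_int f" and [measurable]: "g \<in> borel_measurable unit_cube"
    and "AE x in unit_cube. cmod (g x) \<le> B"
  shows "sq_int (\<lambda>x. g x * f x)"
  unfolding sq_int_def
proof (intro conjI)
  note [measurable] = sq_int_measurable[OF assms(1)]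
  show "(\<lambda>x. g x * f x) \<in> borel_measurable unit_cube" by measurable
  show "integrable unit_cube (\<lambda>x. (cmod (g x * f x))\<^sup>2)"
  proof (rule Bochner_Integration.integrable_bound)
    show "integrable unit_cube (\<lambda>x. B\<^sup>2 * (cmod (f x))\<^sup>2)"
      using assms(1) by (simp add: sq_int_def)
    show "AE x in unit_cube. norm ((cmod (g x * f x))\<^sup>2) \<le> norm (B\<^sup>2 * (cmod (f x))\<^sup>2)"
      using assms(3)
      by (rule eventually_mono) (auto simp: norm_mult power_mult_distrib intro!: mult_right_mono power_mono)
  qed simp
qed

lemma sq_int_integrable:
  assumes "sq_int f" shows "integrable unit_cube f"
proof -
  have "sq_int (\<lambda>x. 1 :: complex)" by (rule sq_int_bounded[where B=1]) auto
  from sq_int_mult_integrable[OF assms this] show ?thesis by simp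
qed

section \<open>Algebra of the complex inner product\<close>

lemma scaleC_add_right: "c *\<^sub>C (f + g) = c *\<^sub>C f + c *\<^sub>C g"
  by transfer (auto intro!: L2_eq_if_eq simp: L2_eq_def sq_int_add sq_int_cmult distrib_left)

lemma scaleC_add_left: "(c + d) *\<^sub>C f = c *\<^sub>C f + d *\<^sub>C f"
  by transfer (auto intro!: L2_eq_if_eq simp: L2_eq_def sq_int_add sq_int_cmult distrib_right)

lemma scaleC_scaleC [simp]: "c *\<^sub>C d *\<^sub>C f = (c * d) *\<^sub>C f"
  by transfer (auto intro!: L2_eq_if_eq simp: L2_eq_def sq_int_add sq_int_cmult)

lemma scaleC_one [simp]: "1 *\<^sub>C f = f"
  by transfer (auto simp: L2_eq_def)

lemma scaleC_zero_left [simp]: "0 *\<^sub>C f = 0"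
  using scaleC_add_left[of 0 0 f] by simp

lemma scaleC_zero_right [simp]: "c *\<^sub>C 0 = 0"
  using scaleC_add_right[of c 0 0] by simp

lemma scaleC_minus_left: "(- c) *\<^sub>C f = - (c *\<^sub>C f)"
  by (simp add: uminus_L2_def)

lemma scaleC_minus_right: "c *\<^sub>C (- f) = - (c *\<^sub>C f)"
  by (simp add: uminus_L2_def)

lemma scaleC_diff_right: "c *\<^sub>C (f - g) = c *\<^sub>C f - c *\<^sub>C g"
  using scaleC_add_right[of c f "- g"] by (simp add: scaleC_minus_right)

lemma scaleC_eq_0_iff: "c *\<^sub>C f = 0 \<longleftrightarrow> c = 0 \<or> f = 0"
  by (metis left_inverse scaleC_one scaleC_scaleC scaleC_zero_left scaleC_zero_right)

lemma scaleR_scaleC: "r *\<^sub>R (f :: 'a::euclidean_space L2) = complex_of_real r *\<^sub>C f"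
  by (simp add: scaleR_L2_def)

lemma cinner_commute: "cinner f g = cnj (cinner g f)"
  by transfer (subst Bochner_Integration.integral_cnj[symmetric], simp add: mult.commute)

lemma cinner_add_left: "cinner (f + g) h = cinner f h + cinner g h"
  by transfer (auto simp: L2_eq_def distrib_right sq_int_mult_integrable)

lemma cinner_scaleC_left: "cinner (c *\<^sub>C f) g = c * cinner f g"
  by transfer (simp add: mult.assoc)

lemma cinner_add_right: "cinner h (f + g) = cinner h f + cinner h g"
  by (subst (1 2 3) cinner_commute) (simp add: cinner_add_left)

lemma cinner_scaleC_right: "cinner f (c *\<^sub>C g) = cnj c * cinner f g"
  by (subst (1 2) cinner_commute) (simp add: cinner_scaleC_left)

lemma cinner_minus_left: "cinner (- f) g = - cinner f g"
  by (simp add: uminus_L2_def cinner_scaleC_left)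

lemma cinner_minus_right: "cinner f (- g) = - cinner f g"
  by (simp add: uminus_L2_def cinner_scaleC_right)

lemma cinner_diff_left: "cinner (f - g) h = cinner f h - cinner g h"
  using cinner_add_left[of f "- g" h] by (simp add: cinner_minus_left)

lemma cinner_diff_right: "cinner h (f - g) = cinner h f - cinner h g"
  using cinner_add_right[of h f "- g"] by (simp add: cinner_minus_right)

lemma cinner_zero [simp]: "cinner 0 f = 0" "cinner f 0 = 0"
  using cinner_scaleC_left[of 0 f f] cinner_scaleC_right[of f 0 f] by auto

lemmas cinner_simps = cinner_add_left cinner_add_right cinner_diff_left cinner_diff_right
  cinner_minus_left cinner_minus_right cinner_scaleC_left cinner_scaleC_right

lemma cinner_sum_left: "cinner (\<Sum>i\<in>A. f i) g = (\<Sum>i\<in>A. cinner (f i) g)"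
  by (induction A rule: infinite_finite_induct) (auto simp: cinner_simps)

lemma cinner_self: "cinner f f = complex_of_real ((norm f)\<^sup>2)"
proof -
  have "Im (cinner f f) = 0"
    using arg_cong[OF cinner_commute[of f f], of Im] by simp
  then show ?thesis
    by (simp add: complex_eq_iff power2_norm_eq_inner inner_L2_def)
qed

lemma norm_scaleC: "norm (c *\<^sub>C f) = cmod c * norm f"
proof -
  have "complex_of_real ((norm (c *\<^sub>C f))\<^sup>2) = complex_of_real ((cmod c * norm f)\<^sup>2)"
    unfolding cinner_self[symmetric] cinner_simps
    by (simp add: cinner_self power_mult_distrib mult.assoc[symmetric]
        complex_norm_square[of c, unfolded of_real_power] mult.commute)
  then show ?thesis
    by (simp only: of_real_eq_iff) (auto intro: power2_eq_imp_eq)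
qed

text \<open>Rotating \<open>f\<close> by a phase makes the complex inner product real and
  nonnegative, which reduces the claim to Cauchy-Schwarz for the real inner product.\<close>

lemma cinner_bound: "cmod (cinner f g) \<le> norm f * norm g"
proof (cases "cinner f g = 0")
  case False
  define c where "c = cnj (sgn (cinner f g))"
  have c: "cmod c = 1" using False by (simp add: c_def norm_sgn)
  have "c * cinner f g = complex_of_real (cmod (cinner f g))"
    using False unfolding c_def sgn_eq
    by (simp add: mult.commute[of "cnj _"] complex_norm_square[symmetric] power2_eq_square)
  then have "cmod (cinner f g) = inner (c *\<^sub>C f) g"
    by (simp add: inner_L2_def cinner_simps)
  also have "\<dots> \<le> norm (c *\<^sub>C f) * norm g" by (rule norm_cauchy_schwarz)
  finally show ?thesis using c by (simp add: norm_scaleC)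
qed simp

lemma bounded_linear_cinner_left: "bounded_linear (\<lambda>f. cinner f g)"
  by (rule bounded_linear_intro[where K = "norm g"])
     (auto simp: cinner_simps scaleR_scaleC cinner_bound scaleR_conv_of_real)

lemma bounded_linear_scaleC_right: "bounded_linear (\<lambda>f. c *\<^sub>C f)"
  by (rule bounded_linear_intro[where K = "cmod c"])
     (auto simp: scaleC_add_right scaleR_scaleC norm_scaleC mult.commute)

lemma bounded_linear_scaleC_left: "bounded_linear (\<lambda>c. c *\<^sub>C f)"
  by (rule bounded_linear_intro[where K = "norm f"])
     (auto simp: scaleC_add_left scaleR_scaleC norm_scaleC mult.commute scaleR_conv_of_real)

text \<open>Testing with f - g itself gives norm zero. The rule turns identities between vectors
  into identities between scalars.\<close>

lemma L2_eqI: "(\<And>h. cinner f h = cinner g h) \<Longrightarrow> f = g"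
  using cinner_self[of "f - g"] by (simp add: cinner_diff_left)

lemma norm_abs_L2:
  assumes "sq_int f"
  shows "(norm (abs_L2 f))\<^sup>2 = (LINT x|unit_cube. (cmod (f x))\<^sup>2)"
proof -
  have "complex_of_real ((norm (abs_L2 f))\<^sup>2) = (LINT x|unit_cube. complex_of_real ((cmod (f x))\<^sup>2))"
    unfolding cinner_self[symmetric] cinner_abs[OF assms assms] by (simp only: complex_norm_square)
  then show ?thesis by (simp only: integral_complex_of_real of_real_eq_iff)
qed


section \<open>Completeness, tensor products and coordinate exchange\<close>

text \<open>Cauchy-Schwarz against the constant function 1, which has norm one since the cube has
  measure one.\<close>

lemma integral_cmod_le_norm:
  assumes f: "sq_int f"
  shows "(LINT x|unit_cube. cmod (f x)) \<le> norm (abs_L2 f)"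
proof -
  let ?g = "\<lambda>x. complex_of_real (cmod (f x))"
  note [measurable] = sq_int_measurable[OF f]
  have g: "sq_int ?g" using f by (auto simp: sq_int_def)
  have one: "sq_int (\<lambda>x. 1)" by (rule sq_int_bounded[where B = 1]) auto
  have "(LINT x|unit_cube. cmod (f x)) = cmod (complex_of_real (LINT x|unit_cube. cmod (f x)))"
    by (simp add: integral_nonneg_AE)
  also have "\<dots> = cmod (cinner (abs_L2 ?g) (abs_L2 (\<lambda>x. 1)))"
    by (subst cinner_abs[OF g one]) (simp add: integral_complex_of_real)
  also have "\<dots> \<le> norm (abs_L2 ?g) * norm (abs_L2 (\<lambda>x::'a. 1))"
    by (rule cinner_bound)
  also have "norm (abs_L2 ?g) = norm (abs_L2 f)"
    by (rule power2_eq_imp_eq) (simp_all add: norm_abs_L2 f g)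
  also have "norm (abs_L2 (\<lambda>x::'a. 1)) = 1"
    by (rule power2_eq_imp_eq) (simp_all add: norm_abs_L2 one measure_space_unit_cube)
  finally show ?thesis by simp
qed

text \<open>By monotone convergence the sum of the norms has a finite integral, hence is finite
  almost everywhere.\<close>

lemma AE_summable_norm:
  fixes f :: "nat \<Rightarrow> 'a \<Rightarrow> 'b::{second_countable_topology, banach}"
  assumes f: "\<And>k. integrable M (f k)"
    and sum: "summable (\<lambda>k. LINT x|M. norm (f k x))"
  shows "AE x in M. summable (\<lambda>k. norm (f k x))"
proof -
  note [measurable] = borel_measurable_integrable[OF f]
  have "(\<integral>\<^sup>+x. (\<Sum>k. ennreal (norm (f k x))) \<partial>M) = (\<Sum>k. \<integral>\<^sup>+x. ennreal (norm (f k x)) \<partial>M)"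
    by (rule nn_integral_suminf) measurable
  also have "\<dots> = (\<Sum>k. ennreal (LINT x|M. norm (f k x)))"
    using f by (simp add: nn_integral_eq_integral)
  also have "\<dots> = ennreal (\<Sum>k. LINT x|M. norm (f k x))"
    using sum by (intro suminf_ennreal2) (auto intro: integral_nonneg_AE)
  finally have "AE x in M. (\<Sum>k. ennreal (norm (f k x))) \<noteq> \<infinity>"
    by (intro nn_integral_noteq_infinite) auto
  then show ?thesis
    by (rule eventually_mono) (auto intro: summable_suminf_not_top)
qed

text \<open>Riesz-Fischer: a subsequence with geometrically small increments converges almost
  everywhere, and Fatou's lemma bounds its distance to the pointwise limit. Completeness serves the
  orthogonal series and the fixed point argument below.\<close>

lemma L2_Cauchy_convergent:
  fixes X :: "nat \<Rightarrow> 'a::euclidean_space L2"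
  assumes "Cauchy X"
  shows "convergent X"
proof -
  have "\<forall>k. \<exists>M. \<forall>m\<ge>M. \<forall>n\<ge>M. norm (X m - X n) < (1/2) ^ k"
    using assms unfolding Cauchy_def dist_norm by simp
  then obtain M where M: "\<And>k m n. m \<ge> M k \<Longrightarrow> n \<ge> M k \<Longrightarrow> norm (X m - X n) < (1/2) ^ k"
    by metis
  \<comment> \<open>Summing the thresholds makes the indices monotone and keeps \<open>r k\<close>
    at least \<open>M k\<close>.\<close>
  define r where "r k = (\<Sum>i\<le>k. M i)" for k
  have rM: "r k \<ge> M k" for k
    unfolding r_def by (rule member_le_sum) auto
  have r_mono: "r j \<ge> r k" if "j \<ge> k" for j k
    unfolding r_def using that by (intro sum_mono2) auto
  define F where "F k = rep_L2 (X (r k))" for k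
  have F: "sq_int (F k)" "abs_L2 (F k) = X (r k)" for k by (simp_all add: F_def)
  have diff: "norm (abs_L2 (\<lambda>x. F j x - F k x)) \<le> (1/2) ^ k" if "j \<ge> k" for j k
    using M[of k "r j" "r k"] rM[of k] r_mono[OF that]
    by (simp add: minus_abs[OF F(1) F(1), symmetric] F(2))
  have [measurable]: "F k \<in> borel_measurable unit_cube" for k
    by (rule sq_int_measurable) (rule F)
  have "AE x in unit_cube. summable (\<lambda>k. norm (F (Suc k) x - F k x))"
  proof (rule AE_summable_norm)
    show "integrable unit_cube (\<lambda>x. F (Suc k) x - F k x)" for k
      by (intro sq_int_integrable sq_int_diff F)
    show "summable (\<lambda>k. LINT x|unit_cube. norm (F (Suc k) x - F k x))"
    proof (rule summable_comparison_test')
      show "summable (\<lambda>k. (1/2::real) ^ k)" by simp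
      show "norm (LINT x|unit_cube. norm (F (Suc k) x - F k x)) \<le> (1/2) ^ k" for k
        using integral_cmod_le_norm[OF sq_int_diff[OF F(1)[of "Suc k"] F(1)[of k]]] diff[of k "Suc k"]
        by (auto simp: integral_nonneg_AE)
    qed
  qed
  then have conv: "AE x in unit_cube. convergent (\<lambda>k. F k x)"
  proof (rule eventually_mono)
    fix x assume "summable (\<lambda>k. norm (F (Suc k) x - F k x))"
    then have "summable (\<lambda>k. F (Suc k) x - F k x)" by (rule summable_norm_cancel)
    then have "convergent (\<lambda>n. \<Sum>k<n. F (Suc k) x - F k x)"
      by (simp add: summable_iff_convergent)
    then have "convergent (\<lambda>n. F n x - F 0 x)"
      by (simp only: sum_lessThan_telescope[of "\<lambda>k. F k x"])
    then have "convergent (\<lambda>n. (F n x - F 0 x) + F 0 x)"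
      by (rule convergent_add) (rule convergent_const)
    then show "convergent (\<lambda>k. F k x)" by simp
  qed
  \<comment> \<open>Where the sequence diverges \<open>lim\<close> has an arbitrary value, but this
    concerns only a null set.\<close>
  define G where "G x = lim (\<lambda>k. F k x)" for x
  have [measurable]: "G \<in> borel_measurable unit_cube"
    unfolding G_def by measurable
  have lim: "AE x in unit_cube. (\<lambda>k. F k x) \<longlonglongrightarrow> G x"
    using conv by (rule eventually_mono) (simp add: G_def convergent_LIMSEQ_iff)
  have fatou: "(\<integral>\<^sup>+x. ennreal ((cmod (G x - F k x))\<^sup>2) \<partial>unit_cube) \<le> ennreal (((1/2) ^ k)\<^sup>2)" for k
  proof -
    have "AE x in unit_cube. ennreal ((cmod (G x - F k x))\<^sup>2)
        = liminf (\<lambda>j. ennreal ((cmod (F j x - F k x))\<^sup>2))"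
      using lim
    proof (rule eventually_mono)
      fix x assume "(\<lambda>j. F j x) \<longlonglongrightarrow> G x"
      then have "(\<lambda>j. ennreal ((cmod (F j x - F k x))\<^sup>2)) \<longlonglongrightarrow> ennreal ((cmod (G x - F k x))\<^sup>2)"
        by (intro tendsto_ennrealI tendsto_intros)
      then show "ennreal ((cmod (G x - F k x))\<^sup>2) = liminf (\<lambda>j. ennreal ((cmod (F j x - F k x))\<^sup>2))"
        by (intro lim_imp_Liminf[symmetric]) auto
    qed
    then have "(\<integral>\<^sup>+x. ennreal ((cmod (G x - F k x))\<^sup>2) \<partial>unit_cube)
        = (\<integral>\<^sup>+x. liminf (\<lambda>j. ennreal ((cmod (F j x - F k x))\<^sup>2)) \<partial>unit_cube)"
      by (rule nn_integral_cong_AE)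
    also have "\<dots> \<le> liminf (\<lambda>j. \<integral>\<^sup>+x. ennreal ((cmod (F j x - F k x))\<^sup>2) \<partial>unit_cube)"
      by (rule nn_integral_liminf) measurable
    also have "\<dots> \<le> limsup (\<lambda>j. \<integral>\<^sup>+x. ennreal ((cmod (F j x - F k x))\<^sup>2) \<partial>unit_cube)"
      by (rule Liminf_le_Limsup) simp
    also have "\<dots> \<le> ennreal (((1/2) ^ k)\<^sup>2)"
    proof (rule Limsup_bounded, rule eventually_sequentiallyI)
      fix j assume "k \<le> j"
      have d: "sq_int (\<lambda>x. F j x - F k x)" by (intro sq_int_diff F)
      have "(\<integral>\<^sup>+x. ennreal ((cmod (F j x - F k x))\<^sup>2) \<partial>unit_cube)
         = ennreal ((norm (abs_L2 (\<lambda>x. F j x - F k x)))\<^sup>2)"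
        unfolding norm_abs_L2[OF d]
        by (rule nn_integral_eq_integral) (use d in \<open>auto simp: sq_int_def\<close>)
      also have "\<dots> \<le> ennreal (((1/2) ^ k)\<^sup>2)"
        by (intro ennreal_leI power_mono diff \<open>k \<le> j\<close>) simp
      finally show "(\<integral>\<^sup>+x. ennreal ((cmod (F j x - F k x))\<^sup>2) \<partial>unit_cube) \<le> ennreal (((1/2) ^ k)\<^sup>2)" .
    qed
    finally show ?thesis .
  qed
  have GF: "sq_int (\<lambda>x. G x - F k x)" for k
    unfolding sq_int_def
  proof (intro conjI integrableI_nonneg)
    show "(\<integral>\<^sup>+x. ennreal ((cmod (G x - F k x))\<^sup>2) \<partial>unit_cube) < \<infinity>"
      by (rule le_less_trans[OF fatou]) simp
  qed auto
  have G: "sq_int G"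
    using sq_int_add[OF GF[of 0] F(1)[of 0]] by simp
  have GX: "norm (abs_L2 G - X (r k)) \<le> (1/2) ^ k" for k
  proof -
    have "ennreal ((norm (abs_L2 (\<lambda>x. G x - F k x)))\<^sup>2) \<le> ennreal (((1/2) ^ k)\<^sup>2)"
      using fatou[of k] unfolding norm_abs_L2[OF GF]
      by (subst (asm) nn_integral_eq_integral) (use GF[of k] in \<open>auto simp: sq_int_def\<close>)
    then have "(norm (abs_L2 (\<lambda>x. G x - F k x)))\<^sup>2 \<le> ((1/2) ^ k)\<^sup>2"
      by (simp add: ennreal_le_iff)
    then have "norm (abs_L2 (\<lambda>x. G x - F k x)) \<le> (1/2) ^ k"
      by (rule power2_le_imp_le) simp
    then show ?thesis
      by (simp only: minus_abs[OF G F(1), symmetric] F(2))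
  qed
  have "X \<longlonglongrightarrow> abs_L2 G"
  proof (rule LIMSEQ_I)
    fix e :: real assume "0 < e"
    then obtain k where k: "(1/2) ^ k < e / 2"
      using real_arch_pow_inv[of "e/2" "1/2"] by auto
    have "norm (X n - abs_L2 G) < e" if "n \<ge> M k" for n
    proof -
      have "norm (X n - X (r k)) < (1/2) ^ k" using that rM by (intro M)
      moreover have "norm (X n - abs_L2 G) \<le> norm (X n - X (r k)) + norm (X (r k) - abs_L2 G)"
        using norm_triangle_ineq[of "X n - X (r k)" "X (r k) - abs_L2 G"] by simp
      ultimately show ?thesis using GX[of k] k by (simp add: norm_minus_commute)
    qed
    then show "\<exists>no. \<forall>n\<ge>no. norm (X n - abs_L2 G) < e" by blast
  qed
  then show ?thesis by (auto simp: convergent_def)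
qed

instance L2 :: (euclidean_space) banach
  by standard (rule L2_Cauchy_convergent)


section \<open>Null sets and iterated integrals on the square\<close>

lemma AE_pair_fst:
  assumes "AE x in I01. P x"
  shows "AE p in unit_cube. P (fst (p :: real \<times> real))"
proof -
  from AE_E[OF assms] obtain N where N: "{x \<in> space I01. \<not> P x} \<subseteq> N" "emeasure I01 N = 0" "N \<in> sets I01"
    by auto
  have "emeasure (I01 \<Otimes>\<^sub>M I01) (N \<times> space I01) = 0"
    using N sets.top[of I01] by (subst unit_cube.emeasure_pair_measure_Times) auto
  then show ?thesis
    unfolding unit_cube_pair using N sets.top[of I01]
    by (intro AE_I[where N = "N \<times> space I01"]) (auto simp: space_pair_measure)
qed

lemma AE_pair_swap:
  fixes P :: "real \<times> real \<Rightarrow> bool"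
  assumes "AE p in unit_cube. P p"
  shows "AE p in unit_cube. P (snd p, fst p)"
proof -
  have "AE p in distr (I01 \<Otimes>\<^sub>M I01) (I01 \<Otimes>\<^sub>M I01) (\<lambda>(x, y). (y, x)). P p"
    using assms unfolding unit_cube_pair by (subst I01_pair.distr_pair_swap[symmetric])
  from AE_distrD[OF measurable_pair_swap' this] show ?thesis
    unfolding unit_cube_pair by (simp only: case_prod_beta)
qed

lemma AE_pair_snd: "AE y in I01. P y \<Longrightarrow> AE p in unit_cube. P (snd (p :: real \<times> real))"
  using AE_pair_swap[OF AE_pair_fst] by simp

lemma AE_pair_iterated:
  assumes "AE p in unit_cube. P p"
  shows "AE x in I01. AE y in I01. P (x, y :: real)" "AE y in I01. AE x in I01. P (x, y)"
  using I01_pair.AE_pair[OF assms[unfolded unit_cube_pair]]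
    I01_pair.AE_pair[OF AE_pair_swap[OF assms, unfolded unit_cube_pair]]
  by simp_all

text \<open>The inner integral is over x, because differentiation in x is studied on slices with
  fixed y.\<close>

lemma
  fixes f :: "real \<times> real \<Rightarrow> 'b::{banach, second_countable_topology}"
  assumes "integrable unit_cube f"
  shows integral_unit_cube_iterated: "(LINT p|unit_cube. f p) = (LINT y|I01. LINT x|I01. f (x, y))"
    and integrable_slice_integral: "integrable I01 (\<lambda>y. LINT x|I01. f (x, y))"
    and AE_integrable_slice: "AE y in I01. integrable I01 (\<lambda>x. f (x, y))"
  using I01_pair.integral_snd[of "\<lambda>x y. f (x, y)"] I01_pair.integrable_snd[of "\<lambda>x y. f (x, y)"]
    I01_pair.AE_integrable_snd[of "\<lambda>x y. f (x, y)"] assms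
  by (simp_all add: unit_cube_pair)

section \<open>Products of functions of one variable\<close>

lemma integrable_tensor:
  fixes f g :: "real \<Rightarrow> complex"
  assumes "integrable I01 f" "integrable I01 g"
  shows "integrable unit_cube (\<lambda>p. f (fst p) * g (snd p))"
  unfolding unit_cube_pair
proof (rule I01_pair.Fubini_integrable)
  note [measurable] = borel_measurable_integrable[OF assms(1)] borel_measurable_integrable[OF assms(2)]
  show "(\<lambda>p. f (fst p) * g (snd p)) \<in> borel_measurable (I01 \<Otimes>\<^sub>M I01)" by measurable
  show "integrable I01 (\<lambda>x. LINT y|I01. norm (f (fst (x, y)) * g (snd (x, y))))"
    using assms by (simp add: norm_mult)
  show "AE x in I01. integrable I01 (\<lambda>y. f (fst (x, y)) * g (snd (x, y)))"
    using assms by simp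
qed

lemma integral_tensor:
  fixes f g :: "real \<Rightarrow> complex"
  assumes "integrable I01 f" "integrable I01 g"
  shows "(LINT p|unit_cube. f (fst p) * g (snd p)) = (LINT x|I01. f x) * (LINT y|I01. g y)"
  using I01_pair.integral_fst'[OF integrable_tensor[OF assms, unfolded unit_cube_pair]]
  by (simp add: unit_cube_pair)

lemma sq_int_tensor:
  fixes f g :: "real \<Rightarrow> complex"
  assumes "sq_int f" "sq_int g"
  shows "sq_int (\<lambda>p. f (fst p) * g (snd p))"
proof -
  note [measurable] = sq_int_measurable[OF assms(1)] sq_int_measurable[OF assms(2)]
  have "(\<lambda>p. f (fst p) * g (snd p)) \<in> borel_measurable unit_cube"
    unfolding unit_cube_pair by measurable
  \<comment> \<open>The squared moduli are treated as complex functions, so that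
    \<open>integrable_tensor\<close> applies, and then returned to the reals.\<close>
  moreover have "integrable unit_cube (\<lambda>p. complex_of_real ((cmod (f (fst p)))\<^sup>2) * complex_of_real ((cmod (g (snd p)))\<^sup>2))"
    using assms by (intro integrable_tensor integrable_of_real) (auto simp: sq_int_def)
  then have "integrable unit_cube (\<lambda>p. Re (complex_of_real ((cmod (f (fst p)))\<^sup>2) * complex_of_real ((cmod (g (snd p)))\<^sup>2)))"
    by (rule integrable_Re)
  ultimately show ?thesis
    by (simp add: sq_int_def norm_mult power_mult_distrib)
qed

definition tensor :: "real L2 \<Rightarrow> real L2 \<Rightarrow> (real \<times> real) L2" (infixr "\<otimes>\<^sub>L" 76) where
  "u \<otimes>\<^sub>L v = abs_L2 (\<lambda>p. rep_L2 u (fst p) * rep_L2 v (snd p))"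

lemma tensor_abs:
  assumes "sq_int f" "sq_int g"
  shows "abs_L2 f \<otimes>\<^sub>L abs_L2 g = abs_L2 (\<lambda>p. f (fst p) * g (snd p))"
  unfolding tensor_def
proof (subst abs_L2_eq_iff)
  show "AE p in unit_cube. rep_L2 (abs_L2 f) (fst p) * rep_L2 (abs_L2 g) (snd p) = f (fst p) * g (snd p)"
    using AE_pair_fst[OF rep_abs_L2[OF assms(1)]] AE_pair_snd[OF rep_abs_L2[OF assms(2)]]
    by eventually_elim simp
qed (use assms in \<open>auto intro: sq_int_tensor\<close>)

lemma cinner_tensor: "cinner (u \<otimes>\<^sub>L v) (u' \<otimes>\<^sub>L v') = cinner u u' * cinner v v'"
proof -
  obtain f g f' g' where [simp]: "u = abs_L2 f" "v = abs_L2 g" "u' = abs_L2 f'" "v' = abs_L2 g'"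
    and sq: "sq_int f" "sq_int g" "sq_int f'" "sq_int g'"
    by (metis L2_cases)
  have "(\<lambda>p. f (fst p) * g (snd p) * cnj (f' (fst p) * g' (snd p)))
      = (\<lambda>p. (f (fst p) * cnj (f' (fst p))) * (g (snd p) * cnj (g' (snd p :: real))))"
    by (auto simp: fun_eq_iff)
  then show ?thesis
    using integral_tensor[OF sq_int_mult_integrable[OF sq(1,3)] sq_int_mult_integrable[OF sq(2,4)]]
    by (simp add: sq tensor_abs cinner_abs sq_int_tensor)
qed

lemma tensor_add_left: "(u + v) \<otimes>\<^sub>L w = u \<otimes>\<^sub>L w + v \<otimes>\<^sub>L w"
proof -
  obtain f g h where [simp]: "u = abs_L2 f" "v = abs_L2 g" "w = abs_L2 h"
    and sq: "sq_int f" "sq_int g" "sq_int h"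
    by (metis L2_cases)
  show ?thesis by (simp add: sq plus_abs sq_int_add tensor_abs sq_int_tensor distrib_right)
qed

lemma tensor_add_right: "u \<otimes>\<^sub>L (v + w) = u \<otimes>\<^sub>L v + u \<otimes>\<^sub>L w"
proof -
  obtain f g h where [simp]: "u = abs_L2 f" "v = abs_L2 g" "w = abs_L2 h"
    and sq: "sq_int f" "sq_int g" "sq_int h"
    by (metis L2_cases)
  show ?thesis by (simp add: sq plus_abs sq_int_add tensor_abs sq_int_tensor distrib_left)
qed

lemma tensor_scaleC_left: "(c *\<^sub>C u) \<otimes>\<^sub>L v = c *\<^sub>C (u \<otimes>\<^sub>L v)"
proof -
  obtain f g where [simp]: "u = abs_L2 f" "v = abs_L2 g" and sq: "sq_int f" "sq_int g"
    by (metis L2_cases)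
  show ?thesis by (simp add: sq scaleC_abs sq_int_cmult tensor_abs sq_int_tensor mult.assoc)
qed

lemma tensor_scaleC_right: "u \<otimes>\<^sub>L (c *\<^sub>C v) = c *\<^sub>C (u \<otimes>\<^sub>L v)"
proof -
  obtain f g where [simp]: "u = abs_L2 f" "v = abs_L2 g" and sq: "sq_int f" "sq_int g"
    by (metis L2_cases)
  show ?thesis by (simp add: sq scaleC_abs sq_int_cmult tensor_abs sq_int_tensor mult.left_commute)
qed

lemma tensor_diff_right: "u \<otimes>\<^sub>L (v - w) = u \<otimes>\<^sub>L v - u \<otimes>\<^sub>L w"
  using tensor_add_right[of u v "- w"] tensor_scaleC_right[of u "-1" w] by (simp add: uminus_L2_def minus_L2_def)

lemma tensor_zero [simp]: "0 \<otimes>\<^sub>L v = 0" "v \<otimes>\<^sub>L 0 = 0"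
  using tensor_scaleC_left[of 0 0 v] tensor_scaleC_right[of v 0 0] by simp_all

lemma norm_tensor: "norm (u \<otimes>\<^sub>L v) = norm u * norm v"
proof (rule power2_eq_imp_eq)
  have "complex_of_real ((norm (u \<otimes>\<^sub>L v))\<^sup>2) = complex_of_real ((norm u)\<^sup>2) * complex_of_real ((norm v)\<^sup>2)"
    by (simp only: cinner_self[symmetric] cinner_tensor)
  then show "(norm (u \<otimes>\<^sub>L v))\<^sup>2 = (norm u * norm v)\<^sup>2"
    by (simp only: of_real_mult[symmetric] of_real_eq_iff power_mult_distrib)
qed auto

lemma bounded_linear_tensor_left: "bounded_linear (\<lambda>u. u \<otimes>\<^sub>L v)"
  by (rule bounded_linear_intro[where K = "norm v"])
     (auto simp: tensor_add_left tensor_scaleC_left scaleR_scaleC norm_tensor)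

section \<open>Exchange of the two coordinates\<close>

lemma sq_int_swap:
  fixes f :: "real \<times> real \<Rightarrow> complex"
  assumes "sq_int f"
  shows "sq_int (\<lambda>p. f (snd p, fst p))"
proof -
  note [measurable] = sq_int_measurable[OF assms, unfolded unit_cube_pair]
  have "(\<lambda>p. f (snd p, fst p)) \<in> borel_measurable unit_cube"
    unfolding unit_cube_pair by measurable
  moreover have "integrable unit_cube (\<lambda>p. (cmod (f (snd p, fst p)))\<^sup>2)"
    using assms I01_pair.integrable_product_swap[of "\<lambda>p. (cmod (f p))\<^sup>2"]
    by (simp add: sq_int_def unit_cube_pair case_prod_beta')
  ultimately show ?thesis by (simp add: sq_int_def)
qed

lemma integral_swap:
  fixes f :: "real \<times> real \<Rightarrow> complex"
  assumes "f \<in> borel_measurable unit_cube"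
  shows "(LINT p|unit_cube. f (snd p, fst p)) = (LINT p|unit_cube. f p)"
  using I01_pair.integral_product_swap[of f] assms by (simp add: unit_cube_pair case_prod_beta')

text \<open>The unitary that conjugates differentiation in y into differentiation in x; all facts
  about \<open>Q_op\<close> are transported from \<open>P_op\<close> by it.\<close>

definition swap_L2 :: "(real \<times> real) L2 \<Rightarrow> (real \<times> real) L2" where
  "swap_L2 f = abs_L2 (\<lambda>p. rep_L2 f (snd p, fst p))"

lemma swap_abs: "sq_int f \<Longrightarrow> swap_L2 (abs_L2 f) = abs_L2 (\<lambda>p. f (snd p, fst p))"
  unfolding swap_L2_def using AE_pair_swap[OF rep_abs_L2[of f]]
  by (subst abs_L2_eq_iff) (auto intro: sq_int_swap)

lemma swap_swap [simp]: "swap_L2 (swap_L2 f) = f"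
  by (rule L2_cases[of f]) (simp add: swap_abs sq_int_swap)

lemma swap_add: "swap_L2 (f + g) = swap_L2 f + swap_L2 g"
proof -
  obtain F G where [simp]: "f = abs_L2 F" "g = abs_L2 G" and sq: "sq_int F" "sq_int G"
    by (metis L2_cases)
  show ?thesis by (simp add: sq plus_abs sq_int_add swap_abs sq_int_swap)
qed

lemma swap_scaleC: "swap_L2 (c *\<^sub>C f) = c *\<^sub>C swap_L2 f"
  by (rule L2_cases[of f]) (simp add: scaleC_abs sq_int_cmult swap_abs sq_int_swap)

lemma cinner_swap: "cinner (swap_L2 f) (swap_L2 g) = cinner f g"
proof -
  obtain F G where [simp]: "f = abs_L2 F" "g = abs_L2 G" and sq: "sq_int F" "sq_int G"
    by (metis L2_cases)
  have "(\<lambda>p. F p * cnj (G p)) \<in> borel_measurable unit_cube"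
    by (rule borel_measurable_integrable[OF sq_int_mult_integrable[OF sq]])
  from integral_swap[OF this] show ?thesis
    by (simp add: sq swap_abs cinner_abs sq_int_swap)
qed

lemma swap_tensor: "swap_L2 (u \<otimes>\<^sub>L v) = v \<otimes>\<^sub>L u"
proof -
  obtain f g where [simp]: "u = abs_L2 f" "v = abs_L2 g" and sq: "sq_int f" "sq_int g"
    by (metis L2_cases)
  show ?thesis by (simp add: sq tensor_abs sq_int_tensor swap_abs mult.commute)
qed

lemma norm_swap: "norm (swap_L2 f) = norm f"
  by (simp add: norm_eq_sqrt_inner inner_L2_def cinner_swap)

lemma bounded_linear_swap: "bounded_linear swap_L2"
  by (rule bounded_linear_intro[where K = 1])
     (auto simp: swap_add swap_scaleC scaleR_scaleC norm_swap)


section \<open>Completeness of the exponentials\<close>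

lemma unit_exp_add: "unit_exp (x + y) = unit_exp x * unit_exp y"
  by (simp add: unit_exp_def exp_add[symmetric] algebra_simps)

lemma unit_exp_0 [simp]: "unit_exp 0 = 1"
  by (simp add: unit_exp_def)

lemma norm_unit_exp [simp]: "cmod (unit_exp x) = 1"
  by (simp add: unit_exp_def)

lemma cnj_unit_exp: "cnj (unit_exp x) = unit_exp (- x)"
  by (simp add: unit_exp_def exp_cnj)

lemma unit_exp_nonzero [simp]: "unit_exp x \<noteq> 0"
  by (simp add: unit_exp_def)

lemma unit_exp_mult_cnj [simp]: "unit_exp x * cnj (unit_exp x) = 1" "cnj (unit_exp x) * unit_exp x = 1"
  by (simp_all add: cnj_unit_exp unit_exp_add[symmetric])

lemma unit_exp_int [simp]: "unit_exp (of_int n) = 1"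
  unfolding unit_exp_def exp_eq_1 by auto

lemma unit_exp_add_int [simp]: "unit_exp (x + of_int n) = unit_exp x"
  by (simp add: unit_exp_add)

lemma unit_exp_deriv [derivative_intros]:
  "((\<lambda>x. unit_exp (r * x)) has_vector_derivative 2 * pi * \<i> * r * unit_exp (r * x)) (at x within S)"
  unfolding unit_exp_def
  by (rule has_vector_derivative_eq_rhs, (rule derivative_eq_intros vector_derivative_chain_within refl
     has_vector_derivative_real_field has_complex_derivative_imp_has_vector_derivative | simp)+)

lemma continuous_on_unit_exp [continuous_intros]:
  "continuous_on S f \<Longrightarrow> continuous_on S (\<lambda>x. unit_exp (f x))"
  unfolding unit_exp_def by (intro continuous_intros)

lemma unit_exp_measurable [measurable]: "unit_exp \<in> borel_measurable borel"
  by (intro borel_measurable_continuous_onI continuous_intros)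

lemma borel_measurable_I01 [measurable (raw)]:
  "f \<in> borel_measurable borel \<Longrightarrow> f \<in> borel_measurable I01"
  unfolding unit_cube_def by (rule measurable_restrict_space1) simp

lemma continuous_on_I01_measurable:
  "continuous_on {0..1} f \<Longrightarrow> f \<in> borel_measurable I01"
  unfolding unit_cube_real using borel_measurable_continuous_on_restrict[of "{0..1}" f]
  by (simp add: measurable_def sets_restrict_space space_restrict_space)

lemma continuous_on_I01_bounded:
  fixes f :: "real \<Rightarrow> complex"
  assumes "continuous_on {0..1} f"
  obtains B where "AE x in I01. cmod (f x) \<le> B"
proof -
  obtain B where "\<And>x. x \<in> {0..1} \<Longrightarrow> cmod (f x) \<le> B"
    using compact_imp_bounded[OF compact_continuous_image[OF assms]] by (force simp: bounded_iff)
  then show ?thesis by (intro that[of B] AE_I2) auto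
qed

lemma sq_int_continuous:
  fixes f :: "real \<Rightarrow> complex"
  assumes "continuous_on {0..1} f" shows "sq_int f"
  using continuous_on_I01_bounded[OF assms] sq_int_bounded[OF continuous_on_I01_measurable[OF assms]]
  by blast

lemma integrable_mult_bounded:
  fixes f g :: "_ \<Rightarrow> complex"
  assumes f: "integrable M f" and [measurable]: "g \<in> borel_measurable M"
    and "AE x in M. cmod (g x) \<le> B"
  shows "integrable M (\<lambda>x. f x * g x)"
proof (rule Bochner_Integration.integrable_bound)
  show "integrable M (\<lambda>x. of_real B * f x)" using f by simp
  show "(\<lambda>x. f x * g x) \<in> borel_measurable M"
    using borel_measurable_integrable[OF f] by measurable
  show "AE x in M. norm (f x * g x) \<le> norm (of_real B * f x)"
    using assms(3) by (rule eventually_mono)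
      (auto simp: norm_mult mult.commute[of "cmod (f _)"] intro!: mult_right_mono)
qed

lemma borel_measurable_cnj [measurable (raw)]:
  "f \<in> borel_measurable M \<Longrightarrow> (\<lambda>x. cnj (f x)) \<in> borel_measurable M"
  by (rule borel_measurable_continuous_on[OF continuous_on_cnj[OF continuous_on_id]])

lemma integrable_mult_continuous:
  fixes f g :: "real \<Rightarrow> complex"
  assumes f: "integrable I01 f" and g: "continuous_on {0..1} g"
  shows "integrable I01 (\<lambda>x. f x * g x)"
proof -
  obtain B where "AE x in I01. cmod (g x) \<le> B" by (rule continuous_on_I01_bounded[OF g])
  then show ?thesis by (rule integrable_mult_bounded[OF f continuous_on_I01_measurable[OF g]])
qed

lemma integrable_continuous: "continuous_on {0..1} (g :: real \<Rightarrow> complex) \<Longrightarrow> integrable I01 g"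
  using integrable_mult_continuous[of "\<lambda>x. 1" g] by simp

section \<open>Uniform approximation by trigonometric polynomials\<close>

inductive trig_poly :: "(real \<Rightarrow> complex) \<Rightarrow> bool" where
  trig_exp: "trig_poly (\<lambda>x. unit_exp (of_int n * x))"
| trig_add: "trig_poly f \<Longrightarrow> trig_poly g \<Longrightarrow> trig_poly (\<lambda>x. f x + g x)"
| trig_cmult: "trig_poly f \<Longrightarrow> trig_poly (\<lambda>x. c * f x)"

lemma trig_const: "trig_poly (\<lambda>x. c)"
  using trig_cmult[OF trig_exp[of 0], of c] by simp

lemma trig_mult:
  assumes "trig_poly f" "trig_poly g"
  shows "trig_poly (\<lambda>x. f x * g x)"
  using assms(1)
proof induction
  case (trig_exp n)
  show ?case using assms(2)
  proof induction
    case (trig_exp m)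
    show ?case using trig_poly.trig_exp[of "n + m"] by (simp add: distrib_right unit_exp_add)
  next
    case (trig_add f g)
    then show ?case using trig_poly.trig_add by (fastforce simp: distrib_left)
  next
    case (trig_cmult f c)
    then show ?case using trig_poly.trig_cmult[OF trig_cmult(2), of c] by (simp add: mult.left_commute)
  qed
next
  case (trig_add f g)
  then show ?case using trig_poly.trig_add by (fastforce simp: distrib_right)
next
  case (trig_cmult f c)
  then show ?case using trig_poly.trig_cmult[OF trig_cmult(2), of c] by (simp add: mult.assoc)
qed

lemma trig_Re_Im:
  "trig_poly (\<lambda>x. complex_of_real (Re (unit_exp x)))" "trig_poly (\<lambda>x. complex_of_real (Im (unit_exp x)))"
proof -
  have t: "trig_poly (\<lambda>x. unit_exp x)" "trig_poly (\<lambda>x. unit_exp (- x))"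
    using trig_exp[of 1] trig_exp[of "-1"] by simp_all
  have re: "complex_of_real (Re (unit_exp x)) = (1/2) * (unit_exp x + unit_exp (- x))" for x
    by (simp add: cnj_unit_exp[symmetric] complex_add_cnj)
  have im: "complex_of_real (Im (unit_exp x)) = (1/(2*\<i>)) * (unit_exp x + (-1) * unit_exp (- x))" for x
    by (simp add: cnj_unit_exp[symmetric] complex_diff_cnj complex_eq_iff)
  show "trig_poly (\<lambda>x. complex_of_real (Re (unit_exp x)))" "trig_poly (\<lambda>x. complex_of_real (Im (unit_exp x)))"
    unfolding re im by (intro trig_cmult trig_add t)+
qed

text \<open>A real linear functional of z is a combination of Re z and Im z, which are trigonometric
  on the circle; \<open>trig_mult\<close> then covers products.\<close>

lemma trig_real_polynomial:
  "real_polynomial_function p \<Longrightarrow> trig_poly (\<lambda>x. complex_of_real (p (unit_exp x)))"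
proof (induction rule: real_polynomial_function.induct)
  case (linear f)
  interpret f: bounded_linear f by fact
  have lin: "f z = Re z * f 1 + Im z * f \<i>" for z
  proof -
    have "f z = f (Re z *\<^sub>R 1 + Im z *\<^sub>R \<i>)" by (rule arg_cong[of _ _ f]) (simp add: complex_eq_iff)
    then show ?thesis by (simp add: f.add f.scaleR)
  qed
  have eq: "(\<lambda>x. complex_of_real (f (unit_exp x))) = (\<lambda>x. complex_of_real (f 1) * complex_of_real (Re (unit_exp x))
      + complex_of_real (f \<i>) * complex_of_real (Im (unit_exp x)))"
    by (rule ext) (subst lin, simp)
  show ?case unfolding eq by (intro trig_add trig_cmult trig_Re_Im)
next
  case (const c)
  show ?case by (rule trig_const)
next
  case (add f g)
  then show ?case using trig_add by fastforce
next
  case (mult f g)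
  then show ?case using trig_mult by fastforce
qed

text \<open>Equal end values make \<open>g\<close> a continuous function on the circle, where the
  Stone-Weierstrass theorem yields a polynomial in the real and imaginary parts.\<close>

lemma trig_approx:
  assumes g: "continuous_on {0..1} g" "g 0 = g 1" and e: "0 < e"
  obtains t where "trig_poly t" "\<And>x. x \<in> {0..1} \<Longrightarrow> cmod (g x - t x) < e"
proof -
  let ?h = "g \<circ> (\<lambda>z. Arg2pi z / (2 * pi))"
  \<comment> \<open>The correspondence between loops and circle maps, applied to the constant
    homotopy, yields continuity on the whole circle, including the point 1 where
    \<open>Arg2pi\<close> jumps.\<close>
  have "homotopic_loops UNIV g g"
    using g by (simp add: homotopic_loops_refl path_def pathfinish_def pathstart_def)
  then have "continuous_on (sphere 0 1) ?h"
    by (rule homotopic_with_imp_continuous[OF homotopic_loops_imp_homotopic_circlemaps, THEN conjunct1])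
  then obtain q where q: "polynomial_function q" "\<And>z. z \<in> sphere 0 1 \<Longrightarrow> cmod (?h z - q z) < e"
    using Stone_Weierstrass_polynomial_function[OF compact_sphere _ e] by metis
  define t where "t x = q (unit_exp x)" for x
  have "real_polynomial_function (Re \<circ> q)" "real_polynomial_function (Im \<circ> q)"
    using q(1) bounded_linear_Re bounded_linear_Im by (auto simp: polynomial_function_def)
  then have "trig_poly (\<lambda>x. complex_of_real ((Re \<circ> q) (unit_exp x)) + \<i> * complex_of_real ((Im \<circ> q) (unit_exp x)))"
    by (intro trig_add trig_cmult trig_real_polynomial)
  then have "trig_poly t"
    by (simp add: t_def[abs_def] complex_eq[symmetric])
  moreover have "cmod (g x - t x) < e" if "x \<in> {0..1}" for x
  proof -
    have "?h (unit_exp x) = g x"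
    proof (cases "x = 1")
      case True
      moreover have "Arg2pi 1 = 0" by (rule Arg2pi_unique[of 1]) auto
      ultimately show ?thesis using g(2) unit_exp_int[of 1] by simp
    next
      case False
      have "unit_exp x = of_real 1 * exp (\<i> * of_real (2 * pi * x))"
        by (simp add: unit_exp_def mult_ac)
      then have "Arg2pi (unit_exp x) = 2 * pi * x"
        using that False by (intro Arg2pi_unique) auto
      then show ?thesis by simp
    qed
    then show ?thesis using q(2)[of "unit_exp x"] by (simp add: t_def)
  qed
  ultimately show ?thesis using that by blast
qed

section \<open>Uniqueness of Fourier coefficients\<close>

lemma integral_trig_poly_eq_0:
  assumes f: "integrable I01 f"
    and 0: "\<And>n :: int. (LINT x|I01. f x * cnj (unit_exp (of_int n * x))) = 0"
    and "trig_poly t"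
  shows "integrable I01 (\<lambda>x. f x * t x) \<and> (LINT x|I01. f x * t x) = 0"
  using assms(3)
proof induction
  case (trig_exp n)
  have "integrable I01 (\<lambda>x. f x * unit_exp (of_int n * x))"
    using f by (rule Bochner_Integration.integrable_bound) (use borel_measurable_integrable[OF f] in \<open>auto simp: norm_mult\<close>)
  then show ?case using 0[of "- n"] by (simp add: cnj_unit_exp)
next
  case (trig_add g h)
  then show ?case by (simp add: distrib_left)
next
  case (trig_cmult g c)
  then show ?case by (simp add: mult.left_commute)
qed

lemma integral_periodic_eq_0:
  assumes f: "integrable I01 f"
    and 0: "\<And>n :: int. (LINT x|I01. f x * cnj (unit_exp (of_int n * x))) = 0"
    and g: "continuous_on {0..1} g" "g 0 = g 1"
  shows "(LINT x|I01. f x * g x) = 0"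
proof (rule ccontr)
  let ?I = "LINT x|I01. f x * g x" and ?J = "LINT x|I01. cmod (f x)"
  assume "?I \<noteq> 0"
  then have I: "cmod ?I > 0" by simp
  have J: "?J \<ge> 0" by (rule integral_nonneg_AE) simp
  \<comment> \<open>A uniform error \<open>e\<close> changes the integral by at most
    \<open>?J * e\<close>, which is at most half of its modulus; the summand 1 covers the case
    \<open>?J = 0\<close>.\<close>
  define e where "e = cmod ?I / (2 * (?J + 1))"
  have "e > 0" unfolding e_def using I J by (intro divide_pos_pos mult_pos_pos add_nonneg_pos) simp_all
  then obtain t where t: "trig_poly t" "\<And>x. x \<in> {0..1} \<Longrightarrow> cmod (g x - t x) < e"
    using trig_approx[OF g] by metis
  note ft = integral_trig_poly_eq_0[OF f 0 t(1)]
  have fg: "integrable I01 (\<lambda>x. f x * g x)"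
    by (rule integrable_mult_continuous[OF f g(1)])
  have "cmod ?I = cmod (LINT x|I01. f x * g x - f x * t x)"
    using fg ft by simp
  also have "\<dots> \<le> (LINT x|I01. cmod (f x * g x - f x * t x))"
    by (rule integral_norm_bound)
  also have "\<dots> \<le> (LINT x|I01. cmod (f x) * e)"
  proof (rule integral_mono)
    show "integrable I01 (\<lambda>x. cmod (f x * g x - f x * t x))" using fg ft by auto
    show "integrable I01 (\<lambda>x. cmod (f x) * e)" using f by simp
    show "cmod (f x * g x - f x * t x) \<le> cmod (f x) * e" if "x \<in> space I01" for x
      using t(2)[of x] that by (auto simp: right_diff_distrib[symmetric] norm_mult intro!: mult_left_mono)
  qed
  also have "\<dots> = ?J * e" by simp
  also have "\<dots> < cmod ?I"
  proof -
    have "?J * e \<le> (?J + 1) * e" using \<open>e > 0\<close> by simp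
    also have "\<dots> = cmod ?I / 2"
    proof -
      have "2 * (?J + 1) > 0" using J by (intro mult_pos_pos add_nonneg_pos) simp_all
      then have "2 * (?J + 1) \<noteq> 0" by (rule less_imp_neq[symmetric])
      then have "e * (2 * (?J + 1)) = cmod ?I"
        unfolding e_def by (rule nonzero_eq_divide_eq[THEN iffD1, OF _ refl])
      then show ?thesis by (simp add: algebra_simps)
    qed
    finally show ?thesis using I by linarith
  qed
  finally show False by simp
qed

lemma null_singleton_I01: "AE x in I01. x \<noteq> (a :: real)"
proof -
  have "AE x in lborel. x \<noteq> a" by (rule AE_lborel_singleton)
  then show ?thesis unfolding unit_cube_def
    by (subst AE_restrict_space_iff) auto
qed

text \<open>The integrals against continuous periodic functions vanish. Dominated convergence passes
  to open intervals, and these form an intersection-stable generator, so a Dynkin argument reaches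
  all Borel sets.\<close>

lemma Fourier_uniqueness:
  assumes f: "integrable I01 f"
    and 0: "\<And>n :: int. (LINT x|I01. f x * cnj (unit_exp (of_int n * x))) = 0"
  shows "AE x in I01. f x = 0"
proof (rule unit_cube.density_zero[OF f])
  note [measurable] = borel_measurable_integrable[OF f]
  \<comment> \<open>Removing the end points costs a null set and permits approximation by functions
    that vanish at 0 and 1, hence are periodic.\<close>
  define S where "S A = set_lebesgue_integral I01 (A \<inter> {0<..<1}) f" for A
  have sets: "A \<inter> {0<..<1} \<in> sets I01" if "A \<in> sets borel" for A
    using that by (auto simp: unit_cube_def sets_restrict_space_iff)
  have int: "set_integrable I01 (A \<inter> {0<..<1}) f" if "A \<in> sets borel" for A
    using integrable_mult_indicator[OF sets[OF that] f] by (simp add: set_integrable_def)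
  have ivl: "S {a<..<b} = 0" for a b
  proof -
    \<comment> \<open>The inner minimum is positive exactly on the intersection of (a, b) with (0,
      1); scaling by k and truncating at 1 gives continuous functions increasing to its
      indicator.\<close>
    define g where "g k x = min 1 (real k * max 0 (min (min (x - a) (b - x)) (min x (1 - x))))" for k x
    have "(\<lambda>k. LINT x|I01. f x * complex_of_real (g k x)) \<longlonglongrightarrow> S {a<..<b}"
      unfolding S_def set_lebesgue_integral_def
    proof (rule integral_dominated_convergence[where w = "\<lambda>x. cmod (f x)"])
      have "g k \<in> borel_measurable borel" for k unfolding g_def by measurable
      then have [measurable]: "g k \<in> borel_measurable I01" for k by measurable
      show "(\<lambda>x. f x * complex_of_real (g k x)) \<in> borel_measurable I01" for k by measurable
      show "(\<lambda>x. indicat_real ({a<..<b} \<inter> {0<..<1}) x *\<^sub>R f x) \<in> borel_measurable I01"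
        using int[of "{a<..<b}"] by (auto simp: set_integrable_def)
      show "AE x in I01. norm (f x * complex_of_real (g k x)) \<le> cmod (f x)" for k
        by (auto simp: norm_mult g_def intro!: mult_left_le)
      show "AE x in I01. (\<lambda>k. f x * complex_of_real (g k x)) \<longlonglongrightarrow> indicat_real ({a<..<b} \<inter> {0<..<1}) x *\<^sub>R f x"
      proof (rule AE_I2)
        fix x :: real
        let ?m = "min (min (x - a) (b - x)) (min x (1 - x))"
        have "(\<lambda>k. g k x) \<longlonglongrightarrow> indicator ({a<..<b} \<inter> {0<..<1}) x"
        proof (cases "?m > 0")
          case True
          then obtain N where N: "1 / ?m < real N" using reals_Archimedean2 by blast
          have "g k x = 1" if "k \<ge> N" for k
          proof -
            have "1 < real N * ?m" using N True by (simp only: pos_divide_less_eq)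
            also have "\<dots> \<le> real k * ?m" using True that by (intro mult_right_mono) auto
            finally show ?thesis using True by (simp add: g_def max_def)
          qed
          then have "eventually (\<lambda>k. g k x = 1) sequentially"
            by (auto simp: eventually_sequentially)
          moreover have "indicator ({a<..<b} \<inter> {0<..<1}) x = (1 :: real)" using True by (auto simp: indicator_def)
          ultimately show ?thesis by (auto intro: tendsto_eventually)
        next
          case False
          then have "max 0 ?m = 0" by linarith
          then have "g k x = 0" for k by (simp add: g_def)
          moreover have "indicator ({a<..<b} \<inter> {0<..<1}) x = (0 :: real)" using False by (auto simp: indicator_def)
          ultimately show ?thesis by simp
        qed
        then have "(\<lambda>k. f x * complex_of_real (g k x)) \<longlonglongrightarrow> f x * complex_of_real (indicator ({a<..<b} \<inter> {0<..<1}) x)"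
          by (intro tendsto_intros)
        then show "(\<lambda>k. f x * complex_of_real (g k x)) \<longlonglongrightarrow> indicat_real ({a<..<b} \<inter> {0<..<1}) x *\<^sub>R f x"
          by (simp add: scaleR_conv_of_real mult.commute)
      qed
    qed (use f in auto)
    moreover have "(LINT x|I01. f x * complex_of_real (g k x)) = 0" for k
      unfolding g_def by (rule integral_periodic_eq_0[OF f 0]) (auto intro!: continuous_intros)
    ultimately show ?thesis by (simp add: LIMSEQ_const_iff)
  qed
  have borel: "(borel :: real measure) = sigma UNIV (range (\<lambda>(a, b). {a<..<b}))"
    using borel_eq_box[where 'a = real] by (simp add: box_real)
  have S: "S A = 0" if "A \<in> sets borel" for A
  proof -
    have "Int_stable (range (\<lambda>(a::real, b). {a<..<b}))"
      by (auto simp: Int_stable_def image_iff)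
    moreover have "range (\<lambda>(a::real, b). {a<..<b}) \<subseteq> Pow UNIV" by simp
    moreover have "A \<in> sigma_sets UNIV (range (\<lambda>(a, b). {a<..<b}))"
      using that unfolding borel by simp
    ultimately show ?thesis
    proof (induction rule: sigma_sets_induct_disjoint)
      case (basic A)
      then show ?case using ivl by auto
    next
      case empty
      show ?case by (simp add: S_def set_lebesgue_integral_def)
    next
      case (compl A)
      then have A: "A \<in> sets borel" unfolding borel by simp
      have "S A + S (UNIV - A) = S {0<..<1}"
        unfolding S_def using A int[of A] int[of "UNIV - A"]
        by (subst set_integral_Un[symmetric]) (auto intro!: arg_cong[where f = "\<lambda>A. set_lebesgue_integral I01 A f"])
      then show ?case using compl ivl by simp
    next
      case (union A)
      then have A: "A i \<in> sets borel" for i unfolding borel by auto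
      have "S (\<Union>i. A i) = (\<Sum>i. S (A i))"
      proof -
        have eq: "(\<Union>i. A i) \<inter> {0<..<1} = (\<Union>i. A i \<inter> {0<..<1})" by blast
        show ?thesis
          unfolding S_def eq
        proof (rule lebesgue_integral_countable_add)
          show "A i \<inter> {0<..<1} \<in> sets I01" for i by (rule sets[OF A])
          show "(A i \<inter> {0<..<1}) \<inter> (A j \<inter> {0<..<1}) = {}" if "i \<noteq> j" for i j
            using union(1) that by (auto simp: disjoint_family_on_def)
          show "set_integrable I01 (\<Union>i. A i \<inter> {0<..<1}) f"
            using int[of "\<Union>i. A i"] A by (simp add: eq[symmetric])
        qed
      qed
      then show ?case using union by simp
    qed
  qed
  fix A assume "A \<in> sets I01"
  then have A: "A \<in> sets borel" by (auto simp: unit_cube_def sets_restrict_space_iff)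
  have "set_lebesgue_integral I01 A f = S A"
    unfolding set_lebesgue_integral_def S_def
  proof (rule integral_cong_AE)
    show "(\<lambda>x. indicat_real (A \<inter> {0<..<1}) x *\<^sub>R f x) \<in> borel_measurable I01"
      using int[OF A] by (auto simp: set_integrable_def)
    show "(\<lambda>x. indicat_real A x *\<^sub>R f x) \<in> borel_measurable I01"
      using \<open>A \<in> sets I01\<close> by measurable
    show "AE x in I01. indicat_real A x *\<^sub>R f x = indicat_real (A \<inter> {0<..<1}) x *\<^sub>R f x"
      using null_singleton_I01[of 0] null_singleton_I01[of 1] AE_space
      by eventually_elim (auto simp: indicator_def)
  qed
  then show "set_lebesgue_integral I01 A f = 0" using S[OF A] by simp
qed

section \<open>Total families of bounded functions\<close>

text \<open>Testing with integrable functions suits the slices and partial integrals delivered by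
  Fubini; boundedness of the family keeps the products integrable.\<close>

definition L1_total :: "(int \<Rightarrow> real \<Rightarrow> complex) \<Rightarrow> bool" where
  "L1_total \<phi> \<longleftrightarrow> (\<forall>m. \<phi> m \<in> borel_measurable I01 \<and> (\<exists>B. \<forall>x\<in>{0..1}. cmod (\<phi> m x) \<le> B)) \<and>
    (\<forall>h. integrable I01 h \<longrightarrow> (\<forall>m. (LINT x|I01. h x * cnj (\<phi> m x)) = 0) \<longrightarrow> (AE x in I01. h x = 0))"


lemma L1_totalD:
  assumes "L1_total \<phi>" "integrable I01 h" "\<And>m. (LINT x|I01. h x * cnj (\<phi> m x)) = 0"
  shows "AE x in I01. h x = 0"
  using assms by (auto simp: L1_total_def)

lemma L1_total_measurable: "L1_total \<phi> \<Longrightarrow> \<phi> m \<in> borel_measurable I01"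
  by (auto simp: L1_total_def)

lemma L1_total_bounded: "L1_total \<phi> \<Longrightarrow> \<exists>B. \<forall>x\<in>{0..1}. cmod (\<phi> m x) \<le> B"
  by (auto simp: L1_total_def)

lemma L1_total_sq_int: "L1_total \<phi> \<Longrightarrow> sq_int (\<phi> m)"
  using L1_total_bounded[of \<phi> m] L1_total_measurable[of \<phi> m]
  by (auto intro!: sq_int_bounded AE_I2)

text \<open>The weight is moved onto the tested function and divided out at the end, where it is
  nonzero almost everywhere.\<close>

lemma L1_total_mult:
  assumes \<phi>: "L1_total \<phi>" and w: "w \<in> borel_measurable I01" "\<And>x. x \<in> {0..1} \<Longrightarrow> cmod (w x) \<le> C"
    and nz: "AE x in I01. w x \<noteq> 0"
  shows "L1_total (\<lambda>m x. w x * \<phi> m x)"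
  unfolding L1_total_def
proof (intro conjI allI impI)
  fix m
  show "(\<lambda>x. w x * \<phi> m x) \<in> borel_measurable I01"
    using w(1) L1_total_measurable[OF \<phi>] by measurable
  obtain B where B: "\<forall>x\<in>{0..1}. cmod (\<phi> m x) \<le> B" using L1_total_bounded[OF \<phi>] by auto
  have "cmod (w x * \<phi> m x) \<le> C * B" if "x \<in> {0..1}" for x
    unfolding norm_mult using that B w(2)[OF that] by (intro mult_mono) (auto intro: order_trans[OF norm_ge_zero])
  then show "\<exists>B. \<forall>x\<in>{0..1}. cmod (w x * \<phi> m x) \<le> B" by blast
next
  fix h assume h: "integrable I01 h" and 0: "\<forall>m. (LINT x|I01. h x * cnj (w x * \<phi> m x)) = 0"
  have "integrable I01 (\<lambda>x. h x * cnj (w x))"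
    using w by (intro integrable_mult_bounded[OF h, where B = C]) auto
  moreover have "(LINT x|I01. h x * cnj (w x) * cnj (\<phi> m x)) = 0" for m
    using 0 by (simp add: mult.assoc)
  ultimately have "AE x in I01. h x * cnj (w x) = 0"
    by (rule L1_totalD[OF \<phi>])
  then show "AE x in I01. h x = 0" using nz by eventually_elim simp
qed

lemma L1_total_unit_exp_int: "L1_total (\<lambda>m x. unit_exp (of_int m * x))"
  unfolding L1_total_def by (auto intro: Fourier_uniqueness exI[of _ 1])

lemma L1_total_unit_exp: "L1_total (\<lambda>m x. unit_exp ((\<alpha> + of_int m) * x))"
  using L1_total_mult[OF L1_total_unit_exp_int, of "\<lambda>x. unit_exp (\<alpha> * x)" 1]
  by (simp add: distrib_right unit_exp_add)

lemma L1_total_L2: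
  assumes "L1_total \<phi>" "\<And>m. cinner f (abs_L2 (\<phi> m)) = 0"
  shows "f = 0"
proof -
  have "AE x in I01. rep_L2 f x = 0"
  proof (rule L1_totalD[OF assms(1)])
    show "integrable I01 (rep_L2 f)" by (simp add: sq_int_integrable)
    show "(LINT x|I01. rep_L2 f x * cnj (\<phi> m x)) = 0" for m
      using assms(2)[of m] cinner_abs[OF sq_int_rep[of f] L1_total_sq_int[OF assms(1)]] by simp
  qed
  then have "abs_L2 (rep_L2 f) = abs_L2 (\<lambda>x. 0)"
    by (subst abs_L2_eq_iff) auto
  then show ?thesis by (simp add: zero_abs)
qed

text \<open>Fubini in two stages: for each m the partial integral against \<open>\<phi> m\<close>
  vanishes by totality of \<open>\<psi> m\<close>, and then almost every slice vanishes by totality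
  of \<open>\<phi>\<close>. Letting \<open>\<psi>\<close> depend on m accommodates phases
  \<open>\<beta> m\<close> that vary with the other index.\<close>

lemma L1_total_tensor:
  assumes \<phi>: "L1_total \<phi>" and \<psi>: "\<And>m. L1_total (\<psi> m)"
    and 0: "\<And>m n. cinner f (abs_L2 (\<phi> m) \<otimes>\<^sub>L abs_L2 (\<psi> m n)) = 0"
  shows "f = 0"
proof -
  define F where "F = rep_L2 f"
  have F: "sq_int F" "abs_L2 F = f" by (simp_all add: F_def)
  have Fi: "integrable unit_cube F" by (rule sq_int_integrable[OF F(1)])
  note [measurable] = borel_measurable_integrable[OF Fi, unfolded unit_cube_pair]
    L1_total_measurable[OF \<phi>] L1_total_measurable[OF \<psi>]
  define G where "G m y = (LINT x|I01. F (x, y) * cnj (\<phi> m x))" for m y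
  have Fphi: "integrable unit_cube (\<lambda>p. F p * cnj (\<phi> m (fst p)))" for m
  proof -
    obtain B where B: "\<forall>x\<in>{0..1}. cmod (\<phi> m x) \<le> B" using L1_total_bounded[OF \<phi>] by auto
    show ?thesis
      by (rule integrable_mult_bounded[OF Fi, where B = B])
        (use B in \<open>auto intro!: AE_I2 simp: unit_cube_pair space_pair_measure\<close>)
  qed
  have Gi: "integrable I01 (G m)" for m
    unfolding G_def using integrable_slice_integral[OF Fphi[of m]] by simp
  have "AE y in I01. G m y = 0" for m
  proof (rule L1_totalD[OF \<psi> Gi])
    fix n
    obtain B where B: "\<forall>x\<in>{0..1}. cmod (\<psi> m n x) \<le> B" using L1_total_bounded[OF \<psi>] by blast
    have "integrable unit_cube (\<lambda>p. F p * cnj (\<phi> m (fst p)) * cnj (\<psi> m n (snd p)))"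
      by (rule integrable_mult_bounded[OF Fphi, where B = B])
        (use B in \<open>auto intro!: AE_I2 simp: unit_cube_pair space_pair_measure\<close>)
    from integral_unit_cube_iterated[OF this]
    have "(LINT y|I01. G m y * cnj (\<psi> m n y)) = (LINT p|unit_cube. F p * cnj (\<phi> m (fst p)) * cnj (\<psi> m n (snd p)))"
      by (simp add: G_def)
    also have "\<dots> = cinner f (abs_L2 (\<phi> m) \<otimes>\<^sub>L abs_L2 (\<psi> m n))"
      using cinner_abs[OF F(1) sq_int_tensor[OF L1_total_sq_int[OF \<phi>, of m] L1_total_sq_int[OF \<psi>, of m n]]]
      by (simp add: tensor_abs L1_total_sq_int[OF \<phi>] L1_total_sq_int[OF \<psi>] F(2) mult.assoc)
    finally show "(LINT y|I01. G m y * cnj (\<psi> m n y)) = 0" using 0 by simp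
  qed
  \<comment> \<open>The integers are countable, so a single null set serves all m.\<close>
  then have "AE y in I01. \<forall>m. G m y = 0"
    by (simp add: AE_all_countable)
  then have "AE y in I01. AE x in I01. F (x, y) = 0"
    using AE_integrable_slice[OF Fi] by eventually_elim (auto simp: G_def intro: L1_totalD[OF \<phi>])
  then have "AE x in I01. AE y in I01. F (x, y) = 0"
    by (subst I01_pair.AE_commute) simp_all
  then have "AE p in unit_cube. F p = 0"
    unfolding unit_cube_pair by (intro I01_pair.AE_pair_measure) simp_all
  then have "abs_L2 F = abs_L2 (\<lambda>x. 0)"
    using F(1) by (subst abs_L2_eq_iff) auto
  then show ?thesis by (simp add: zero_abs F(2))
qed

lemma sq_int_unit_exp [simp]: "sq_int (\<lambda>x. unit_exp (r * x))"
  by (rule sq_int_bounded[where B = 1]) auto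

lemma L1_total_exp_fun:
  assumes "\<And>m. cinner f (exp_fun (\<alpha> + of_int m)) = 0"
  shows "f = 0"
  by (rule L1_total_L2[OF L1_total_unit_exp[of \<alpha>]]) (use assms in \<open>simp add: exp_fun_def\<close>)

lemma exp_fun_tensor_total:
  assumes "\<And>m n. cinner f (exp_fun (\<alpha> + of_int m) \<otimes>\<^sub>L exp_fun (\<beta> m + of_int n)) = 0"
  shows "f = 0"
  by (rule L1_total_tensor[where \<psi> = "\<lambda>m n x. unit_exp ((\<beta> m + of_int n) * x)",
      OF L1_total_unit_exp[of \<alpha>] L1_total_unit_exp])
    (use assms in \<open>simp add: exp_fun_def\<close>)

lemma norm_exp_fun [simp]: "norm (exp_fun r) = 1"
  unfolding exp_fun_def
  by (rule power2_eq_imp_eq) (simp_all add: norm_abs_L2 measure_space_unit_cube[where 'a = real, simplified])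

text \<open>The numerator vanishes exactly when r - s is an integer. This gives orthogonality for
  integer shifts, and the nonzero overlaps by which \<open>V\<close> is later seen to be
  scalar.\<close>

lemma cinner_exp_fun:
  assumes "r \<noteq> s"
  shows "cinner (exp_fun r) (exp_fun s) = (unit_exp (r - s) - 1) / (2 * pi * \<i> * (r - s))"
proof -
  have "((\<lambda>x. 2 * pi * \<i> * of_real (r - s) * unit_exp ((r - s) * x)) has_integral
      unit_exp ((r - s) * 1) - unit_exp ((r - s) * 0)) {0..1}"
  proof (rule fundamental_theorem_of_calculus)
    show "((\<lambda>x. unit_exp ((r - s) * x)) has_vector_derivative
        2 * pi * \<i> * of_real (r - s) * unit_exp ((r - s) * x)) (at x within {0..1})" for x
      by (rule unit_exp_deriv)
  qed simp
  then have "((\<lambda>x. (2 * pi * \<i> * of_real (r - s) * unit_exp ((r - s) * x)) / (2 * pi * \<i> * of_real (r - s))) has_integral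
      (unit_exp ((r - s) * 1) - unit_exp ((r - s) * 0)) / (2 * pi * \<i> * of_real (r - s))) {0..1}"
    by (rule has_integral_divide)
  then have 1: "((\<lambda>x. unit_exp ((r - s) * x)) has_integral
      (unit_exp (r - s) - 1) / (2 * pi * \<i> * (r - s))) {0..1}"
    using assms by simp
  have "set_integrable lborel {0..1} (\<lambda>x. unit_exp ((r - s) * x))"
    unfolding set_integrable_def
    by (intro borel_integrable_compact continuous_intros) auto
  from has_integral_unique[OF 1] set_borel_integral_eq_integral[OF this]
  have "(LINT x:{0..1}|lborel. unit_exp ((r - s) * x)) = (unit_exp (r - s) - 1) / (2 * pi * \<i> * (r - s))"
    using integral_unique[OF 1] by simp
  moreover have "(LINT x|I01. unit_exp ((r - s) * x)) = (LINT x:{0..1}|lborel. unit_exp ((r - s) * x))"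
    unfolding unit_cube_real set_lebesgue_integral_def by (subst integral_restrict_space) auto
  ultimately show ?thesis
    unfolding exp_fun_def
    by (simp add: cinner_abs cnj_unit_exp unit_exp_add[symmetric] left_diff_distrib)
qed


section \<open>Unitary groups and their generators\<close>

lemma
  assumes "unitary_op U"
  shows unitary_add: "U (f + g) = U f + U g"
    and unitary_scaleC: "U (c *\<^sub>C f) = c *\<^sub>C U f"
    and unitary_cinner: "cinner (U f) (U g) = cinner f g"
    and unitary_surj: "\<exists>f. U f = h"
  using assms unfolding unitary_op_def surj_def by (blast, blast, blast, metis)

lemma unitary_norm: "unitary_op U \<Longrightarrow> norm (U f) = norm f"
  by (simp add: norm_eq_sqrt_inner inner_L2_def unitary_cinner)

lemma unitary_diff: "unitary_op U \<Longrightarrow> U (f - g) = U f - U g"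
  using unitary_add[of U f "- g"] unitary_scaleC[of U "-1" g] by (simp add: uminus_L2_def minus_L2_def)

lemma unitary_bounded_linear: "unitary_op U \<Longrightarrow> bounded_linear U"
  by (rule bounded_linear_intro[where K = 1])
     (auto simp: unitary_add unitary_scaleC scaleR_scaleC unitary_norm)

lemma bounded_bilinear_cinner: "bounded_bilinear cinner"
proof
  show "\<exists>K. \<forall>a b. norm (cinner a b) \<le> norm a * norm b * K"
    by (intro exI[of _ 1]) (simp add: cinner_bound)
qed (simp_all add: cinner_simps scaleR_scaleC scaleR_conv_of_real)

context
  fixes A :: "('a::euclidean_space L2 \<times> 'a L2) set" and W
  assumes W: "is_exp_group A W"
begin

lemma exp_group_unitary: "unitary_op (W t)"
  using W by (simp add: is_exp_group_def)

lemma exp_group_0: "W 0 f = f"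
  using W by (simp add: is_exp_group_def)

lemma exp_group_add: "W (s + t) f = W s (W t f)"
  using W by (simp add: is_exp_group_def)

lemma exp_group_inverse: "W t (W (- t) f) = f" "W (- t) (W t f) = f"
  using exp_group_add[of t "- t" f] exp_group_add[of "- t" t f] by (simp_all add: exp_group_0)

lemma exp_group_generator:
  "(f, g) \<in> A \<longleftrightarrow> ((\<lambda>t. W t f) has_vector_derivative (2 * pi * \<i>) *\<^sub>C g) (at 0)"
  using W by (simp add: is_exp_group_def)

lemma exp_group_adjoint: "cinner (W t f) g = cinner f (W (- t) g)"
  using unitary_cinner[OF exp_group_unitary[of t], of f "W (- t) g"] by (simp add: exp_group_inverse)

text \<open>The inner product of the two orbits is constant in time. In its derivative at 0 the
  factor 2 pi i changes sign in the conjugate-linear second argument.\<close>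

lemma exp_group_symmetric:
  assumes "(f, g) \<in> A" "(f', g') \<in> A"
  shows "cinner g f' = cinner f g'"
proof -
  have "((\<lambda>t. cinner (W t f) (W t f')) has_vector_derivative
      cinner (W 0 f) ((2 * pi * \<i>) *\<^sub>C g') + cinner ((2 * pi * \<i>) *\<^sub>C g) (W 0 f')) (at 0)"
    using assms unfolding exp_group_generator
    by (intro bounded_bilinear.has_vector_derivative[OF bounded_bilinear_cinner])
  moreover have "((\<lambda>t. cinner (W t f) (W t f')) has_vector_derivative 0) (at 0)"
    by (simp add: unitary_cinner[OF exp_group_unitary])
  ultimately have "cinner (W 0 f) ((2 * pi * \<i>) *\<^sub>C g') + cinner ((2 * pi * \<i>) *\<^sub>C g) (W 0 f') = 0"
    by (rule vector_derivative_unique_at)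
  then have "(2 * pi * \<i>) * (cinner g f' - cinner f g') = 0"
    by (simp add: exp_group_0 cinner_simps algebra_simps)
  then show ?thesis by simp
qed

text \<open>A bounded operator that commutes with the group may be applied inside the difference
  quotient.\<close>

lemma exp_group_invariant:
  assumes "bounded_linear T" "\<And>c f. T (c *\<^sub>C f) = c *\<^sub>C T f" "\<And>t f. T (W t f) = W t (T f)"
    and "(f, g) \<in> A"
  shows "(T f, T g) \<in> A"
  using bounded_linear.has_vector_derivative[OF assms(1) assms(4)[unfolded exp_group_generator]]
  by (simp only: exp_group_generator assms(2,3))

lemma exp_group_generator_scaleC: "(f, g) \<in> A \<Longrightarrow> (c *\<^sub>C f, c *\<^sub>C g) \<in> A"
  by (rule exp_group_invariant[of "\<lambda>f. c *\<^sub>C f"])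
     (auto simp: bounded_linear_scaleC_right mult.commute unitary_scaleC[OF exp_group_unitary])

text \<open>
  Since \<open>W s\<close> is isometric, the increments of $s \mapsto W(-s)F(s)$ have the same norm as those
  of $s \mapsto F(s) - W(s-t)F(t)$, whose derivative at \<open>t\<close> vanishes.
\<close>

lemma exp_group_curve:
  assumes S: "convex S" "0 \<in> S" "a \<in> S"
    and F: "\<And>t. t \<in> S \<Longrightarrow> (F has_vector_derivative (2 * pi * \<i>) *\<^sub>C G t) (at t within S)"
    and A: "\<And>t. t \<in> S \<Longrightarrow> (F t, G t) \<in> A"
  shows "F a = W a (F 0)"
proof -
  have "((\<lambda>s. W (- s) (F s)) has_vector_derivative 0) (at t within S)" if t: "t \<in> S" for t
  proof -
    define K where "K s = F s - W (s - t) (F t)" for s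
    have "((\<lambda>s. s - t) has_vector_derivative 1) (at t)"
      by (auto intro!: derivative_eq_intros)
    moreover have "((\<lambda>r. W r (F t)) has_vector_derivative (2 * pi * \<i>) *\<^sub>C G t) (at (t - t))"
      using A[OF t] by (simp add: exp_group_generator)
    ultimately have "(((\<lambda>r. W r (F t)) \<circ> (\<lambda>s. s - t)) has_vector_derivative 1 *\<^sub>R ((2 * pi * \<i>) *\<^sub>C G t)) (at t)"
      by (rule vector_diff_chain_at)
    then have "((\<lambda>s. W (s - t) (F t)) has_vector_derivative (2 * pi * \<i>) *\<^sub>C G t) (at t within S)"
      by (auto simp: o_def intro: has_vector_derivative_at_within)
    from has_vector_derivative_diff[OF F[OF t] this]
    have K: "(K has_vector_derivative 0) (at t within S)"
      by (simp add: K_def[abs_def])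
    have eq: "norm (W (- s) (F s) - W (- t) (F t)) = norm (K s - K t)" for s
    proof -
      have "norm (W (- s) (F s) - W (- t) (F t)) = norm (W s (W (- s) (F s) - W (- t) (F t)))"
        by (simp add: unitary_norm[OF exp_group_unitary])
      also have "W s (W (- s) (F s) - W (- t) (F t)) = K s - K t"
        using exp_group_add[of s "- t" "F t"]
        by (simp add: unitary_diff[OF exp_group_unitary] exp_group_inverse K_def exp_group_0)
      finally show ?thesis .
    qed
    have "((\<lambda>y. (1 / norm (y - t)) *\<^sub>R (K y - K t)) \<longlongrightarrow> 0) (at t within S)"
      using K by (simp add: has_vector_derivative_def has_derivative_within)
    then have "((\<lambda>y. norm ((1 / norm (y - t)) *\<^sub>R (K y - K t))) \<longlongrightarrow> 0) (at t within S)"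
      by (rule tendsto_norm_zero)
    then have "((\<lambda>y. norm ((1 / norm (y - t)) *\<^sub>R (W (- y) (F y) - W (- t) (F t)))) \<longlongrightarrow> 0) (at t within S)"
      by (simp add: eq)
    then have "((\<lambda>y. (1 / norm (y - t)) *\<^sub>R (W (- y) (F y) - W (- t) (F t))) \<longlongrightarrow> 0) (at t within S)"
      by (rule tendsto_norm_zero_cancel)
    then show ?thesis by (simp add: has_vector_derivative_def has_derivative_within)
  qed
  from has_vector_derivative_zero_constant[OF S(1) this]
  obtain c where "\<And>s. s \<in> S \<Longrightarrow> W (- s) (F s) = c" by blast
  then have "W (- a) (F a) = F 0"
    using S by (metis exp_group_0 minus_zero)
  then show ?thesis by (metis exp_group_inverse(1))
qed

text \<open>The phase curve stays in the domain and solves the evolution equation, so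
  \<open>exp_group_curve\<close> identifies it with the orbit.\<close>

lemma exp_group_eigenvector:
  assumes "(f, complex_of_real r *\<^sub>C f) \<in> A"
  shows "W t f = unit_exp (r * t) *\<^sub>C f"
proof -
  have "unit_exp (r * t) *\<^sub>C f = W t (unit_exp (r * 0) *\<^sub>C f)"
  proof (rule exp_group_curve[of UNIV])
    fix t
    have "((\<lambda>t. unit_exp (r * t) *\<^sub>C f) has_vector_derivative
        (2 * pi * \<i> * r * unit_exp (r * t)) *\<^sub>C f) (at t)"
      by (rule bounded_linear.has_vector_derivative[OF bounded_linear_scaleC_left unit_exp_deriv])
    then show "((\<lambda>t. unit_exp (r * t) *\<^sub>C f) has_vector_derivative
        (2 * pi * \<i>) *\<^sub>C (unit_exp (r * t) *\<^sub>C (complex_of_real r *\<^sub>C f))) (at t within UNIV)"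
      by (simp add: mult_ac)
    show "(unit_exp (r * t) *\<^sub>C f, unit_exp (r * t) *\<^sub>C (complex_of_real r *\<^sub>C f)) \<in> A"
      by (rule exp_group_generator_scaleC[OF assms])
  qed auto
  then show ?thesis by simp
qed

end

text \<open>Mean value inequality; it supplies a bound on difference quotients that is uniform in
  the time step.\<close>

lemma norm_unit_exp_minus_1_le: "cmod (unit_exp x - 1) \<le> 2 * pi * \<bar>x\<bar>"
proof -
  have "norm (unit_exp (1 * x) - unit_exp (1 * 0)) \<le> 2 * pi * norm (x - 0)"
  proof (rule differentiable_bound[of UNIV])
    show "((\<lambda>x. unit_exp (1 * x)) has_derivative (\<lambda>h. h *\<^sub>R (2 * pi * \<i> * 1 * unit_exp (1 * y)))) (at y within UNIV)" for y
      using unit_exp_deriv[of 1 y UNIV] by (simp add: has_vector_derivative_def)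
    show "onorm (\<lambda>h. h *\<^sub>R (2 * pi * \<i> * 1 * unit_exp (1 * y))) \<le> 2 * pi" for y
      by (rule onorm_le) (simp add: norm_mult)
  qed auto
  then show ?thesis by simp
qed

section \<open>Diagonal unitary groups in an orthonormal basis\<close>

context
  fixes E :: "nat \<Rightarrow> 'a::euclidean_space L2"
  assumes orth: "\<And>i j. cinner (E i) (E j) = (if i = j then 1 else 0)"
    and total: "\<And>f. (\<And>i. cinner f (E i) = 0) \<Longrightarrow> f = 0"
begin

lemma orth_cinner_sum:
  assumes "finite I"
  shows "cinner (\<Sum>i\<in>I. c i *\<^sub>C E i) (E j) = (if j \<in> I then c j else 0)"
  using assms by (simp add: cinner_sum_left cinner_simps orth if_distrib[of "\<lambda>x. _ * x"] sum.delta cong: if_cong)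

lemma orth_norm_sum:
  assumes "finite I"
  shows "(norm (\<Sum>i\<in>I. c i *\<^sub>C E i))\<^sup>2 = (\<Sum>i\<in>I. (cmod (c i))\<^sup>2)"
proof -
  let ?S = "\<Sum>i\<in>I. c i *\<^sub>C E i"
  have "complex_of_real ((norm ?S)\<^sup>2) = cinner ?S ?S"
    by (simp add: cinner_self)
  also have "\<dots> = (\<Sum>i\<in>I. c i * cnj (cinner ?S (E i)))"
    by (subst cinner_sum_left) (simp add: cinner_simps cinner_commute[of "E _" ?S])
  also have "\<dots> = (\<Sum>i\<in>I. complex_of_real ((cmod (c i))\<^sup>2))"
    by (rule sum.cong) (use assms in \<open>simp_all add: orth_cinner_sum complex_norm_square del: of_real_power\<close>)
  finally show ?thesis by (simp only: of_real_sum[symmetric] of_real_eq_iff)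
qed

lemma orth_summable:
  assumes "summable (\<lambda>i. (cmod (c i))\<^sup>2)"
  shows "summable (\<lambda>i. c i *\<^sub>C E i)"
  unfolding summable_Cauchy
proof (intro allI impI)
  fix e :: real assume "e > 0"
  then obtain N where N: "\<And>m n. m \<ge> N \<Longrightarrow> norm (\<Sum>i\<in>{m..<n}. (cmod (c i))\<^sup>2) < e\<^sup>2"
    using assms unfolding summable_Cauchy by (metis zero_less_power)
  have "norm (\<Sum>i\<in>{m..<n}. c i *\<^sub>C E i) < e" if "m \<ge> N" for m n
  proof (rule power2_less_imp_less)
    show "(norm (\<Sum>i\<in>{m..<n}. c i *\<^sub>C E i))\<^sup>2 < e\<^sup>2"
      using N[OF that, of n] by (simp add: orth_norm_sum)
  qed (use \<open>e > 0\<close> in simp)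
  then show "\<exists>N. \<forall>m\<ge>N. \<forall>n. norm (\<Sum>i\<in>{m..<n}. c i *\<^sub>C E i) < e" by blast
qed

lemma orth_suminf:
  assumes "summable (\<lambda>i. (cmod (c i))\<^sup>2)"
  shows "cinner (\<Sum>i. c i *\<^sub>C E i) (E j) = c j"
proof -
  have "(\<lambda>i. cinner (c i *\<^sub>C E i) (E j)) sums cinner (\<Sum>i. c i *\<^sub>C E i) (E j)"
    by (rule bounded_linear.sums[OF bounded_linear_cinner_left summable_sums[OF orth_summable[OF assms]]])
  moreover have "(\<lambda>i. cinner (c i *\<^sub>C E i) (E j)) = (\<lambda>i. if i = j then c i else 0)"
    by (auto simp: cinner_simps orth)
  ultimately show ?thesis using sums_single[of j c] by (auto intro: sums_unique2)
qed

text \<open>The remainder after projecting to finitely many basis vectors has squared norm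
  \<open>(norm f)\<^sup>2 - ?s\<close>, which bounds the partial sums.\<close>

lemma orth_Bessel: "summable (\<lambda>i. (cmod (cinner f (E i)))\<^sup>2)"
proof (rule bounded_imp_summable)
  fix n
  let ?S = "\<Sum>i\<in>{..n}. cinner f (E i) *\<^sub>C E i" and ?s = "\<Sum>i\<le>n. (cmod (cinner f (E i)))\<^sup>2"
  have S: "cinner ?S ?S = complex_of_real ?s"
    by (simp only: cinner_self orth_norm_sum[OF finite_atMost])
  have "cinner ?S f = (\<Sum>i\<le>n. cinner f (E i) * cnj (cinner f (E i)))"
    by (subst cinner_sum_left) (simp add: cinner_simps cinner_commute[of "E _" f])
  also have "\<dots> = complex_of_real ?s"
    by (simp only: of_real_sum complex_norm_square)
  finally have Sf: "cinner ?S f = complex_of_real ?s" .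
  have "complex_of_real ((norm (f - ?S))\<^sup>2) = cinner (f - ?S) (f - ?S)"
    by (simp only: cinner_self)
  also have "\<dots> = complex_of_real ((norm f)\<^sup>2) - complex_of_real ?s"
    by (simp only: cinner_diff_left cinner_diff_right S Sf cinner_commute[of f ?S] cinner_self[of f]) simp
  finally have "(norm (f - ?S))\<^sup>2 = (norm f)\<^sup>2 - ?s"
    by (simp only: of_real_diff[symmetric] of_real_eq_iff)
  then show "?s \<le> (norm f)\<^sup>2" using zero_le_power2[of "norm (f - ?S)"] by linarith
qed simp

lemma orth_eqI: "(\<And>i. cinner f (E i) = cinner g (E i)) \<Longrightarrow> f = g"
  using total[of "f - g"] by (simp add: cinner_simps)

lemma orth_expansion: "(\<lambda>i. cinner f (E i) *\<^sub>C E i) sums f"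
proof -
  have "(\<Sum>i. cinner f (E i) *\<^sub>C E i) = f"
    by (rule orth_eqI) (simp add: orth_suminf orth_Bessel)
  then show ?thesis using summable_sums[OF orth_summable[OF orth_Bessel[of f]]] by simp
qed

lemma orth_cinner_sums: "(\<lambda>i. cinner f (E i) * cnj (cinner g (E i))) sums cinner f g"
  using bounded_linear.sums[OF bounded_linear_cinner_left orth_expansion, of f g]
  by (simp add: cinner_simps cinner_commute[of "E _" g])

lemma orth_Parseval: "(\<lambda>i. (cmod (cinner f (E i)))\<^sup>2) sums (norm f)\<^sup>2"
proof -
  have "(\<lambda>i. complex_of_real ((cmod (cinner f (E i)))\<^sup>2)) sums complex_of_real ((norm f)\<^sup>2)"
    using orth_cinner_sums[of f f] by (simp only: complex_norm_square cinner_self)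
  then show ?thesis by (simp only: sums_of_real_iff)
qed

text \<open>Parseval turns the norm into a series, and Tannery's theorem exchanges limit and sum.
  The dominating coefficients come from a second vector \<open>g\<close>, since for difference
  quotients those of \<open>f\<close> would not suffice.\<close>

lemma orth_dominated_tendsto_0:
  fixes D :: "'b::t2_space \<Rightarrow> 'a L2"
  assumes D: "\<And>s i. cinner (D s) (E i) = q i s * cinner f (E i)"
    and bound: "\<And>i s. cmod (q i s * cinner f (E i)) \<le> C * cmod (cinner g (E i))"
    and q: "\<And>i. (q i \<longlongrightarrow> 0) (at t)" and t: "at t \<noteq> bot"
  shows "(D \<longlongrightarrow> 0) (at t)"
proof -
  have "((\<lambda>s. \<Sum>i. (cmod (q i s * cinner f (E i)))\<^sup>2) \<longlongrightarrow> (\<Sum>i. 0)) (at t)"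
  proof (rule tannerys_theorem[where M = "\<lambda>i. C\<^sup>2 * (cmod (cinner g (E i)))\<^sup>2", THEN conjunct2, THEN conjunct2])
    show "((\<lambda>s. (cmod (q i s * cinner f (E i)))\<^sup>2) \<longlongrightarrow> 0) (at t)" for i
      by (rule tendsto_eq_intros q refl | simp)+
    show "\<forall>\<^sub>F (i, s) in sequentially \<times>\<^sub>F at t. norm ((cmod (q i s * cinner f (E i)))\<^sup>2) \<le> C\<^sup>2 * (cmod (cinner g (E i)))\<^sup>2"
    proof (rule always_eventually, clarify)
      fix i s
      have "(cmod (q i s * cinner f (E i)))\<^sup>2 \<le> (C * cmod (cinner g (E i)))\<^sup>2"
        by (intro power_mono bound) simp
      then show "norm ((cmod (q i s * cinner f (E i)))\<^sup>2) \<le> C\<^sup>2 * (cmod (cinner g (E i)))\<^sup>2"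
        by (simp add: power_mult_distrib)
    qed
    show "summable (\<lambda>i. C\<^sup>2 * (cmod (cinner g (E i)))\<^sup>2)"
      by (intro summable_mult orth_Bessel)
  qed (rule t)
  then have "((\<lambda>s. sqrt ((norm (D s))\<^sup>2)) \<longlongrightarrow> sqrt 0) (at t)"
    by (intro tendsto_real_sqrt) (simp add: sums_unique[OF orth_Parseval] D)
  then show ?thesis by - (rule tendsto_norm_zero_cancel, simp)
qed

text \<open>The series is meaningful when the multiplied coefficients remain square summable; here
  the multipliers have modulus one.\<close>

definition diag_op :: "(nat \<Rightarrow> complex) \<Rightarrow> 'a L2 \<Rightarrow> 'a L2" where
  "diag_op d f = (\<Sum>i. (d i * cinner f (E i)) *\<^sub>C E i)"

lemma cinner_diag_op:
  assumes "\<And>i. cmod (d i) = 1"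
  shows "cinner (diag_op d f) (E i) = d i * cinner f (E i)"
  unfolding diag_op_def using orth_Bessel[of f] assms
  by (subst orth_suminf) (simp_all add: norm_mult)

lemma unitary_diag_op:
  assumes d: "\<And>i. cmod (d i) = 1"
  shows "unitary_op (diag_op d)"
  unfolding unitary_op_def
proof (intro conjI allI)
  note [simp] = cinner_diag_op[OF d]
  show "diag_op d (f + g) = diag_op d f + diag_op d g" for f g
    by (rule orth_eqI) (simp add: cinner_simps distrib_left)
  show "diag_op d (c *\<^sub>C f) = c *\<^sub>C diag_op d f" for c f
    by (rule orth_eqI) (simp add: cinner_simps)
  have dd: "d i * cnj (d i) = 1" for i
    using d[of i] by (simp add: complex_norm_square[symmetric])
  show "cinner (diag_op d f) (diag_op d g) = cinner f g" for f g
  proof -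
    have "d i * cinner f (E i) * cnj (d i * cinner g (E i)) = (d i * cnj (d i)) * (cinner f (E i) * cnj (cinner g (E i)))" for i
      by (simp add: mult_ac)
    then have "(\<lambda>i. cinner f (E i) * cnj (cinner g (E i))) sums cinner (diag_op d f) (diag_op d g)"
      using orth_cinner_sums[of "diag_op d f" "diag_op d g"] by (simp only: cinner_diag_op[OF d] dd mult_1_left)
    then show ?thesis using orth_cinner_sums[of f g] by (rule sums_unique2)
  qed
  have "diag_op d (diag_op (\<lambda>i. cnj (d i)) f) = f" for f
    by (rule orth_eqI) (simp add: cinner_diag_op d mult.assoc[symmetric] dd)
  then show "surj (diag_op d)" by (metis surjI)
qed

text \<open>The generator is the maximal multiplication operator. A derivative can be read off
  coordinatewise; conversely, existence of \<open>g\<close> says that the multiplied coefficients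
  are square summable, which is the domination needed for convergence of the difference
  quotients.\<close>

lemma diag_exp_group:
  fixes \<mu> :: "nat \<Rightarrow> real"
  shows "is_exp_group {(f, g). \<forall>i. cinner g (E i) = of_real (\<mu> i) * cinner f (E i)}
     (\<lambda>t. diag_op (\<lambda>i. unit_exp (\<mu> i * t)))"
proof -
  define W where "W t = diag_op (\<lambda>i. unit_exp (\<mu> i * t))" for t
  have W: "cinner (W t f) (E i) = unit_exp (\<mu> i * t) * cinner f (E i)" for t f i
    unfolding W_def by (rule cinner_diag_op) simp
  have W0: "W 0 f = f" for f
    by (rule orth_eqI) (simp add: W)
  have deriv_iff: "((\<lambda>t. W t f) has_vector_derivative (2 * pi * \<i>) *\<^sub>C g) (at 0) \<longleftrightarrow>
      (\<forall>i. cinner g (E i) = of_real (\<mu> i) * cinner f (E i))" for f g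
  proof safe
    fix i assume "((\<lambda>t. W t f) has_vector_derivative (2 * pi * \<i>) *\<^sub>C g) (at 0)"
    then have "((\<lambda>t. cinner (W t f) (E i)) has_vector_derivative cinner ((2 * pi * \<i>) *\<^sub>C g) (E i)) (at 0)"
      by (rule bounded_linear.has_vector_derivative[OF bounded_linear_cinner_left])
    moreover have "((\<lambda>t. cinner (W t f) (E i)) has_vector_derivative
        2 * pi * \<i> * \<mu> i * unit_exp (\<mu> i * 0) * cinner f (E i)) (at 0)"
      unfolding W by (intro has_vector_derivative_mult_left unit_exp_deriv)
    ultimately have "cinner ((2 * pi * \<i>) *\<^sub>C g) (E i) = 2 * pi * \<i> * \<mu> i * unit_exp (\<mu> i * 0) * cinner f (E i)"
      by (rule vector_derivative_unique_at)
    then show "cinner g (E i) = of_real (\<mu> i) * cinner f (E i)"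
      by (simp add: cinner_simps)
  next
    assume g: "\<forall>i. cinner g (E i) = of_real (\<mu> i) * cinner f (E i)"
    \<comment> \<open>The remainder of the difference quotient. At h = 0 both \<open>D\<close> and
      \<open>q\<close> are zero by the convention for division, so the coefficient formula holds for
      every h.\<close>
    define D where "D h = (W h f - f - h *\<^sub>R ((2 * pi * \<i>) *\<^sub>C g)) /\<^sub>R \<bar>h\<bar>" for h
    define q where "q i h = (unit_exp (\<mu> i * h) - 1 - h * (2 * pi * \<i> * \<mu> i)) / complex_of_real \<bar>h\<bar>" for i h
    have D: "cinner (D h) (E i) = q i h * cinner f (E i)" for h i
      unfolding D_def q_def scaleR_scaleC cinner_simps W using g
      by (cases "h = 0") (simp_all add: field_simps)
    \<comment> \<open>One summand 2 pi comes from the mean value bound, the other from the linear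
      term.\<close>
    have qb: "cmod (q i h) \<le> 4 * pi * \<bar>\<mu> i\<bar>" for i h
    proof (cases "h = 0")
      case False
      have "cmod (unit_exp (\<mu> i * h) - 1 - h * (2 * pi * \<i> * \<mu> i)) \<le> 2 * pi * \<bar>\<mu> i * h\<bar> + cmod (h * (2 * pi * \<i> * \<mu> i))"
        using norm_triangle_ineq4[of "unit_exp (\<mu> i * h) - 1" "h * (2 * pi * \<i> * \<mu> i)"]
          norm_unit_exp_minus_1_le[of "\<mu> i * h"] by linarith
      also have "\<dots> = 4 * pi * \<bar>\<mu> i\<bar> * \<bar>h\<bar>" by (simp add: norm_mult abs_mult)
      finally show ?thesis using False by (simp add: q_def norm_divide divide_le_eq)
    qed (simp add: q_def)
    have q0: "((\<lambda>h. q i h) \<longlongrightarrow> 0) (at 0)" for i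
    proof -
      have "((\<lambda>h. norm (unit_exp (\<mu> i * (0 + h)) - unit_exp (\<mu> i * 0) - h *\<^sub>R (2 * pi * \<i> * \<mu> i * unit_exp (\<mu> i * 0))) / norm h) \<longlongrightarrow> 0) (at 0)"
        using unit_exp_deriv[of "\<mu> i" 0 UNIV] unfolding has_vector_derivative_def has_derivative_at by blast
      then have "((\<lambda>h. norm (q i h)) \<longlongrightarrow> 0) (at 0)"
        by (simp add: q_def norm_divide scaleR_conv_of_real)
      then show ?thesis by (rule tendsto_norm_zero_cancel)
    qed
    have "(D \<longlongrightarrow> 0) (at 0)"
    proof (rule orth_dominated_tendsto_0[OF D _ q0])
      show "cmod (q i h * cinner f (E i)) \<le> 4 * pi * cmod (cinner g (E i))" for i h
        using mult_right_mono[OF qb[of i h], of "cmod (cinner f (E i))"] g by (simp add: norm_mult mult.assoc)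
    qed simp
    then have "((\<lambda>h. norm (D h)) \<longlongrightarrow> 0) (at 0)" by (rule tendsto_norm_zero)
    then have "((\<lambda>h. norm (W (0 + h) f - W 0 f - h *\<^sub>R ((2 * pi * \<i>) *\<^sub>C g)) / norm h) \<longlongrightarrow> 0) (at 0)"
      by (simp add: D_def W0 divide_inverse mult.commute)
    then show "((\<lambda>t. W t f) has_vector_derivative (2 * pi * \<i>) *\<^sub>C g) (at 0)"
      unfolding has_vector_derivative_def has_derivative_at
      by (auto intro: bounded_linear_scaleR_left)
  qed
  have cont: "((\<lambda>s. W s f) \<longlongrightarrow> W t f) (at t)" for f t
  proof -
    define q where "q i s = unit_exp (\<mu> i * s) - unit_exp (\<mu> i * t)" for i s
    have D: "cinner (W s f - W t f) (E i) = q i s * cinner f (E i)" for s i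
      by (simp add: q_def cinner_simps W left_diff_distrib)
    have qb: "cmod (q i s) \<le> 2" for i s
      using norm_triangle_ineq4[of "unit_exp (\<mu> i * s)" "unit_exp (\<mu> i * t)"] by (simp add: q_def)
    have q0: "((\<lambda>s. q i s) \<longlongrightarrow> 0) (at t)" for i
    proof -
      have "isCont (\<lambda>s. unit_exp (\<mu> i * s)) t"
        using unit_exp_deriv[of "\<mu> i" t UNIV] by (rule has_vector_derivative_continuous)
      then show ?thesis unfolding q_def isCont_def by (simp add: LIM_zero)
    qed
    have "((\<lambda>s. W s f - W t f) \<longlongrightarrow> 0) (at t)"
    proof (rule orth_dominated_tendsto_0[OF D _ q0])
      show "cmod (q i s * cinner f (E i)) \<le> 2 * cmod (cinner f (E i))" for i s
        unfolding norm_mult by (intro mult_right_mono qb) simp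
    qed simp
    then show ?thesis by (rule LIM_zero_cancel)
  qed
  show ?thesis
    unfolding is_exp_group_def W_def[symmetric]
  proof (intro conjI allI)
    show "unitary_op (W t)" for t
      unfolding W_def by (rule unitary_diag_op) simp
    show "W 0 = id" by (auto simp: W0)
    show "W (s + t) = W s \<circ> W t" for s t
    proof (rule ext, rule orth_eqI)
      show "cinner (W (s + t) f) (E i) = cinner ((W s \<circ> W t) f) (E i)" for f i
        by (simp add: W distrib_left unit_exp_add)
    qed
    show "continuous_on UNIV (\<lambda>t. W t f)" for f
      using cont by (simp add: continuous_on_def)
  qed (simp only: deriv_iff)
qed

end


section \<open>Integration by parts along the first coordinate\<close>

text \<open>No vanishing at the ends is imposed, so that integration by parts exposes the boundary
  values.\<close>

definition C1_pair :: "(real \<Rightarrow> complex) \<Rightarrow> (real \<Rightarrow> complex) \<Rightarrow> bool" where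
  "C1_pair k k' \<longleftrightarrow> (\<forall>x\<in>{0..1}. (k has_vector_derivative k' x) (at x within {0..1})) \<and>
     continuous_on {0..1} k'"

lemma C1_pair_continuous: "C1_pair k k' \<Longrightarrow> continuous_on {0..1} k"
  by (auto simp: C1_pair_def continuous_on_eq_continuous_within intro: has_vector_derivative_continuous)

lemma C1_pair_mult:
  assumes "C1_pair k k'" "C1_pair l l'"
  shows "C1_pair (\<lambda>x. k x * l x) (\<lambda>x. k x * l' x + k' x * l x)"
  using assms C1_pair_continuous[OF assms(1)] C1_pair_continuous[OF assms(2)]
  by (auto simp: C1_pair_def intro!: has_vector_derivative_mult continuous_intros)

lemma C1_pair_exp: "C1_pair (\<lambda>x. exp (\<kappa> * of_real x)) (\<lambda>x. \<kappa> * exp (\<kappa> * of_real x))"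
proof -
  have "((\<lambda>x. exp (\<kappa> * of_real x)) has_vector_derivative \<kappa> * exp (\<kappa> * of_real x)) (at x within {0..1})" for x :: real
  proof -
    have "((\<lambda>z. exp (\<kappa> * z)) has_field_derivative \<kappa> * exp (\<kappa> * of_real x)) (at (of_real x))"
      by (auto intro!: derivative_eq_intros)
    from has_vector_derivative_real_field[OF this] show ?thesis by simp
  qed
  then show ?thesis by (auto simp: C1_pair_def intro!: continuous_intros)
qed

lemma FTC_I01:
  assumes k: "C1_pair k k'" and s: "s \<in> {0..1}"
  shows "(LINT x|I01. (if s \<le> x then k' x else 0)) = k 1 - k s"
proof -
  have "(LINT x|I01. (if s \<le> x then k' x else 0)) = (LINT x|lborel. indicator {0..1} x *\<^sub>R (if s \<le> x then k' x else 0))"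
    unfolding unit_cube_real by (subst integral_restrict_space) (auto simp: set_lebesgue_integral_def)
  also have "\<dots> = (LINT x|lborel. indicator {s..1} x *\<^sub>R k' x)"
    using s by (intro Bochner_Integration.integral_cong) (auto simp: indicator_def)
  also have "\<dots> = k 1 - k s"
  proof (rule integral_FTC_Icc)
    show "(k has_vector_derivative k' x) (at x within {s..1})" if "s \<le> x" "x \<le> 1" for x
      using k s that by (intro has_vector_derivative_within_subset[of k "k' x" x "{0..1}" "{s..1}"]) (auto simp: C1_pair_def)
    show "continuous_on {s..1} k'"
      using k s by (auto simp: C1_pair_def intro: continuous_on_subset)
  qed (use s in auto)
  finally show ?thesis .
qed

lemma integral_C1_derivative:
  assumes "C1_pair k k'"
  shows "(LINT x|I01. k' x) = k 1 - k 0"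
proof -
  have "(LINT x|I01. k' x) = (LINT x|I01. (if 0 \<le> x then k' x else 0))"
    by (rule Bochner_Integration.integral_cong) auto
  then show ?thesis using FTC_I01[OF assms, of 0] by simp
qed

section \<open>Primitives of integrable functions\<close>

text \<open>The primitive that vanishes at 0, written as an integral over the fixed interval so that
  Fubini and dominated convergence apply.\<close>

definition prim :: "(real \<Rightarrow> complex) \<Rightarrow> real \<Rightarrow> complex" where
  "prim K x = (LINT s|I01. (if s \<le> x then K s else 0))"

lemma id_I01_measurable: "(\<lambda>x. x) \<in> borel_measurable I01"
  by (rule borel_measurable_I01) simp

lemma integrable_prim_integrand:
  fixes K :: "real \<Rightarrow> complex"
  assumes "integrable I01 K"
  shows "integrable I01 (\<lambda>s. if s \<le> x then K s else 0)"
proof (rule Bochner_Integration.integrable_bound[OF assms])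
  note [measurable] = borel_measurable_integrable[OF assms]
  have [measurable]: "Measurable.pred I01 (\<lambda>s. s \<le> x)" 
    using id_I01_measurable by measurable
  show "(\<lambda>s. if s \<le> x then K s else 0) \<in> borel_measurable I01" by measurable
qed auto

lemma prim_0: "prim K 0 = 0"
  unfolding prim_def
proof (rule integral_eq_zero_AE)
  show "AE s in I01. (if s \<le> 0 then K s else 0) = 0"
    using null_singleton_I01[of 0] AE_space by eventually_elim auto
qed

lemma prim_1: "prim K 1 = (LINT s|I01. K s)"
  unfolding prim_def by (rule Bochner_Integration.integral_cong) auto

lemma cmod_prim_le:
  assumes "integrable I01 K" shows "cmod (prim K x) \<le> (LINT s|I01. cmod (K s))"
proof -
  have "cmod (prim K x) \<le> (LINT s|I01. cmod (if s \<le> x then K s else 0))"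
    unfolding prim_def by (rule integral_norm_bound)
  also have "\<dots> \<le> (LINT s|I01. cmod (K s))"
    using assms integrable_prim_integrand[OF assms, of x] by (intro integral_mono integrable_norm) auto
  finally show ?thesis .
qed

text \<open>Dominated convergence: the truncated integrands converge at every s except possibly s =
  x.\<close>

lemma continuous_on_prim:
  assumes "integrable I01 K" shows "continuous_on S (prim K)"
proof -
  have "continuous (at x) (prim K)" for x
  proof (rule continuous_at_sequentiallyI)
    fix u :: "nat \<Rightarrow> real" assume u: "u \<longlonglongrightarrow> x"
    show "(\<lambda>n. prim K (u n)) \<longlonglongrightarrow> prim K x"
      unfolding prim_def
    proof (rule integral_dominated_convergence[where w = "\<lambda>s. cmod (K s)"])
      show "AE s in I01. (\<lambda>n. if s \<le> u n then K s else 0) \<longlonglongrightarrow> (if s \<le> x then K s else 0)"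
        using null_singleton_I01[of x]
      proof eventually_elim
        case (elim s)
        have "eventually (\<lambda>n. (s \<le> u n) = (s \<le> x)) sequentially"
        proof (cases "s < x")
          case True
          then show ?thesis using order_tendstoD(1)[OF u, of s] by (auto elim: eventually_mono)
        next
          case False
          then show ?thesis using elim order_tendstoD(2)[OF u, of s] by (auto elim: eventually_mono)
        qed
        then show ?case by - (rule tendsto_eventually, erule eventually_mono, simp)
      qed
    qed (use assms integrable_prim_integrand[OF assms] in auto)
  qed
  then show ?thesis by (auto intro: continuous_at_imp_continuous_on)
qed

text \<open>Since \<open>K\<close> is merely integrable, Fubini on the triangle s \<le> x takes the
  place of the product rule.\<close>

lemma integral_by_parts_I01:
  assumes K: "integrable I01 K" and k: "C1_pair k k'"
  shows "(LINT x|I01. (c + prim K x) * k' x + K x * k x) = (c + prim K 1) * k 1 - c * k 0"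
proof -
  note [measurable] = borel_measurable_integrable[OF K]
  have k': "continuous_on {0..1} k'" using k by (simp add: C1_pair_def)
  note kc = C1_pair_continuous[OF k]
  have [measurable]: "k' \<in> borel_measurable I01" by (rule continuous_on_I01_measurable[OF k'])
  have meas [measurable]: "Measurable.pred (I01 \<Otimes>\<^sub>M I01) (\<lambda>p. snd p \<le> fst p)"
    using measurable_compose[OF measurable_fst id_I01_measurable]
      measurable_compose[OF measurable_snd id_I01_measurable]
    by measurable
  have int: "integrable (I01 \<Otimes>\<^sub>M I01) (\<lambda>p. if snd p \<le> fst p then K (snd p) * k' (fst p) else 0)"
  proof (rule Bochner_Integration.integrable_bound)
    show "integrable (I01 \<Otimes>\<^sub>M I01) (\<lambda>p. k' (fst p) * K (snd p))"
      using integrable_tensor[OF integrable_continuous[OF k'] K] by (simp add: unit_cube_pair)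
  qed (auto simp: norm_mult)
  have "(LINT x|I01. prim K x * k' x) = (LINT x|I01. LINT s|I01. (if s \<le> x then K s * k' x else 0))"
  proof (rule Bochner_Integration.integral_cong[OF refl])
    fix x
    have "prim K x * k' x = (LINT s|I01. (if s \<le> x then K s else 0) * k' x)"
      unfolding prim_def using integrable_prim_integrand[OF K] by simp
    also have "\<dots> = (LINT s|I01. (if s \<le> x then K s * k' x else 0))"
      by (rule Bochner_Integration.integral_cong) auto
    finally show "prim K x * k' x = (LINT s|I01. (if s \<le> x then K s * k' x else 0))" .
  qed
  also have "\<dots> = (LINT s|I01. LINT x|I01. (if s \<le> x then K s * k' x else 0))"
    using I01_pair.Fubini_integral[of "\<lambda>x s. if s \<le> x then K s * k' x else 0"] int
    by (simp add: case_prod_beta')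
  also have "\<dots> = (LINT s|I01. K s * (k 1 - k s))"
  proof (rule Bochner_Integration.integral_cong[OF refl])
    fix s assume "s \<in> space I01"
    have "(LINT x|I01. (if s \<le> x then K s * k' x else 0)) = (LINT x|I01. K s * (if s \<le> x then k' x else 0))"
      by (rule Bochner_Integration.integral_cong) auto
    also have "\<dots> = K s * (k 1 - k s)"
      using \<open>s \<in> space I01\<close> by (simp add: FTC_I01[OF k])
    finally show "(LINT x|I01. (if s \<le> x then K s * k' x else 0)) = K s * (k 1 - k s)" .
  qed
  also have "\<dots> = prim K 1 * k 1 - (LINT s|I01. K s * k s)"
    using K integrable_mult_continuous[OF K kc] by (simp add: right_diff_distrib prim_1)
  finally have 1: "(LINT x|I01. prim K x * k' x) = prim K 1 * k 1 - (LINT s|I01. K s * k s)" .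
  have 2: "integrable I01 (\<lambda>x. prim K x * k' x)"
    by (intro integrable_continuous continuous_intros continuous_on_prim K k')
  show ?thesis
    using 1 2 integrable_continuous[OF k'] integrable_mult_continuous[OF K kc]
    by (simp add: distrib_right integral_C1_derivative[OF k] right_diff_distrib)
qed

text \<open>
  Absolute continuity in \<open>x\<close> with derivative \<open>G\<close>, expressed by integration by parts: only this
  consequence is needed, for test functions as well as for exponentials.
\<close>

definition abs_cont_x :: "(real \<times> real \<Rightarrow> complex) \<Rightarrow> (real \<times> real \<Rightarrow> complex) \<Rightarrow> bool" where
  "abs_cont_x F G \<longleftrightarrow> sq_int F \<and> sq_int G \<and> (AE y in I01. \<forall>k k'. C1_pair k k' \<longrightarrow>
     (LINT x|I01. F (x, y) * k' x + G (x, y) * k x) = F (1, y) * k 1 - F (0, y) * k 0)"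

lemma smooth_funD:
  assumes "smooth_fun \<phi>"
  shows "continuous_on UNIV \<phi>" "smooth_fun (dx \<phi>)" "smooth_fun (dy \<phi>)"
    "((\<lambda>s. \<phi> (s, y)) has_vector_derivative dx \<phi> (x, y)) (at x)"
    "((\<lambda>s. \<phi> (x, s)) has_vector_derivative dy \<phi> (x, y)) (at y)"
  using assms by (auto elim: smooth_fun.cases simp: dx_def dy_def vector_derivative_works[symmetric])

lemma smooth_fun_C1_pair:
  assumes "smooth_fun \<phi>"
  shows "C1_pair (\<lambda>x. \<phi> (x, y)) (\<lambda>x. dx \<phi> (x, y))"
proof -
  have "continuous_on {0..1} (\<lambda>x. dx \<phi> (x, y))"
    by (rule continuous_on_compose2[OF smooth_funD(1)[OF smooth_funD(2)[OF assms]]]) (auto intro!: continuous_intros)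
  then show ?thesis
    using smooth_funD(4)[OF assms] by (auto simp: C1_pair_def intro: has_vector_derivative_at_within)
qed

lemma continuous_cube_bounded:
  fixes \<phi> :: "real \<times> real \<Rightarrow> complex"
  assumes "continuous_on UNIV \<phi>"
  obtains B where "AE p in unit_cube. cmod (\<phi> p) \<le> B" "\<phi> \<in> borel_measurable unit_cube"
proof -
  have c: "compact (cbox 0 (One :: real \<times> real))" by (rule compact_cbox)
  obtain B where B: "\<And>p. p \<in> cbox 0 (One :: real \<times> real) \<Longrightarrow> cmod (\<phi> p) \<le> B"
    using compact_imp_bounded[OF compact_continuous_image[OF continuous_on_subset[OF assms] c]]
    by (force simp: bounded_iff)
  have "\<phi> \<in> borel_measurable unit_cube"
    unfolding unit_cube_def
    by (rule measurable_restrict_space1) (use borel_measurable_continuous_onI[OF assms] in simp)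
  moreover have "AE p in unit_cube. cmod (\<phi> p) \<le> B"
    by (rule AE_I2) (simp add: space_unit_cube B)
  ultimately show ?thesis using that by blast
qed

lemma test_fun_boundary:
  assumes "test_fun \<phi>" shows "\<phi> (0, y) = 0" "\<phi> (1, y) = 0"
proof -
  obtain K where K: "K \<subseteq> {0<..<1} \<times> {0<..<1}" "\<And>p. p \<notin> K \<Longrightarrow> \<phi> p = 0"
    using assms by (auto simp: test_fun_def)
  then have "(0, y) \<notin> K" "(1, y) \<notin> K" by auto
  then show "\<phi> (0, y) = 0" "\<phi> (1, y) = 0" by (auto intro: K(2))
qed

lemma integral_rep_abs:
  assumes "sq_int f" and [measurable]: "g \<in> borel_measurable unit_cube"
  shows "(LINT p|unit_cube. rep_L2 (abs_L2 f) p * g p) = (LINT p|unit_cube. f p * g p)"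
proof (rule integral_cong_AE)
  note [measurable] = sq_int_measurable[OF assms(1)] sq_int_measurable[OF sq_int_rep[of "abs_L2 f"]]
  show "(\<lambda>p. rep_L2 (abs_L2 f) p * g p) \<in> borel_measurable unit_cube" by measurable
  show "(\<lambda>p. f p * g p) \<in> borel_measurable unit_cube" by measurable
  show "AE p in unit_cube. rep_L2 (abs_L2 f) p * g p = f p * g p"
    using rep_abs_L2[OF assms(1)] by eventually_elim simp
qed

text \<open>A test function is continuously differentiable along each line in direction x and
  vanishes at both ends, so no boundary terms remain.\<close>

lemma abs_cont_x_weak_dx:
  assumes "abs_cont_x F G"
  shows "weak_dx (abs_L2 F) (abs_L2 G)"
  unfolding weak_dx_def
proof (intro allI impI)
  fix \<phi> assume \<phi>: "test_fun \<phi>"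
  then have sm: "smooth_fun \<phi>" by (simp add: test_fun_def)
  have F: "sq_int F" and G: "sq_int G" using assms by (auto simp: abs_cont_x_def)
  obtain B where B: "AE p in unit_cube. cmod (\<phi> p) \<le> B" "\<phi> \<in> borel_measurable unit_cube"
    using continuous_cube_bounded[OF smooth_funD(1)[OF sm]] by blast
  obtain B' where B': "AE p in unit_cube. cmod (dx \<phi> p) \<le> B'" "dx \<phi> \<in> borel_measurable unit_cube"
    using continuous_cube_bounded[OF smooth_funD(1)[OF smooth_funD(2)[OF sm]]] by blast
  have iF: "integrable unit_cube (\<lambda>p. F p * dx \<phi> p)"
    by (rule integrable_mult_bounded[OF sq_int_integrable[OF F] B'(2,1)])
  have iG: "integrable unit_cube (\<lambda>p. G p * \<phi> p)"
    by (rule integrable_mult_bounded[OF sq_int_integrable[OF G] B(2,1)])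
  have "(LINT p|unit_cube. F p * dx \<phi> p + G p * \<phi> p)
      = (LINT y|I01. LINT x|I01. F (x, y) * dx \<phi> (x, y) + G (x, y) * \<phi> (x, y))"
    by (rule integral_unit_cube_iterated) (intro Bochner_Integration.integrable_add iF iG)
  also have "\<dots> = 0"
  proof (rule integral_eq_zero_AE)
    have "AE y in I01. \<forall>k k'. C1_pair k k' \<longrightarrow>
     (LINT x|I01. F (x, y) * k' x + G (x, y) * k x) = F (1, y) * k 1 - F (0, y) * k 0"
      using assms by (simp add: abs_cont_x_def)
    then show "AE y in I01. (LINT x|I01. F (x, y) * dx \<phi> (x, y) + G (x, y) * \<phi> (x, y)) = 0"
      by (rule eventually_mono) (use smooth_fun_C1_pair[OF sm] test_fun_boundary[OF \<phi>] in auto)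
  qed
  finally have "(LINT p|unit_cube. F p * dx \<phi> p) = - (LINT p|unit_cube. G p * \<phi> p)"
    using iF iG by (simp add: add_eq_0_iff)
  then show "(LINT p|unit_cube. rep_L2 (abs_L2 F) p * dx \<phi> p) = - (LINT p|unit_cube. rep_L2 (abs_L2 G) p * \<phi> p)"
    by (simp add: integral_rep_abs F G B(2) B'(2))
qed

lemma C1_pair_unit_exp: "C1_pair (\<lambda>x. unit_exp (r * x)) (\<lambda>x. 2 * pi * \<i> * r * unit_exp (r * x))"
  unfolding C1_pair_def by (intro conjI ballI unit_exp_deriv continuous_intros)

text \<open>Integration by parts against the conjugate exponential. The boundary terms are kept,
  because they cancel only for frequencies matched to the boundary unitary.\<close>

lemma abs_cont_x_cinner:
  assumes FG: "abs_cont_x F G" and F0: "sq_int (\<lambda>y. F (0, y))" and F1: "sq_int (\<lambda>y. F (1, y))"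
  shows "cinner (abs_L2 G) (exp_fun r \<otimes>\<^sub>L v) = 2 * pi * \<i> * r * cinner (abs_L2 F) (exp_fun r \<otimes>\<^sub>L v)
     + unit_exp (- r) * cinner (abs_L2 (\<lambda>y. F (1, y))) v - cinner (abs_L2 (\<lambda>y. F (0, y))) v"
proof -
  obtain w where v: "v = abs_L2 w" and w: "sq_int w" by (rule L2_cases)
  have F: "sq_int F" and G: "sq_int G" using FG by (auto simp: abs_cont_x_def)
  define k where "k x = unit_exp ((- r) * x)" for x
  define k' where "k' x = 2 * pi * \<i> * (- r) * unit_exp ((- r) * x)" for x
  have k: "C1_pair k k'" unfolding k_def k'_def using C1_pair_unit_exp[of "- r"] by simp
  have k'k: "k' x = - (2 * pi * \<i> * r) * k x" for x by (simp add: k_def k'_def)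
  define T where "T = (\<lambda>p. k (fst p) * cnj (w (snd p)))"
  have T: "sq_int (\<lambda>p. cnj (T p))"
    using sq_int_tensor[OF sq_int_unit_exp[of r] w] by (simp add: T_def k_def cnj_unit_exp)
  have t: "exp_fun r \<otimes>\<^sub>L v = abs_L2 (\<lambda>p. cnj (T p))"
    by (simp add: exp_fun_def v tensor_abs w T_def k_def cnj_unit_exp)
  have iF: "integrable unit_cube (\<lambda>p. F p * T p)" and iG: "integrable unit_cube (\<lambda>p. G p * T p)"
    using sq_int_mult_integrable[OF F T] sq_int_mult_integrable[OF G T] by simp_all
  have iGF: "integrable unit_cube (\<lambda>p. G p * T p - 2 * pi * \<i> * r * (F p * T p))"
    using iF iG by simp
  have iB: "integrable I01 (\<lambda>y. F (0, y) * cnj (w y))" "integrable I01 (\<lambda>y. F (1, y) * cnj (w y))"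
    using sq_int_mult_integrable[OF F0 w] sq_int_mult_integrable[OF F1 w] by simp_all
  have "cinner (abs_L2 G) (exp_fun r \<otimes>\<^sub>L v) - 2 * pi * \<i> * r * cinner (abs_L2 F) (exp_fun r \<otimes>\<^sub>L v)
    = (LINT p|unit_cube. G p * T p - 2 * pi * \<i> * r * (F p * T p))"
    using iF iG by (simp add: t cinner_abs F G T)
  also have "\<dots> = (LINT y|I01. LINT x|I01. G (x, y) * T (x, y) - 2 * pi * \<i> * r * (F (x, y) * T (x, y)))"
    by (rule integral_unit_cube_iterated[OF iGF])
  also have "\<dots> = (LINT y|I01. F (1, y) * cnj (w y) * k 1 - F (0, y) * cnj (w y))"
  proof (rule integral_cong_AE)
    show "(\<lambda>y. LINT x|I01. G (x, y) * T (x, y) - 2 * pi * \<i> * r * (F (x, y) * T (x, y))) \<in> borel_measurable I01"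
      by (rule borel_measurable_integrable[OF integrable_slice_integral[OF iGF]])
    show "(\<lambda>y. F (1, y) * cnj (w y) * k 1 - F (0, y) * cnj (w y)) \<in> borel_measurable I01"
      using iB by auto
    have "AE y in I01. \<forall>k k'. C1_pair k k' \<longrightarrow>
     (LINT x|I01. F (x, y) * k' x + G (x, y) * k x) = F (1, y) * k 1 - F (0, y) * k 0"
      using FG by (simp add: abs_cont_x_def)
    then show "AE y in I01. (LINT x|I01. G (x, y) * T (x, y) - 2 * pi * \<i> * r * (F (x, y) * T (x, y)))
        = F (1, y) * cnj (w y) * k 1 - F (0, y) * cnj (w y)"
    proof eventually_elim
      case (elim y)
      have "(LINT x|I01. G (x, y) * T (x, y) - 2 * pi * \<i> * r * (F (x, y) * T (x, y)))
         = (LINT x|I01. (F (x, y) * k' x + G (x, y) * k x) * cnj (w y))"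
        by (simp add: T_def k'k algebra_simps)
      also have "\<dots> = (F (1, y) * k 1 - F (0, y) * k 0) * cnj (w y)"
        using elim k by (simp only: integral_mult_left_zero)
      finally show ?case by (simp add: k_def algebra_simps)
    qed
  qed
  also have "\<dots> = unit_exp (- r) * cinner (abs_L2 (\<lambda>y. F (1, y))) v - cinner (abs_L2 (\<lambda>y. F (0, y))) v"
    using iB by (simp add: v cinner_abs F0 F1 w k_def)
  finally show ?thesis by (simp add: algebra_simps)
qed

section \<open>Explicit solutions of the linear equation in x\<close>

lemma sq_int_AE_slice:
  fixes K :: "real \<times> real \<Rightarrow> complex"
  assumes "sq_int K"
  shows "AE y in I01. sq_int (\<lambda>x. K (x, y))"
proof -
  note K = sq_int_measurable[OF assms, unfolded unit_cube_pair]
  have "AE y in I01. integrable I01 (\<lambda>x. (cmod (K (x, y)))\<^sup>2)"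
    using assms by (intro AE_integrable_slice) (simp add: sq_int_def)
  then show ?thesis using AE_space
  proof eventually_elim
    case (elim y)
    have "(\<lambda>x. K (x, y)) \<in> borel_measurable I01"
      using K elim(2) by measurable
    with elim show ?case by (simp add: sq_int_def)
  qed
qed

lemma slice_bound:
  assumes "sq_int K" 
  shows "((LINT s|I01. cmod (K s)))\<^sup>2 \<le> (LINT s|I01. (cmod (K s))\<^sup>2)"
proof -
  have "(LINT s|I01. cmod (K s)) \<ge> 0" by (rule integral_nonneg_AE) simp
  then show ?thesis
    using power_mono[OF integral_cmod_le_norm[OF assms], of 2] norm_abs_L2[OF assms] by simp
qed

lemma prim_measurable:
  fixes K :: "real \<times> real \<Rightarrow> complex"
  assumes [measurable]: "K \<in> borel_measurable (I01 \<Otimes>\<^sub>M I01)"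
  shows "(\<lambda>p. prim (\<lambda>s. K (s, snd p)) (fst p)) \<in> borel_measurable (I01 \<Otimes>\<^sub>M I01)"
proof -
  have [measurable]: "Measurable.pred ((I01 \<Otimes>\<^sub>M I01) \<Otimes>\<^sub>M I01) (\<lambda>q. snd q \<le> fst (fst q))"
    using measurable_compose[OF measurable_compose[OF measurable_fst measurable_fst] id_I01_measurable]
      measurable_compose[OF measurable_snd id_I01_measurable]
    by measurable
  show ?thesis unfolding prim_def
    by (rule unit_cube.borel_measurable_lebesgue_integral) (simp add: case_prod_beta')
qed

text \<open>On almost every slice Cauchy-Schwarz bounds the squared primitive, uniformly in x, by
  \<open>?N y\<close>, which is integrable in y.\<close>

lemma sq_int_prim:
  fixes K :: "real \<times> real \<Rightarrow> complex"
  assumes K: "sq_int K"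
  shows "sq_int (\<lambda>p. prim (\<lambda>s. K (s, snd p)) (fst p))"
proof -
  note [measurable] = sq_int_measurable[OF K, unfolded unit_cube_pair]
  let ?N = "\<lambda>y. LINT s|I01. (cmod (K (s, y)))\<^sup>2"
  have N: "integrable I01 ?N"
    using K by (intro integrable_slice_integral) (simp add: sq_int_def)
  have "integrable unit_cube (\<lambda>p. (cmod (prim (\<lambda>s. K (s, snd p)) (fst p)))\<^sup>2)"
  proof (rule Bochner_Integration.integrable_bound)
    have "integrable unit_cube (\<lambda>p :: real \<times> real. 1 * complex_of_real (?N (snd p)))"
      by (intro integrable_tensor[of "\<lambda>x. 1" "\<lambda>y. complex_of_real (?N y)"] integrable_of_real N) simp
    then show "integrable unit_cube (\<lambda>p. Re (complex_of_real (?N (snd (p :: real \<times> real)))))"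
      by (intro integrable_Re) simp
    show "(\<lambda>p. (cmod (prim (\<lambda>s. K (s, snd p)) (fst p)))\<^sup>2) \<in> borel_measurable unit_cube"
      unfolding unit_cube_pair using prim_measurable[of K] by measurable
    show "AE p in unit_cube. norm ((cmod (prim (\<lambda>s. K (s, snd p)) (fst p)))\<^sup>2) \<le> norm (Re (complex_of_real (?N (snd p))))"
      using AE_pair_snd[OF sq_int_AE_slice[OF K]]
    proof eventually_elim
      case (elim p)
      have "(cmod (prim (\<lambda>s. K (s, snd p)) (fst p)))\<^sup>2 \<le> (LINT s|I01. cmod (K (s, snd p)))\<^sup>2"
        by (intro power_mono cmod_prim_le sq_int_integrable elim) simp
      also note slice_bound[OF elim]
      finally show ?case by simp
    qed
  qed
  moreover have "(\<lambda>p. prim (\<lambda>s. K (s, snd p)) (fst p)) \<in> borel_measurable unit_cube"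
    unfolding unit_cube_pair by (rule prim_measurable) measurable
  ultimately show ?thesis by (simp add: sq_int_def)
qed

lemma sq_int_slice_integral:
  fixes K :: "real \<times> real \<Rightarrow> complex"
  assumes K: "sq_int K"
  shows "sq_int (\<lambda>y. LINT s|I01. K (s, y))"
proof -
  note [measurable] = sq_int_measurable[OF K, unfolded unit_cube_pair]
  let ?N = "\<lambda>y. LINT s|I01. (cmod (K (s, y)))\<^sup>2"
  have N: "integrable I01 ?N"
    using K by (intro integrable_slice_integral) (simp add: sq_int_def)
  have "integrable I01 (\<lambda>y. LINT s|I01. K (s, y))"
    by (rule integrable_slice_integral[OF sq_int_integrable[OF K]])
  then have m: "(\<lambda>y. LINT s|I01. K (s, y)) \<in> borel_measurable I01" by auto
  have "integrable I01 (\<lambda>y. (cmod (LINT s|I01. K (s, y)))\<^sup>2)"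
  proof (rule Bochner_Integration.integrable_bound[OF N])
    show "(\<lambda>y. (cmod (LINT s|I01. K (s, y)))\<^sup>2) \<in> borel_measurable I01" using m by measurable
    show "AE y in I01. norm ((cmod (LINT s|I01. K (s, y)))\<^sup>2) \<le> norm (?N y)"
      using sq_int_AE_slice[OF K]
    proof eventually_elim
      case (elim y)
      have "(cmod (LINT s|I01. K (s, y)))\<^sup>2 \<le> (LINT s|I01. cmod (K (s, y)))\<^sup>2"
        by (intro power_mono integral_norm_bound) simp
      also note slice_bound[OF elim]
      finally show ?case by simp
    qed
  qed
  with m show ?thesis by (simp add: sq_int_def)
qed

lemma cexp_measurable:
  "(\<lambda>p. exp (\<kappa> * complex_of_real (fst p))) \<in> borel_measurable (unit_cube :: (real \<times> real) measure)"
  "AE p in (unit_cube :: (real \<times> real) measure). cmod (exp (\<kappa> * complex_of_real (fst p))) \<le> exp \<bar>Re \<kappa>\<bar>"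
proof -
  show "(\<lambda>p. exp (\<kappa> * complex_of_real (fst p))) \<in> borel_measurable (unit_cube :: (real \<times> real) measure)"
    unfolding unit_cube_def
    by (rule measurable_restrict_space1) (auto intro!: borel_measurable_continuous_onI continuous_intros)
  have "Re \<kappa> * x \<le> \<bar>Re \<kappa>\<bar>" if "x \<in> {0..1}" for x
    using that by (metis abs_ge_self abs_ge_zero abs_mult abs_of_nonneg atLeastAtMost_iff mult_left_le order_trans)
  then show "AE p in (unit_cube :: (real \<times> real) measure). cmod (exp (\<kappa> * complex_of_real (fst p))) \<le> exp \<bar>Re \<kappa>\<bar>"
    unfolding unit_cube_pair by (intro AE_I2) (auto simp: space_pair_measure)
qed

lemma sq_int_cexp_mult: "sq_int F \<Longrightarrow> sq_int (\<lambda>p. exp (\<kappa> * complex_of_real (fst p)) * F p :: complex)" for F :: "real \<times> real \<Rightarrow> complex"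
  by (rule sq_int_mult_bounded[OF _ cexp_measurable])

lemma sq_int_one [simp]: "sq_int (\<lambda>x. 1)"
  by (rule sq_int_bounded[where B = 1]) auto

text \<open>Variation of constants. The factor exp(\<kappa> x) is moved from \<open>F\<close> to the
  test function, after which integration by parts for the primitive applies.\<close>

lemma abs_cont_x_explicit:
  fixes c :: "real \<Rightarrow> complex" and \<kappa> :: complex
  assumes c: "sq_int c" and K: "sq_int K"
  defines "F \<equiv> \<lambda>p. exp (\<kappa> * of_real (fst p)) * (c (snd p) + prim (\<lambda>s. K (s, snd p)) (fst p))"
  shows "abs_cont_x F (\<lambda>p. \<kappa> * F p + exp (\<kappa> * of_real (fst p)) * K p)"
    "AE y in I01. continuous_on {0..1} (\<lambda>x. F (x, y))"
proof -
  have F: "sq_int F"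
    unfolding F_def using sq_int_tensor[OF sq_int_one c]
    by (intro sq_int_cexp_mult sq_int_add sq_int_prim K) simp
  have slice: "AE y in I01. integrable I01 (\<lambda>x. K (x, y))"
    using sq_int_AE_slice[OF K] by eventually_elim (rule sq_int_integrable)
  show "AE y in I01. continuous_on {0..1} (\<lambda>x. F (x, y))"
    using slice by (rule eventually_mono) (auto simp: F_def intro!: continuous_intros continuous_on_prim)
  show "abs_cont_x F (\<lambda>p. \<kappa> * F p + exp (\<kappa> * of_real (fst p)) * K p)"
    unfolding abs_cont_x_def
  proof (intro conjI)
    show "sq_int (\<lambda>p. \<kappa> * F p + exp (\<kappa> * of_real (fst p)) * K p)"
      by (intro sq_int_add sq_int_cmult sq_int_cexp_mult F K)
    show "AE y in I01. \<forall>k k'. C1_pair k k' \<longrightarrow>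
      (LINT x|I01. F (x, y) * k' x + (\<kappa> * F (x, y) + exp (\<kappa> * of_real (fst (x, y))) * K (x, y)) * k x)
        = F (1, y) * k 1 - F (0, y) * k 0"
      using slice
    proof (eventually_elim, intro allI impI)
      fix y k k' assume Ky: "integrable I01 (\<lambda>x. K (x, y))" and k: "C1_pair k k'"
      let ?k = "\<lambda>x. exp (\<kappa> * of_real x) * k x"
      let ?k' = "\<lambda>x. exp (\<kappa> * of_real x) * k' x + \<kappa> * exp (\<kappa> * of_real x) * k x"
      let ?p = "prim (\<lambda>s. K (s, y))"
      have "(LINT x|I01. F (x, y) * k' x + (\<kappa> * F (x, y) + exp (\<kappa> * of_real (fst (x, y))) * K (x, y)) * k x)
        = (LINT x|I01. (c y + ?p x) * ?k' x + K (x, y) * ?k x)"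
        by (simp add: F_def algebra_simps)
      also have "\<dots> = (c y + ?p 1) * ?k 1 - c y * ?k 0"
        by (rule integral_by_parts_I01[OF Ky C1_pair_mult[OF C1_pair_exp k]])
      finally show "(LINT x|I01. F (x, y) * k' x + (\<kappa> * F (x, y) + exp (\<kappa> * of_real (fst (x, y))) * K (x, y)) * k x)
        = F (1, y) * k 1 - F (0, y) * k 0"
        by (simp add: F_def prim_0 algebra_simps)
    qed
  qed (rule F)
qed


section \<open>Weak derivatives and test functions\<close>

lemma sq_int_continuous_cube:
  fixes \<phi> :: "real \<times> real \<Rightarrow> complex"
  assumes "continuous_on UNIV \<phi>"
  shows "sq_int \<phi>"
  using continuous_cube_bounded[OF assms] sq_int_bounded by metis

lemma integral_rep_eq_cinner:
  assumes "sq_int g"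
  shows "(LINT p|unit_cube. rep_L2 f p * g p) = cinner f (abs_L2 (\<lambda>p. cnj (g p)))"
proof -
  have "sq_int (\<lambda>p. cnj (g p))"
    using assms sq_int_measurable[OF assms] by (simp add: sq_int_def)
  from cinner_abs[OF sq_int_rep[of f] this] show ?thesis by simp
qed

text \<open>Test functions and their derivatives are square integrable; in terms of inner products
  the linearity of weak derivatives is immediate.\<close>

lemma weak_dx_cinner:
  "weak_dx f g \<longleftrightarrow> (\<forall>\<phi>. test_fun \<phi> \<longrightarrow>
     cinner f (abs_L2 (\<lambda>p. cnj (dx \<phi> p))) = - cinner g (abs_L2 (\<lambda>p. cnj (\<phi> p))))"
  unfolding weak_dx_def test_fun_def
  by (auto simp: integral_rep_eq_cinner sq_int_continuous_cube smooth_funD(1,2))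

lemma weak_dx_add: "weak_dx f g \<Longrightarrow> weak_dx f' g' \<Longrightarrow> weak_dx (f + f') (g + g')"
  by (simp add: weak_dx_cinner cinner_simps)

lemma weak_dx_diff: "weak_dx f g \<Longrightarrow> weak_dx f' g' \<Longrightarrow> weak_dx (f - f') (g - g')"
  by (simp add: weak_dx_cinner cinner_simps)

lemma slice_x_add_scaleC:
  assumes "slice_x f a h" "slice_x f' a h'"
  shows "slice_x (f + c *\<^sub>C f') a (h + c *\<^sub>C h')"
proof -
  obtain F F' where F: "sq_int F" "abs_L2 F = f" "AE y in I01. continuous_on {0..1} (\<lambda>x. F (x, y))"
      "sq_int (\<lambda>y. F (a, y))" "abs_L2 (\<lambda>y. F (a, y)) = h"
    and F': "sq_int F'" "abs_L2 F' = f'" "AE y in I01. continuous_on {0..1} (\<lambda>x. F' (x, y))"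
      "sq_int (\<lambda>y. F' (a, y))" "abs_L2 (\<lambda>y. F' (a, y)) = h'"
    using assms unfolding slice_x_def by blast
  have "AE y in I01. continuous_on {0..1} (\<lambda>x. F (x, y) + c * F' (x, y))"
    using F(3) F'(3) by eventually_elim (intro continuous_intros)
  then show ?thesis unfolding slice_x_def
    using F F' by (intro exI[of _ "\<lambda>p. F p + c * F' p"])
      (auto simp: sq_int_add sq_int_cmult plus_abs[symmetric] scaleC_abs[symmetric])
qed

lemma slice_x_add: "slice_x f a h \<Longrightarrow> slice_x f' a h' \<Longrightarrow> slice_x (f + f') a (h + h')"
  using slice_x_add_scaleC[of f a h f' h' 1] by simp

lemma slice_x_diff: "slice_x f a h \<Longrightarrow> slice_x f' a h' \<Longrightarrow> slice_x (f - f') a (h - h')"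
  using slice_x_add_scaleC[of f a h f' h' "-1"] by (simp add: scaleC_minus_left)

lemma P_opI:
  assumes "weak_dx f ((2 * pi * \<i>) *\<^sub>C g)" "slice_x f 0 h" "slice_x f 1 (U h)"
  shows "(f, g) \<in> P_op U"
proof -
  have "g = (1 / (2 * pi * \<i>)) *\<^sub>C ((2 * pi * \<i>) *\<^sub>C g)" by simp
  then show ?thesis unfolding P_op_def using assms by blast
qed

lemma P_opE:
  assumes "(f, g) \<in> P_op U"
  obtains h where "weak_dx f ((2 * pi * \<i>) *\<^sub>C g)" "slice_x f 0 h" "slice_x f 1 (U h)"
  using assms unfolding P_op_def by auto

lemma sq_int_C1: "C1_pair k k' \<Longrightarrow> sq_int k" "C1_pair k k' \<Longrightarrow> sq_int k'"
  by (rule sq_int_continuous, erule C1_pair_continuous) (rule sq_int_continuous, simp add: C1_pair_def)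

lemma weak_dx_tensor:
  assumes p: "C1_pair p p'"
  shows "weak_dx (abs_L2 p \<otimes>\<^sub>L v) (abs_L2 p' \<otimes>\<^sub>L v)"
proof -
  obtain w where v: "v = abs_L2 w" and w: "sq_int w" by (rule L2_cases)
  have "abs_cont_x (\<lambda>q. p (fst q) * w (snd q)) (\<lambda>q. p' (fst q) * w (snd q))"
    unfolding abs_cont_x_def
  proof (intro conjI sq_int_tensor sq_int_C1[OF p] w AE_I2 allI impI)
    fix y k k' assume k: "C1_pair k k'"
    have "(LINT x|I01. p (fst (x, y)) * w (snd (x, y)) * k' x + p' (fst (x, y)) * w (snd (x, y)) * k x)
       = (LINT x|I01. w y * (p x * k' x + p' x * k x))"
      by (simp add: algebra_simps)
    also have "\<dots> = w y * (p 1 * k 1 - p 0 * k 0)"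
      by (simp add: integral_C1_derivative[OF C1_pair_mult[OF p k]])
    finally show "(LINT x|I01. p (fst (x, y)) * w (snd (x, y)) * k' x + p' (fst (x, y)) * w (snd (x, y)) * k x)
       = p (fst (1, y)) * w (snd (1, y)) * k 1 - p (fst (0, y)) * w (snd (0, y)) * k 0"
      by (simp add: algebra_simps)
  qed
  from abs_cont_x_weak_dx[OF this] show ?thesis
    by (simp add: v tensor_abs w sq_int_C1[OF p])
qed

lemma slice_x_tensor:
  assumes p: "C1_pair p p'"
  shows "slice_x (abs_L2 p \<otimes>\<^sub>L v) a (p a *\<^sub>C v)"
proof -
  obtain w where v: "v = abs_L2 w" and w: "sq_int w" by (rule L2_cases)
  show ?thesis unfolding slice_x_def
    by (intro exI[of _ "\<lambda>q. p (fst q) * w (snd q)"])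
      (auto simp: v w sq_int_C1[OF p] tensor_abs sq_int_tensor scaleC_abs sq_int_cmult
        intro!: continuous_intros C1_pair_continuous[OF p])
qed

text \<open>\<open>T\<close> is chosen before \<open>c\<close>: the end value is an affine function
  of the initial value, so a boundary condition becomes an equation for \<open>c\<close> alone. The
  last conjunct records the Fourier coefficients of the derivative.\<close>

lemma explicit_solution:
  "\<exists>T. \<forall>c. \<exists>f. weak_dx f (\<kappa> *\<^sub>C f + g) \<and> slice_x f 0 c \<and> slice_x f 1 (exp \<kappa> *\<^sub>C (c + T)) \<and>
    (\<forall>r v. cinner (\<kappa> *\<^sub>C f + g) (exp_fun r \<otimes>\<^sub>L v) = 2 * pi * \<i> * r * cinner f (exp_fun r \<otimes>\<^sub>L v)
     + unit_exp (- r) * cinner (exp \<kappa> *\<^sub>C (c + T)) v - cinner c v)"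
proof -
  \<comment> \<open>The inhomogeneity divided by the integrating factor.\<close>
  define K where "K p = exp (- \<kappa> * complex_of_real (fst p)) * rep_L2 g p" for p :: "real \<times> real"
  have K: "sq_int K" unfolding K_def by (intro sq_int_cexp_mult sq_int_rep)
  have eK: "exp (\<kappa> * complex_of_real (fst p)) * K p = rep_L2 g p" for p
    by (simp add: K_def mult.assoc[symmetric] exp_add[symmetric])
  define T where "T y = (LINT s|I01. K (s, y))" for y
  have T: "sq_int T" unfolding T_def by (rule sq_int_slice_integral[OF K])
  show ?thesis
  proof (intro exI[of _ "abs_L2 T"] allI)
    fix c :: "real L2"
    obtain C where c: "c = abs_L2 C" and C: "sq_int C" by (rule L2_cases)
    define F where "F p = exp (\<kappa> * of_real (fst p)) * (C (snd p) + prim (\<lambda>s. K (s, snd p)) (fst p))" for p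
    have ac: "abs_cont_x F (\<lambda>p. \<kappa> * F p + rep_L2 g p)"
      and cont: "AE y in I01. continuous_on {0..1} (\<lambda>x. F (x, y))"
      using abs_cont_x_explicit[OF C K, of \<kappa>] unfolding eK F_def[symmetric] by auto
    have F: "sq_int F" using ac by (simp add: abs_cont_x_def)
    have G: "abs_L2 (\<lambda>p. \<kappa> * F p + rep_L2 g p) = \<kappa> *\<^sub>C abs_L2 F + g"
      by (simp add: scaleC_abs[OF F] plus_abs[OF sq_int_cmult[OF F] sq_int_rep, symmetric])
    have F0: "(\<lambda>y. F (0, y)) = C" by (simp add: F_def prim_0)
    have F1: "(\<lambda>y. F (1, y)) = (\<lambda>y. exp \<kappa> * (C y + T y))" by (simp add: F_def prim_1 T_def)
    have F1': "abs_L2 (\<lambda>y. F (1, y)) = exp \<kappa> *\<^sub>C (c + abs_L2 T)"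
      by (simp add: F1 c plus_abs C T scaleC_abs sq_int_add)
    have sF1: "sq_int (\<lambda>y. F (1, y))" unfolding F1 by (intro sq_int_cmult sq_int_add C T)
    have sF0: "sq_int (\<lambda>y. F (0, y))" unfolding F0 by (rule C)
    show "\<exists>f. weak_dx f (\<kappa> *\<^sub>C f + g) \<and> slice_x f 0 c \<and> slice_x f 1 (exp \<kappa> *\<^sub>C (c + abs_L2 T)) \<and>
    (\<forall>r v. cinner (\<kappa> *\<^sub>C f + g) (exp_fun r \<otimes>\<^sub>L v) = 2 * pi * \<i> * r * cinner f (exp_fun r \<otimes>\<^sub>L v)
     + unit_exp (- r) * cinner (exp \<kappa> *\<^sub>C (c + abs_L2 T)) v - cinner c v)"
    proof (intro exI[of _ "abs_L2 F"] conjI allI)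
      show "weak_dx (abs_L2 F) (\<kappa> *\<^sub>C abs_L2 F + g)"
        using abs_cont_x_weak_dx[OF ac] by (simp only: G)
      show "slice_x (abs_L2 F) 0 c"
        unfolding slice_x_def using F cont sF0 F0 c by blast
      show "slice_x (abs_L2 F) 1 (exp \<kappa> *\<^sub>C (c + abs_L2 T))"
        unfolding slice_x_def using F cont sF1 F1' by blast
      show "cinner (\<kappa> *\<^sub>C abs_L2 F + g) (exp_fun r \<otimes>\<^sub>L v) = 2 * pi * \<i> * r * cinner (abs_L2 F) (exp_fun r \<otimes>\<^sub>L v)
        + unit_exp (- r) * cinner (exp \<kappa> *\<^sub>C (c + abs_L2 T)) v - cinner c v" for r v
        using abs_cont_x_cinner[OF ac sF0 sF1, of r v] by (simp only: G F1' F0 c)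
    qed
  qed
qed

section \<open>Smooth functions of one variable\<close>

text \<open>The powers of 1/x are included because differentiating exp(-1/x) produces them; the
  family contains its own derivatives up to linear combinations.\<close>

definition flat :: "nat \<Rightarrow> real \<Rightarrow> real" where
  "flat n x = (if x > 0 then exp (- (1 / x)) / x ^ n else 0)"

text \<open>A single term of the series for exp(1/x), the one of degree n + 2, beats the power in
  the denominator and leaves a quadratic bound, so the derivative at 0 vanishes.\<close>

lemma flat_bound: "\<bar>flat n x\<bar> \<le> fact (n + 2) * x\<^sup>2"
proof (cases "x > 0")
  case True
  have "(1 / x) ^ (n + 2) / fact (n + 2) \<le> exp (1 / x)"
  proof -
    have "(\<Sum>k\<in>{n + 2}. inverse (fact k) * (1 / x) ^ k) \<le> (\<Sum>k. inverse (fact k) * (1 / x) ^ k)"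
      by (rule sum_le_suminf) (use True summable_exp[of "1/x"] in auto)
    then show ?thesis by (simp add: exp_def scaleR_conv_of_real divide_inverse mult_ac)
  qed
  then have "exp (- (1 / x)) * ((1 / x) ^ (n + 2) / fact (n + 2)) \<le> exp (- (1 / x)) * exp (1 / x)"
    by (intro mult_left_mono) auto
  then have "exp (- (1 / x)) * ((1 / x) ^ (n + 2) / fact (n + 2)) \<le> 1"
    by (simp add: exp_add[symmetric])
  moreover have "E / x ^ n \<le> C * x\<^sup>2" if "E * ((1 / x) ^ (n + 2) / C) \<le> 1" "C > 0" for C E :: real
    using that True by (simp add: field_simps power_add power2_eq_square)
  ultimately have "exp (- (1 / x)) / x ^ n \<le> fact (n + 2) * x\<^sup>2"
    using fact_gt_zero by blast
  then show ?thesis using True by (simp add: flat_def del: fact_Suc)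
qed (simp add: flat_def del: fact_Suc)

lemma flat_deriv:
  "(flat n has_real_derivative flat (n + 2) x - real n * flat (n + 1) x) (at x)"
proof (cases x "0 :: real" rule: linorder_cases)
  case greater
  have "((\<lambda>x. exp (- (1 / x)) / x ^ n) has_real_derivative flat (n + 2) x - real n * flat (n + 1) x) (at x)"
    using greater
    by (auto intro!: derivative_eq_intros simp: flat_def field_simps power2_eq_square)
       (cases n; simp add: field_simps)
  moreover have "eventually (\<lambda>y. flat n y = exp (- (1 / y)) / y ^ n) (nhds x)"
    using eventually_nhds_in_open[of "{0<..}" x] greater by (auto elim!: eventually_mono simp: flat_def)
  ultimately show ?thesis by (subst DERIV_cong_ev[OF refl _ refl]) auto
next
  case less
  have "((\<lambda>x. 0) has_real_derivative 0) (at x)" by simp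
  moreover have "eventually (\<lambda>y. flat n y = 0) (nhds x)"
    using eventually_nhds_in_open[of "{..<0}" x] less by (auto elim!: eventually_mono simp: flat_def)
  ultimately have "(flat n has_real_derivative 0) (at x)"
    by (subst DERIV_cong_ev[OF refl _ refl]) auto
  then show ?thesis using less by (simp add: flat_def)
next
  case equal
  have "((\<lambda>h. (flat n (0 + h) - flat n 0) / h) \<longlongrightarrow> 0) (at 0)"
  proof (rule Lim_null_comparison)
    show "eventually (\<lambda>h. norm ((flat n (0 + h) - flat n 0) / h) \<le> fact (n + 2) * \<bar>h\<bar>) (at 0)"
    proof (rule always_eventually, rule allI)
      fix h :: real
      show "norm ((flat n (0 + h) - flat n 0) / h) \<le> fact (n + 2) * \<bar>h\<bar>"
      proof (cases "h = 0")
        case False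
        then have "\<bar>flat n h\<bar> / \<bar>h\<bar> \<le> fact (n + 2) * h\<^sup>2 / \<bar>h\<bar>"
          by (intro divide_right_mono flat_bound) simp
        also have "\<dots> = fact (n + 2) * \<bar>h\<bar>"
        proof -
          have "C * h\<^sup>2 / \<bar>h\<bar> = C * \<bar>h\<bar>" for C :: real
            using False by (cases "h \<ge> 0") (auto simp: power2_eq_square)
          then show ?thesis .
        qed
        finally show ?thesis by (simp add: flat_def[of n 0])
      qed simp
    qed
    show "((\<lambda>h. fact (n + 2) * \<bar>h\<bar>) \<longlongrightarrow> 0) (at (0 :: real))"
      by (rule tendsto_eq_intros refl | simp)+
  qed
  then show ?thesis using equal by (simp add: DERIV_def flat_def[of _ 0])
qed

text \<open>The rule \<open>antideriv\<close> provides test functions with a prescribed derivative.\<close>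

inductive smooth1 :: "(real \<Rightarrow> complex) \<Rightarrow> bool" where
  flat: "smooth1 (\<lambda>x. complex_of_real (flat n (a * x + b)))"
| exp: "smooth1 (\<lambda>x. exp (z * complex_of_real x))"
| const: "smooth1 (\<lambda>x. c)"
| add: "smooth1 f \<Longrightarrow> smooth1 g \<Longrightarrow> smooth1 (\<lambda>x. f x + g x)"
| mult: "smooth1 f \<Longrightarrow> smooth1 g \<Longrightarrow> smooth1 (\<lambda>x. f x * g x)"
| antideriv: "smooth1 f' \<Longrightarrow> (\<And>x. (f has_vector_derivative f' x) (at x)) \<Longrightarrow> smooth1 f"

lemma smooth1_deriv:
  assumes "smooth1 f"
  shows "\<exists>f'. smooth1 f' \<and> (\<forall>x. (f has_vector_derivative f' x) (at x))"
  using assms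
proof induction
  case (flat n a b)
  let ?f' = "\<lambda>x. complex_of_real a * (complex_of_real (flat (n + 2) (a * x + b)) +
      - complex_of_real n * complex_of_real (flat (n + 1) (a * x + b)))"
  have "((\<lambda>x. complex_of_real (flat n (a * x + b))) has_vector_derivative ?f' x) (at x)" for x
  proof -
    have "((\<lambda>x. flat n (a * x + b)) has_real_derivative
        (flat (n + 2) (a * x + b) - real n * flat (n + 1) (a * x + b)) * a) (at x)"
      by (rule DERIV_chain2[OF flat_deriv]) (auto intro!: derivative_eq_intros)
    then have "((\<lambda>x. complex_of_real (flat n (a * x + b))) has_vector_derivative
       complex_of_real ((flat (n + 2) (a * x + b) - real n * flat (n + 1) (a * x + b)) * a)) (at x)"
      by (intro has_vector_derivative_of_real) (simp add: has_real_derivative_iff_has_vector_derivative)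
    then show ?thesis by (simp add: mult.commute)
  qed
  then show ?case by (intro exI[of _ ?f'] conjI smooth1.mult smooth1.add smooth1.flat smooth1.const) auto
next
  case (exp z)
  have "((\<lambda>x. exp (z * of_real x)) has_vector_derivative z * exp (z * of_real x)) (at x)" for x :: real
  proof -
    have "((\<lambda>w. exp (z * w)) has_field_derivative z * exp (z * of_real x)) (at (of_real x))"
      by (auto intro!: derivative_eq_intros)
    from has_vector_derivative_real_field[OF this] show ?thesis by simp
  qed
  then show ?case by (intro exI[of _ "\<lambda>x. z * exp (z * of_real x)"] conjI smooth1.mult smooth1.exp smooth1.const) auto
next
  case (const c)
  show ?case by (intro exI[of _ "\<lambda>x. 0"] conjI smooth1.const) auto
next
  case (add f g)
  then obtain f' g' where "smooth1 f'" "smooth1 g'"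
    "\<forall>x. (f has_vector_derivative f' x) (at x)" "\<forall>x. (g has_vector_derivative g' x) (at x)" by blast
  then show ?case
    by (intro exI[of _ "\<lambda>x. f' x + g' x"]) (auto intro!: smooth1.add has_vector_derivative_add)
next
  case (mult f g)
  then obtain f' g' where "smooth1 f'" "smooth1 g'"
    "\<forall>x. (f has_vector_derivative f' x) (at x)" "\<forall>x. (g has_vector_derivative g' x) (at x)" by blast
  then show ?case using mult
    by (intro exI[of _ "\<lambda>x. f x * g' x + f' x * g x"]) (auto intro!: smooth1.add smooth1.mult has_vector_derivative_mult)
next
  case (antideriv f' f)
  then show ?case by blast
qed

lemma smooth1_continuous: "smooth1 f \<Longrightarrow> continuous_on S f"
  using smooth1_deriv[of f] has_vector_derivative_continuous
  by (meson continuous_at_imp_continuous_on)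

section \<open>Test functions of product form\<close>

lemma dx_tensor: "(\<And>x. (f has_vector_derivative f' x) (at x)) \<Longrightarrow>
    dx (\<lambda>p. f (fst p) * g (snd p)) = (\<lambda>p. f' (fst p) * g (snd p))"
  unfolding dx_def
  by (auto simp: fun_eq_iff intro!: vector_derivative_at has_vector_derivative_mult_left)

lemma dy_tensor: "(\<And>x. (g has_vector_derivative g' x) (at x)) \<Longrightarrow>
    dy (\<lambda>p. f (fst p) * g (snd p)) = (\<lambda>p. f (fst p) * g' (snd p))"
  unfolding dy_def
  by (auto simp: fun_eq_iff intro!: vector_derivative_at has_vector_derivative_mult_right)

text \<open>Coinduction on the set of products of two \<open>smooth1\<close> functions, which is
  preserved by both partial derivatives.\<close>

lemma smooth_fun_tensor:
  assumes "smooth1 f" "smooth1 g"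
  shows "smooth_fun (\<lambda>p. f (fst p) * g (snd p))"
proof -
  define X where "X \<phi> \<longleftrightarrow> (\<exists>f g. smooth1 f \<and> smooth1 g \<and> \<phi> = (\<lambda>p. f (fst p) * g (snd p)))" for \<phi>
  have "X (\<lambda>p. f (fst p) * g (snd p))" using assms unfolding X_def by blast
  then show ?thesis
  proof (rule smooth_fun.coinduct[where X = X])
    fix \<phi> assume "X \<phi>"
    then obtain f g where s: "smooth1 f" "smooth1 g" and \<phi>: "\<phi> = (\<lambda>p. f (fst p) * g (snd p))"
      unfolding X_def by blast
    obtain f' g' where d: "smooth1 f'" "smooth1 g'"
      "\<And>x. (f has_vector_derivative f' x) (at x)" "\<And>x. (g has_vector_derivative g' x) (at x)"
      using smooth1_deriv[OF s(1)] smooth1_deriv[OF s(2)] by blast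
    have "continuous_on UNIV \<phi>" unfolding \<phi>
      by (intro continuous_intros continuous_on_compose2[OF smooth1_continuous[OF s(1), of UNIV]]
          continuous_on_compose2[OF smooth1_continuous[OF s(2), of UNIV]]) auto
    moreover have "(\<lambda>s. \<phi> (s, y)) differentiable (at x)" "(\<lambda>s. \<phi> (x, s)) differentiable (at y)" for x y
    proof -
      have "((\<lambda>s. f s * g y) has_vector_derivative f' x * g y) (at x)"
        "((\<lambda>s. f x * g s) has_vector_derivative f x * g' y) (at y)"
        by (rule has_vector_derivative_mult_left[OF d(3)], rule has_vector_derivative_mult_right[OF d(4)])
      then show "(\<lambda>s. \<phi> (s, y)) differentiable (at x)" "(\<lambda>s. \<phi> (x, s)) differentiable (at y)"
        unfolding \<phi> by (auto simp: has_vector_derivative_def differentiable_def)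
    qed
    moreover have "X (dx \<phi>)" "X (dy \<phi>)"
      unfolding \<phi> dx_tensor[OF d(3)] dy_tensor[OF d(4)] X_def using s d by blast+
    ultimately show "\<exists>\<phi>'. \<phi> = \<phi>' \<and> continuous_on UNIV \<phi>' \<and>
        (\<forall>x y. (\<lambda>s. \<phi>' (s, y)) differentiable (at x)) \<and> (\<forall>x y. (\<lambda>s. \<phi>' (x, s)) differentiable (at y)) \<and>
        (X (dx \<phi>') \<or> smooth_fun (dx \<phi>')) \<and> (X (dy \<phi>') \<or> smooth_fun (dy \<phi>'))"
      by blast
  qed
qed

lemma test_fun_tensor:
  assumes f: "smooth1 f" "\<And>x. x \<notin> {d..1 - d} \<Longrightarrow> f x = 0" and g: "smooth1 g" "\<And>x. x \<notin> {d..1 - d} \<Longrightarrow> g x = 0"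
    and d: "d > 0"
  shows "test_fun (\<lambda>p. f (fst p) * g (snd p))"
  unfolding test_fun_def
proof (intro conjI exI[of _ "{d..1 - d} \<times> {d..1 - d}"])
  show "compact ({d..1 - d} \<times> {d..1 - d})" by (intro compact_Times compact_Icc)
qed (use assms smooth_fun_tensor in auto)

text \<open>A margin d > 0 keeps the support in a compact part of the open interval; d = 0 gives a
  weight that is positive on all of (0, 1) and still vanishes smoothly at its ends.\<close>

definition bump :: "real \<Rightarrow> real \<Rightarrow> real" where
  "bump d x = flat 0 (x - d) * flat 0 (1 - d - x)"

lemma bump_smooth1: "smooth1 (\<lambda>x. complex_of_real (bump d x))"
  using smooth1.mult[OF smooth1.flat[of 0 1 "- d"] smooth1.flat[of 0 "-1" "1 - d"]]
  by (simp add: bump_def algebra_simps)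

lemma bump_pos: "bump d x > 0 \<longleftrightarrow> d < x \<and> x < 1 - d"
  by (auto simp: bump_def flat_def)

lemma bump_nonneg: "bump d x \<ge> 0"
  by (auto simp: bump_def flat_def)

lemma bump_0: "x \<notin> {d..1 - d} \<Longrightarrow> bump d x = 0"
  by (auto simp: bump_def flat_def)

lemma smooth1_unit_exp: "smooth1 (\<lambda>x. unit_exp (r * x))"
  using smooth1.exp[of "2 * pi * \<i> * r"] by (simp add: unit_exp_def mult.assoc)


section \<open>Weak solutions of exponential type\<close>

text \<open>A primitive is constant on either side of the support, and integral zero makes the two
  constants equal; subtracting the constant yields compact support.\<close>

lemma smooth1_antiderivative:
  assumes \<rho>: "smooth1 \<rho>" "\<And>x. x \<notin> {d..1 - d} \<Longrightarrow> \<rho> x = 0" and d: "d > 0" "d < 1"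
    and int: "(LINT x|I01. \<rho> x) = 0"
  obtains a where "smooth1 a" "\<And>x. x \<notin> {d..1 - d} \<Longrightarrow> a x = 0"
    "\<And>x. (a has_vector_derivative \<rho> x) (at x)"
proof -
  \<comment> \<open>An interval larger than [0, 1] makes the derivatives at 0 and 1
    two-sided.\<close>
  obtain g where g: "\<And>x. x \<in> {-1..2} \<Longrightarrow> (g has_vector_derivative \<rho> x) (at x within {-1..2})"
    using antiderivative_continuous[OF smooth1_continuous[OF \<rho>(1)]] by metis
  have left: "g x = g 0" if "x \<in> {-1..<d}" for x
  proof -
    have "(g has_vector_derivative 0) (at x within {-1..<d})" if "x \<in> {-1..<d}" for x
    proof -
      have "{-1..<d} \<subseteq> {-1..2}" using d by (auto simp: subset_iff)
      from has_vector_derivative_within_subset[OF g this, of x] show ?thesis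
        using that d \<rho>(2)[of x] by auto
    qed
    then obtain c where "\<And>x. x \<in> {-1..<d} \<Longrightarrow> g x = c"
      using has_vector_derivative_zero_constant[of "{-1..<d}" g] by auto
    from this[OF that] this[of 0] show ?thesis using d by simp
  qed
  have right: "g x = g 1" if "x \<in> {1 - d<..2}" for x
  proof -
    have "(g has_vector_derivative 0) (at x within {1 - d<..2})" if "x \<in> {1 - d<..2}" for x
    proof -
      have "{1 - d<..2} \<subseteq> {-1..2}" using d by (auto simp: subset_iff)
      from has_vector_derivative_within_subset[OF g this, of x] show ?thesis
        using that d \<rho>(2)[of x] by auto
    qed
    then obtain c where "\<And>x. x \<in> {1 - d<..2} \<Longrightarrow> g x = c"
      using has_vector_derivative_zero_constant[of "{1 - d<..2}" g] by auto
    from this[OF that] this[of 1] show ?thesis using d by simp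
  qed
  have "C1_pair g \<rho>"
    unfolding C1_pair_def using smooth1_continuous[OF \<rho>(1)]
    by (auto intro: has_vector_derivative_within_subset[OF g])
  then have g01: "g 1 = g 0" using integral_C1_derivative[of g \<rho>] int by simp
  define a where "a x = (if x \<in> {-1..2} then g x - g 0 else 0)" for x
  have 0: "a x = 0" if "x \<notin> {d..1 - d}" for x
    using left[of x] right[of x] g01 that by (auto simp: a_def)
  have deriv: "(a has_vector_derivative \<rho> x) (at x)" for x
  proof -
    consider "x < 0" | "x > 1" | "x \<in> {-1<..<2}" by fastforce
    then show ?thesis
    proof cases
      case 1
      have "((\<lambda>x. 0) has_vector_derivative \<rho> x) (at x)" using \<rho>(2)[of x] 1 d by simp
      then show ?thesis
        by (rule has_vector_derivative_transform_within_open[where S = "{..<0}"]) (use 1 d 0 in auto)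
    next
      case 2
      have "((\<lambda>x. 0) has_vector_derivative \<rho> x) (at x)" using \<rho>(2)[of x] 2 d by simp
      then show ?thesis
        by (rule has_vector_derivative_transform_within_open[where S = "{1<..}"]) (use 2 d 0 in auto)
    next
      case 3
      then have "(g has_vector_derivative \<rho> x) (at x)"
        using g[of x] by (simp add: at_within_Icc_at)
      then have "((\<lambda>x. g x - g 0) has_vector_derivative \<rho> x) (at x)"
        using has_vector_derivative_diff[OF _ has_vector_derivative_const] by fastforce
      then show ?thesis
        by (rule has_vector_derivative_transform_within_open[where S = "{-1<..<2}"]) (use 3 in \<open>auto simp: a_def\<close>)
    qed
  qed
  show ?thesis by (rule that[OF smooth1.antideriv[OF \<rho>(1) deriv] 0 deriv])
qed

text \<open>The modulus is continuous and nonnegative with integral zero, hence vanishes at every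
  point.\<close>

lemma continuous_AE_zero:
  fixes h :: "real \<Rightarrow> complex"
  assumes h: "continuous_on {0..1} h" and 0: "AE x in I01. h x = 0" and x: "x \<in> {0..1}"
  shows "h x = 0"
proof -
  have c: "continuous_on {0..1} (\<lambda>x. cmod (h x))" by (intro continuous_intros h)
  have si: "set_integrable lborel {0..1} (\<lambda>x. cmod (h x))"
    unfolding set_integrable_def by (rule borel_integrable_compact[OF _ c]) simp
  have "integral {0..1} (\<lambda>x. cmod (h x)) = (LINT x:{0..1}|lborel. cmod (h x))"
    using set_borel_integral_eq_integral(2)[OF si] by simp
  also have "\<dots> = (LINT x|I01. cmod (h x))"
    unfolding unit_cube_real set_lebesgue_integral_def by (subst integral_restrict_space) auto
  also have "\<dots> = 0"
    by (rule integral_eq_zero_AE) (use 0 in \<open>auto elim: eventually_mono\<close>)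
  finally have "((\<lambda>x. cmod (h x)) has_integral 0) {0..1}"
    using integrable_integral[OF set_borel_integral_eq_integral(1)[OF si]] by simp
  then have "cmod (h x) = 0"
    using has_integral_0_cbox_imp_0[of 0 1 "\<lambda>x. cmod (h x)" x] c x by simp
  then show ?thesis by simp
qed

text \<open>The factor exp(-\<kappa> x) is an integrating factor: the term that its derivative
  contributes cancels against \<open>\<kappa> *\<^sub>C f\<close>, and only \<rho> = a'
  survives.\<close>

lemma weak_dx_test_tensor:
  assumes f: "weak_dx f (\<kappa> *\<^sub>C f)" and F: "sq_int F" "abs_L2 F = f"
    and a: "smooth1 a" "\<And>x. x \<notin> {d..1 - d} \<Longrightarrow> a x = 0"
    and \<rho>: "smooth1 \<rho>" "\<And>x. (a has_vector_derivative \<rho> x) (at x)"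
    and b: "smooth1 b" "\<And>x. x \<notin> {d..1 - d} \<Longrightarrow> b x = 0" and d: "d > 0"
  shows "(LINT p|unit_cube. exp (- \<kappa> * of_real (fst p)) * F p * (\<rho> (fst p) * b (snd p))) = 0"
proof -
  let ?e = "\<lambda>x. exp (- \<kappa> * complex_of_real x)"
  have ee: "smooth1 ?e" by (rule smooth1.exp)
  have e': "(?e has_vector_derivative - \<kappa> * ?e x) (at x)" for x
  proof -
    have "((\<lambda>w. exp (- \<kappa> * w)) has_field_derivative - \<kappa> * ?e x) (at (of_real x))"
      by (auto intro!: derivative_eq_intros)
    from has_vector_derivative_real_field[OF this] show ?thesis .
  qed
  define \<phi> where "\<phi> p = (?e (fst p) * a (fst p)) * b (snd p)" for p
  define \<psi> where "\<psi> p = ?e (fst p) * (\<rho> (fst p) * b (snd p))" for p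
  have t: "test_fun \<phi>" unfolding \<phi>_def
    by (rule test_fun_tensor[OF smooth1.mult[OF ee a(1)] _ b(1) _ d]) (use a b in auto)
  have cont: "continuous_on UNIV (\<lambda>p :: real \<times> real. k (fst p))" "continuous_on UNIV (\<lambda>p :: real \<times> real. k (snd p))"
    if "smooth1 k" for k
    by (intro continuous_on_compose2[OF smooth1_continuous[OF that, of UNIV]] continuous_intros; simp)+
  have c\<phi>: "continuous_on UNIV \<phi>" "continuous_on UNIV \<psi>"
    unfolding \<phi>_def \<psi>_def by (intro continuous_on_mult cont ee a(1) b(1) \<rho>(1))+
  have dx: "dx \<phi> p = \<psi> p - \<kappa> * \<phi> p" for p
    unfolding \<phi>_def
    by (subst dx_tensor[OF has_vector_derivative_mult[OF e' \<rho>(2)]]) (simp add: \<psi>_def algebra_simps)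
  have int: "integrable unit_cube (\<lambda>p. F p * k p)" and meas: "k \<in> borel_measurable unit_cube"
    if k: "continuous_on UNIV k" for k :: "real \<times> real \<Rightarrow> complex"
  proof -
    obtain B where "AE p in unit_cube. cmod (k p) \<le> B" "k \<in> borel_measurable unit_cube"
      by (rule continuous_cube_bounded[OF k])
    then show "integrable unit_cube (\<lambda>p. F p * k p)" "k \<in> borel_measurable unit_cube"
      using integrable_mult_bounded[OF sq_int_integrable[OF F(1)]] by blast+
  qed
  have "(LINT p|unit_cube. rep_L2 f p * dx \<phi> p) = - (LINT p|unit_cube. rep_L2 (\<kappa> *\<^sub>C f) p * \<phi> p)"
    using f t by (simp add: weak_dx_def)
  moreover have "(LINT p|unit_cube. rep_L2 f p * dx \<phi> p) = (LINT p|unit_cube. F p * \<psi> p) - \<kappa> * (LINT p|unit_cube. F p * \<phi> p)"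
  proof -
    have "(LINT p|unit_cube. rep_L2 f p * dx \<phi> p) = (LINT p|unit_cube. F p * dx \<phi> p)"
      unfolding F(2)[symmetric] dx using meas[OF c\<phi>(1)] meas[OF c\<phi>(2)]
      by (intro integral_rep_abs F) simp
    also have "\<dots> = (LINT p|unit_cube. F p * \<psi> p - \<kappa> * (F p * \<phi> p))"
      by (simp add: dx algebra_simps)
    finally show ?thesis using int[OF c\<phi>(1)] int[OF c\<phi>(2)] by simp
  qed
  moreover have "(LINT p|unit_cube. rep_L2 (\<kappa> *\<^sub>C f) p * \<phi> p) = \<kappa> * (LINT p|unit_cube. F p * \<phi> p)"
    unfolding F(2)[symmetric] scaleC_abs[OF F(1)]
    by (subst integral_rep_abs) (use F meas[OF c\<phi>(1)] in \<open>auto intro: sq_int_cmult simp: mult.assoc\<close>)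
  ultimately have "(LINT p|unit_cube. F p * \<psi> p) = 0" by simp
  then show ?thesis by (simp add: \<psi>_def mult_ac)
qed

lemma bump_Fourier_uniqueness:
  assumes "integrable I01 G" "\<And>j :: int. (LINT y|I01. G y * (complex_of_real (bump d y) * unit_exp (of_int j * y))) = 0"
  shows "AE y in I01. G y * complex_of_real (bump d y) = 0"
proof (rule Fourier_uniqueness)
  show "integrable I01 (\<lambda>y. G y * complex_of_real (bump d y))"
    by (rule integrable_mult_continuous[OF assms(1) smooth1_continuous[OF bump_smooth1]])
  show "(LINT y|I01. G y * complex_of_real (bump d y) * cnj (unit_exp (of_int n * y))) = 0" for n
    using assms(2)[of "- n"] by (simp add: mult.assoc cnj_unit_exp)
qed

text \<open>
  Testing with $e^{-\kappa x} a(x) b(y)$ shows that $e^{-\kappa x} f$ is orthogonal to all functions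
  $\rho(x) b(y)$ with $\int \rho = 0$, where $\rho = a'$. The functions
  $\rho = \eta\,(e_n - \gamma_n)$ with a bump function $\eta$ and suitable constants $\gamma_n$
  are sufficiently many to deduce that $e^{-\kappa x} f$ does not depend on \<open>x\<close>.
\<close>

lemma weak_exponential:
  assumes f: "weak_dx f (\<kappa> *\<^sub>C f)" and F: "sq_int F" "abs_L2 F = f"
    and cont: "AE y in I01. continuous_on {0..1} (\<lambda>x. F (x, y))"
  shows "AE y in I01. \<forall>x\<in>{0..1}. F (x, y) = exp (\<kappa> * of_real x) * F (0, y)"
proof -
  define \<Phi> where "\<Phi> p = exp (- \<kappa> * of_real (fst p)) * F p" for p
  have \<Phi>: "sq_int \<Phi>" unfolding \<Phi>_def by (rule sq_int_cexp_mult[OF F(1)])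
  have orth: "AE y in I01. (LINT x|I01. \<Phi> (x, y) * \<rho> x) = 0"
    if \<rho>: "smooth1 \<rho>" "\<And>x. x \<notin> {d..1 - d} \<Longrightarrow> \<rho> x = 0" "(LINT x|I01. \<rho> x) = 0" and d: "d > 0" "d < 1" for \<rho> d
  proof -
    obtain a where a: "smooth1 a" "\<And>x. x \<notin> {d..1 - d} \<Longrightarrow> a x = 0"
      "\<And>x. (a has_vector_derivative \<rho> x) (at x)"
      using smooth1_antiderivative[OF \<rho>(1,2) d \<rho>(3)] by blast
    have c\<rho>: "continuous_on UNIV (\<lambda>p :: real \<times> real. \<rho> (fst p))"
      by (intro continuous_on_compose2[OF smooth1_continuous[OF \<rho>(1), of UNIV]] continuous_intros) simp
    obtain B where B: "AE p in unit_cube. cmod (\<rho> (fst (p :: real \<times> real))) \<le> B" "(\<lambda>p :: real \<times> real. \<rho> (fst p)) \<in> borel_measurable unit_cube"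
      by (rule continuous_cube_bounded[OF c\<rho>])
    have i1: "integrable unit_cube (\<lambda>p. \<Phi> p * \<rho> (fst p))"
      by (rule integrable_mult_bounded[OF sq_int_integrable[OF \<Phi>] B(2,1)])
    define G where "G y = (LINT x|I01. \<Phi> (x, y) * \<rho> x)" for y
    have G: "integrable I01 G" unfolding G_def
      using integrable_slice_integral[OF i1] by simp
    have "AE y in I01. G y * complex_of_real (bump e y) = 0" if e: "0 < e" for e
    proof (rule bump_Fourier_uniqueness[OF G])
      fix j :: int
      let ?b = "\<lambda>y. complex_of_real (bump e y) * unit_exp (of_int j * y)"
      have b: "smooth1 ?b" by (intro smooth1.mult bump_smooth1 smooth1_unit_exp)
      have cb: "continuous_on UNIV (\<lambda>p :: real \<times> real. ?b (snd p))"
        by (intro continuous_on_compose2[OF smooth1_continuous[OF b, of UNIV]] continuous_intros) simp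
      obtain B' where B': "AE p in unit_cube. cmod (?b (snd (p :: real \<times> real))) \<le> B'" "(\<lambda>p :: real \<times> real. ?b (snd p)) \<in> borel_measurable unit_cube"
        by (rule continuous_cube_bounded[OF cb])
      have "integrable unit_cube (\<lambda>p. \<Phi> p * \<rho> (fst p) * ?b (snd p))"
        by (rule integrable_mult_bounded[OF i1 B'(2,1)])
      note i2 = integral_unit_cube_iterated[OF this]
      have "(LINT y|I01. G y * ?b y) = (LINT y|I01. LINT x|I01. \<Phi> (x, y) * \<rho> x * ?b y)"
        by (simp add: G_def)
      also have "\<dots> = (LINT p|unit_cube. exp (- \<kappa> * of_real (fst p)) * F p * (\<rho> (fst p) * ?b (snd p)))"
        using i2 by (simp add: \<Phi>_def mult.assoc)
      also have "\<dots> = 0"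
      proof (rule weak_dx_test_tensor[OF f F a(1) _ \<rho>(1) a(3) b])
        \<comment> \<open>The two factors have different margins; the smaller one serves
          both.\<close>
        show "a x = 0" if "x \<notin> {min d e..1 - min d e}" for x
          by (rule a(2)) (use that in \<open>auto simp: min_def split: if_splits\<close>)
        have "bump e x = 0" if "x \<notin> {min d e..1 - min d e}" for x
          by (rule bump_0) (use that in \<open>auto simp: min_def split: if_splits\<close>)
        then show "?b x = 0" if "x \<notin> {min d e..1 - min d e}" for x
          using that by simp
      qed (use d e in simp)
      finally show "(LINT y|I01. G y * ?b y) = 0" .
    qed
    \<comment> \<open>Countably many bumps exhaust the open interval, so one null set suffices and
      the weight can be divided out.\<close>
    then have "AE y in I01. \<forall>k. G y * complex_of_real (bump (1 / real (Suc k)) y) = 0"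
      by (intro AE_all_countable[THEN iffD2] allI) simp
    then show ?thesis
      using null_singleton_I01[of 0] null_singleton_I01[of 1] AE_space
    proof eventually_elim
      case (elim y)
      then have "min y (1 - y) > 0" by auto
      then obtain k where "1 / real (Suc k) < min y (1 - y)"
        using nat_approx_posE by blast
      then have "bump (1 / real (Suc k)) y > 0" unfolding bump_pos by auto
      then show ?case using elim(1) by (auto simp: G_def)
    qed
  qed
  \<comment> \<open>The offset 3 keeps the margin at most 1/3, so every bump is positive at 1/2,
    where the constants for different k will be compared.\<close>
  define \<eta> where "\<eta> k x = complex_of_real (bump (1 / real (k + 3)) x)" for k :: nat and x
  have \<eta>s: "smooth1 (\<eta> k)" for k unfolding \<eta>_def by (rule bump_smooth1)
  have \<eta>c: "continuous_on S (\<eta> k)" for k S by (rule smooth1_continuous[OF \<eta>s])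
  define I where "I k = (LINT x|I01. \<eta> k x)" for k
  have I: "I k \<noteq> 0" for k
  proof
    assume "I k = 0"
    have i: "integrable I01 (\<lambda>x. bump (1 / real (k + 3)) x)"
      using integrable_Re[OF integrable_continuous[OF \<eta>c[of "{0..1}" k]]] by (simp add: \<eta>_def)
    have "(LINT x|I01. bump (1 / real (k + 3)) x) = 0"
      using \<open>I k = 0\<close> unfolding I_def \<eta>_def by (simp only: integral_complex_of_real of_real_eq_0_iff)
    then have "AE x in I01. bump (1 / real (k + 3)) x = 0"
      using integral_nonneg_eq_0_iff_AE[OF i] bump_nonneg by simp
    then have "AE x in I01. \<eta> k x = 0" by (simp add: \<eta>_def)
    from continuous_AE_zero[OF \<eta>c this, of "1/2"] have "bump (1 / real (k + 3)) (1/2) = 0"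
      by (simp add: \<eta>_def)
    moreover have "bump (1 / real (k + 3)) (1/2) > 0"
      unfolding bump_pos by (simp add: field_simps)
    ultimately show False by simp
  qed
  \<comment> \<open>The constant for which \<open>\<eta> k\<close> times the shifted exponential has
    integral zero, as required by \<open>orth\<close>.\<close>
  define \<gamma> where "\<gamma> k n = (LINT x|I01. \<eta> k x * unit_exp (of_int n * x)) / I k" for k and n :: int
  have ie: "integrable I01 (\<lambda>x. \<eta> k x * unit_exp (of_int n * x))" "integrable I01 (\<eta> k)" for k and n :: int
    by (intro integrable_continuous continuous_intros \<eta>c)+
  have "AE y in I01. (LINT x|I01. \<Phi> (x, y) * (\<eta> k x * (unit_exp (of_int n * x) + - \<gamma> k n))) = 0" for k and n :: int
  proof (rule orth[where d = "1 / real (k + 3)"])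
    show "smooth1 (\<lambda>x. \<eta> k x * (unit_exp (of_int n * x) + - \<gamma> k n))"
      by (intro smooth1.mult smooth1.add \<eta>s smooth1_unit_exp smooth1.const)
    show "\<eta> k x * (unit_exp (of_int n * x) + - \<gamma> k n) = 0" if "x \<notin> {1 / real (k + 3)..1 - 1 / real (k + 3)}" for x
      using bump_0[OF that] by (simp add: \<eta>_def)
    have "(LINT x|I01. \<eta> k x * (unit_exp (of_int n * x) + - \<gamma> k n))
       = (LINT x|I01. \<eta> k x * unit_exp (of_int n * x) - \<gamma> k n * \<eta> k x)"
      by (simp add: algebra_simps)
    also have "\<dots> = \<gamma> k n * I k - \<gamma> k n * I k"
      using ie I[of k] by (simp add: \<gamma>_def I_def)
    finally show "(LINT x|I01. \<eta> k x * (unit_exp (of_int n * x) + - \<gamma> k n)) = 0" by simp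
  qed auto
  then have "AE y in I01. \<forall>k. \<forall>n :: int. (LINT x|I01. \<Phi> (x, y) * (\<eta> k x * (unit_exp (of_int n * x) + - \<gamma> k n))) = 0"
    by (simp add: AE_all_countable)
  moreover have "AE y in I01. integrable I01 (\<lambda>x. \<Phi> (x, y))"
    using sq_int_AE_slice[OF \<Phi>] by eventually_elim (rule sq_int_integrable)
  ultimately show ?thesis using cont
  proof eventually_elim
    case (elim y)
    define h where "h x = \<Phi> (x, y)" for x
    have h: "integrable I01 h" and hc: "continuous_on {0..1} h"
      using elim(2,3) by (auto simp: h_def[abs_def] \<Phi>_def intro!: continuous_intros)
    have const: "\<exists>C. \<forall>x. 1 / real (k + 3) < x \<and> x < 1 - 1 / real (k + 3) \<longrightarrow> h x = C" for k
    proof -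
      \<comment> \<open>The mean of \<open>h\<close> with weight \<open>\<eta> k\<close>.
        Subtracting it makes the weighted function orthogonal to all exponentials.\<close>
      define C where "C = (LINT x|I01. h x * \<eta> k x) / I k"
      have ih: "integrable I01 (\<lambda>x. h x * (\<eta> k x * unit_exp (of_int n * x)))" "integrable I01 (\<lambda>x. h x * \<eta> k x)" for n :: int
        by (intro integrable_mult_continuous[OF h] continuous_intros \<eta>c)+
      have "(LINT x|I01. (h x - C) * (\<eta> k x * unit_exp (of_int n * x))) = 0" for n :: int
      proof -
        have "0 = (LINT x|I01. h x * (\<eta> k x * unit_exp (of_int n * x)) - \<gamma> k n * (h x * \<eta> k x))"
          using elim(1)[rule_format, of k n] by (simp add: h_def algebra_simps)
        also have "\<dots> = (LINT x|I01. h x * (\<eta> k x * unit_exp (of_int n * x))) - \<gamma> k n * (C * I k)"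
          using ih I[of k] by (simp add: C_def)
        also have "\<gamma> k n * (C * I k) = C * (LINT x|I01. \<eta> k x * unit_exp (of_int n * x))"
          using I[of k] by (simp add: \<gamma>_def)
        finally have "(LINT x|I01. h x * (\<eta> k x * unit_exp (of_int n * x))) = C * (LINT x|I01. \<eta> k x * unit_exp (of_int n * x))"
          by simp
        then show ?thesis using ih ie by (simp add: left_diff_distrib)
      qed
      then have ae: "AE x in I01. (h x - C) * \<eta> k x = 0"
        unfolding \<eta>_def using h by (intro bump_Fourier_uniqueness) auto
      have z: "(h x - C) * \<eta> k x = 0" if "x \<in> {0..1}" for x
        by (rule continuous_AE_zero[OF _ ae that]) (intro continuous_intros hc \<eta>c)
      show ?thesis
      proof (intro exI[of _ C] allI impI)
        fix x assume x: "1 / real (k + 3) < x \<and> x < 1 - 1 / real (k + 3)"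
        then have "bump (1 / real (k + 3)) x > 0" unfolding bump_pos .
        moreover have "0 < 1 / real (k + 3)" by simp
        then have "x \<in> {0..1}" using x by (simp only: atLeastAtMost_iff) linarith
        ultimately show "h x = C" using z[of x] by (simp add: \<eta>_def)
      qed
    qed
    have eq: "h x = h (1/2)" if x: "x \<in> {0<..<1}" for x
    proof -
      have "min x (1 - x) > 0" using x by simp
      then obtain k where k: "1 / real (Suc k) < min x (1 - x)"
        using nat_approx_posE by blast
      have k3: "1 / real (k + 3) \<le> 1 / real (Suc k)" "1 / real (k + 3) \<le> 1 / 3"
        by (auto simp: field_simps)
      obtain C where "\<forall>x. 1 / real (k + 3) < x \<and> x < 1 - 1 / real (k + 3) \<longrightarrow> h x = C"
        using const[of k] by blast
      note C = this[rule_format]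
      have "h x = C" by (rule C) (use k k3 in linarith)
      moreover have "h (1/2) = C" by (rule C) (use k3 in linarith)
      ultimately show ?thesis by simp
    qed
    have hz: "h x - h (1/2) = 0" if "x \<in> {0..1}" for x
    proof (rule continuous_AE_zero[OF _ _ that])
      show "continuous_on {0..1} (\<lambda>x. h x - h (1/2))" by (intro continuous_intros hc)
      show "AE x in I01. h x - h (1/2) = 0"
        using null_singleton_I01[of 0] null_singleton_I01[of 1] AE_space
      proof eventually_elim
        case (elim x)
        then have "h x = h (1/2)" by (intro eq) simp
        then show ?case by simp
      qed
    qed
    show ?case
    proof
      fix x :: real assume "x \<in> {0..1}"
      then have "h x = h 0" using hz[of x] hz[of 0] by simp
      then have "exp (\<kappa> * of_real x) * h x = exp (\<kappa> * of_real x) * h 0" by simp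
      then show "F (x, y) = exp (\<kappa> * of_real x) * F (0, y)"
        by (simp add: h_def \<Phi>_def mult.assoc[symmetric] exp_add[symmetric])
    qed
  qed
qed


section \<open>The momentum operator with a diagonal boundary unitary\<close>

text \<open>Slices of a weak solution are exponentials, so the boundary condition reads
  \<open>U h = exp \<kappa> *\<^sub>C h\<close>, and isometry forces h = 0. The values at 0 and 1
  may come from different representatives, which have to be reconciled first.\<close>

lemma eigenvalue_solution_zero:
  assumes U: "unitary_op U" and \<kappa>: "Re \<kappa> \<noteq> 0"
    and f: "weak_dx f (\<kappa> *\<^sub>C f)" and h: "slice_x f 0 h" "slice_x f 1 (U h)"
  shows "f = 0"
proof -
  obtain F where F: "sq_int F" "abs_L2 F = f" "AE y in I01. continuous_on {0..1} (\<lambda>x. F (x, y))"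
      "sq_int (\<lambda>y. F (0, y))" "abs_L2 (\<lambda>y. F (0, y)) = h"
    using h(1) unfolding slice_x_def by blast
  obtain F' where F': "sq_int F'" "abs_L2 F' = f" "AE y in I01. continuous_on {0..1} (\<lambda>x. F' (x, y))"
      "sq_int (\<lambda>y. F' (1, y))" "abs_L2 (\<lambda>y. F' (1, y)) = U h"
    using h(2) unfolding slice_x_def by blast
  note e = weak_exponential[OF f F(1-3)] and e' = weak_exponential[OF f F'(1-3)]
  have "AE p in unit_cube. F p = F' p"
    using abs_L2_eq_iff[OF F(1) F'(1)] F(2) F'(2) by simp
  then have "AE y in I01. AE x in I01. F (x, y) = F' (x, y)"
    by (rule AE_pair_iterated(2))
  then have "AE y in I01. F' (1, y) = exp \<kappa> * F (0, y)"
    using e e'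
  proof eventually_elim
    case (elim y)
    from AE_E[OF elim(1)] obtain N where N: "{x \<in> space I01. \<not> F (x, y) = F' (x, y)} \<subseteq> N"
      "emeasure I01 N = 0" "N \<in> sets I01" by blast
    \<comment> \<open>One common point is enough, since both slices are multiples of the same
      nowhere vanishing exponential.\<close>
    have "\<exists>x\<in>space I01. F (x, y) = F' (x, y)"
    proof (rule ccontr)
      assume "\<not> ?thesis"
      then have "space I01 \<subseteq> N" using N(1) by auto
      then have "emeasure I01 (space I01) \<le> emeasure I01 N" using N(3) by (rule emeasure_mono)
      then show False using N(2) emeasure_space_unit_cube[where 'a = real] by simp
    qed
    then obtain x where x: "x \<in> {0..1}" "F (x, y) = F' (x, y)" by auto
    have "exp (\<kappa> * of_real x) * F (0, y) = F (x, y)"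
      by (rule elim(2)[rule_format, OF x(1), symmetric])
    also note x(2)
    also have "F' (x, y) = exp (\<kappa> * of_real x) * F' (0, y)"
      by (rule elim(3)[rule_format, OF x(1)])
    finally have "F (0, y) = F' (0, y)" by simp
    moreover have "F' (1, y) = exp (\<kappa> * of_real 1) * F' (0, y)"
      by (rule elim(3)[rule_format]) simp
    ultimately show ?case by simp
  qed
  then have "abs_L2 (\<lambda>y. F' (1, y)) = abs_L2 (\<lambda>y. exp \<kappa> * F (0, y))"
    by (subst abs_L2_eq_iff[OF F'(4) sq_int_cmult[OF F(4)]])
  then have "U h = exp \<kappa> *\<^sub>C h"
    by (simp only: F(5) F'(5) scaleC_abs[OF F(4), symmetric])
  then have "norm h = cmod (exp \<kappa>) * norm h"
    using unitary_norm[OF U, of h] by (simp add: norm_scaleC)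
  then have "norm h * (exp (Re \<kappa>) - 1) = 0" by (simp add: algebra_simps)
  then have "h = 0" using \<kappa> by simp
  then have "AE y in I01. F (0, y) = 0"
    using F(5) abs_L2_eq_iff[OF F(4) sq_int_zero] unfolding zero_abs by (simp only:)
  then have "AE p in unit_cube. F (0, snd (p :: real \<times> real)) = 0"
    by (rule AE_pair_snd)
  moreover have "AE p in unit_cube. \<forall>x\<in>{0..1}. F (x, snd (p :: real \<times> real)) = exp (\<kappa> * of_real x) * F (0, snd p)"
    by (rule AE_pair_snd[OF e])
  ultimately have "AE p in unit_cube. F p = 0"
    using AE_space
  proof eventually_elim
    case (elim p)
    have "fst p \<in> {0..1}" using elim(3) by (cases p) (simp add: unit_cube_pair space_pair_measure)
    from elim(2)[rule_format, OF this] show ?case using elim(1) by simp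
  qed
  then show "f = 0"
    using abs_L2_eq_iff[OF F(1) sq_int_zero] F(2) unfolding zero_abs by (simp only:)
qed

lemma unitary_inv:
  assumes "unitary_op U"
  shows "U (inv U f) = f" "norm (inv U f - inv U g) = norm (f - g)"
proof -
  have s: "surj U" using assms by (simp add: unitary_op_def)
  then show 1: "U (inv U f) = f" for f by (rule surj_f_inv_f)
  show "norm (inv U f - inv U g) = norm (f - g)"
    using unitary_norm[OF assms, of "inv U f - inv U g"] by (simp add: unitary_diff[OF assms] 1)
qed

text \<open>After application of the inverse of \<open>U\<close> this is a fixed point equation for
  a map that contracts by the factor \<open>cmod z\<close>.\<close>

lemma unitary_shift_solution:
  assumes U: "unitary_op U" and z: "cmod z < 1"
  shows "\<exists>c. U c = z *\<^sub>C (c + t)"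
proof -
  have "\<exists>!c. inv U (z *\<^sub>C (c + t)) = c"
  proof (rule banach_fix_type[OF norm_ge_zero z], intro allI)
    fix c d
    have "dist (inv U (z *\<^sub>C (c + t))) (inv U (z *\<^sub>C (d + t))) = norm (z *\<^sub>C (c + t) - z *\<^sub>C (d + t))"
      by (simp add: dist_norm unitary_inv[OF U])
    also have "z *\<^sub>C (c + t) - z *\<^sub>C (d + t) = z *\<^sub>C (c - d)"
      by (simp add: scaleC_diff_right[symmetric])
    finally show "dist (inv U (z *\<^sub>C (c + t))) (inv U (z *\<^sub>C (d + t))) \<le> cmod z * dist c d"
      by (simp add: dist_norm norm_scaleC)
  qed
  then obtain c where "inv U (z *\<^sub>C (c + t)) = c" by blast
  then have "U c = z *\<^sub>C (c + t)" using unitary_inv(1)[OF U] by metis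
  then show ?thesis ..
qed

lemma cinner_exp_fun_int:
  "cinner (exp_fun (r + of_int m)) (exp_fun (r + of_int n)) = (if m = n then 1 else 0)"
proof (cases "m = n")
  case True
  then show ?thesis by (simp add: cinner_self)
next
  case False
  then show ?thesis
    using cinner_exp_fun[of "r + of_int m" "r + of_int n"] unit_exp_int[of "m - n"] by simp
qed

lemma exp_fun_tensor_total_snd:
  assumes "\<And>m n. cinner f (exp_fun (\<beta> m + of_int n) \<otimes>\<^sub>L exp_fun (\<gamma> + of_int m)) = 0"
  shows "f = 0"
proof -
  have "swap_L2 f = 0"
  proof (rule exp_fun_tensor_total)
    show "cinner (swap_L2 f) (exp_fun (\<gamma> + of_int m) \<otimes>\<^sub>L exp_fun (\<beta> m + of_int n)) = 0" for m n
      using assms[of m n] cinner_swap[of f "exp_fun (\<beta> m + of_int n) \<otimes>\<^sub>L exp_fun (\<gamma> + of_int m)"]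
      by (simp add: swap_tensor)
  qed
  then show ?thesis using norm_swap[of f] by simp
qed

text \<open>
  Both \<open>P_op U\<close> and the diagonal operator have a resolvent at $\kappa/(2\pi i)$, $\kappa = -1$,
  and the explicit solution of $\partial_x f = \kappa f + g$ lies in both domains.
\<close>

lemma P_op_diagonal:
  assumes U: "unitary_op U"
    and eig: "\<And>m. U (exp_fun (\<gamma> + of_int m)) = unit_exp (\<beta> m) *\<^sub>C exp_fun (\<gamma> + of_int m)"
  shows "P_op U = {(f, g). \<forall>m n. cinner g (exp_fun (\<beta> m + of_int n) \<otimes>\<^sub>L exp_fun (\<gamma> + of_int m))
      = of_real (\<beta> m + of_int n) * cinner f (exp_fun (\<beta> m + of_int n) \<otimes>\<^sub>L exp_fun (\<gamma> + of_int m))}"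
    (is "_ = ?D")
proof -
  define \<kappa> :: complex where "\<kappa> = - 1"
  define E where "E m n = exp_fun (\<beta> m + of_int n) \<otimes>\<^sub>L exp_fun (\<gamma> + of_int m)" for m n :: int
  have D: "(f, g) \<in> ?D \<longleftrightarrow> (\<forall>m n. cinner g (E m n) = of_real (\<beta> m + of_int n) * cinner f (E m n))" for f g
    by (simp add: E_def)
  have solution: "\<exists>f h. weak_dx f (\<kappa> *\<^sub>C f + g) \<and> slice_x f 0 h \<and> slice_x f 1 (U h) \<and>
      (\<forall>m n. cinner (\<kappa> *\<^sub>C f + g) (E m n) = 2 * pi * \<i> * of_real (\<beta> m + of_int n) * cinner f (E m n))" for g
  proof -
    obtain T where T: "\<And>c. \<exists>f. weak_dx f (\<kappa> *\<^sub>C f + g) \<and> slice_x f 0 c \<and> slice_x f 1 (exp \<kappa> *\<^sub>C (c + T)) \<and>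
      (\<forall>r v. cinner (\<kappa> *\<^sub>C f + g) (exp_fun r \<otimes>\<^sub>L v) = 2 * pi * \<i> * r * cinner f (exp_fun r \<otimes>\<^sub>L v)
        + unit_exp (- r) * cinner (exp \<kappa> *\<^sub>C (c + T)) v - cinner c v)"
      using explicit_solution[of \<kappa> g] by blast
    \<comment> \<open>With this bound the boundary equation for the initial value is contractive and
      solvable.\<close>
    have "cmod (exp \<kappa>) < 1" by (simp add: \<kappa>_def)
    then obtain c where c: "U c = exp \<kappa> *\<^sub>C (c + T)"
      using unitary_shift_solution[OF U] by blast
    obtain f where f: "weak_dx f (\<kappa> *\<^sub>C f + g)" "slice_x f 0 c" "slice_x f 1 (U c)" and
      f': "\<And>r v. cinner (\<kappa> *\<^sub>C f + g) (exp_fun r \<otimes>\<^sub>L v) = 2 * pi * \<i> * r * cinner f (exp_fun r \<otimes>\<^sub>L v)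
        + unit_exp (- r) * cinner (U c) v - cinner c v"
      using T[of c] unfolding c by blast
    \<comment> \<open>The frequency \<open>\<beta> m + of_int n\<close> has the same phase as the
      eigenvalue of \<open>U\<close>, so the boundary terms cancel.\<close>
    have "unit_exp (- (\<beta> m + of_int n)) * cinner (U c) (exp_fun (\<gamma> + of_int m)) = cinner c (exp_fun (\<gamma> + of_int m))" for m n :: int
    proof -
      have "cnj (unit_exp (\<beta> m)) * cinner (U c) (exp_fun (\<gamma> + of_int m)) = cinner (U c) (U (exp_fun (\<gamma> + of_int m)))"
        by (simp add: eig cinner_simps)
      also have "\<dots> = cinner c (exp_fun (\<gamma> + of_int m))" by (rule unitary_cinner[OF U])
      finally show ?thesis
        using unit_exp_add_int[of "- \<beta> m" "- n"] by (simp add: cnj_unit_exp)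
    qed
    then have "cinner (\<kappa> *\<^sub>C f + g) (E m n) = 2 * pi * \<i> * of_real (\<beta> m + of_int n) * cinner f (E m n)" for m n
      by (simp only: E_def f') simp
    with f show ?thesis by blast
  qed
  have "(f, g) \<in> P_op U \<longleftrightarrow> (f, g) \<in> ?D" for f g
  proof -
    let ?c = "2 * pi * \<i>"
    \<comment> \<open>The right-hand side is chosen so that \<open>f\<close> itself solves the
      equation whenever \<open>(f, g)\<close> lies in either operator. The solution
      \<open>f'\<close> lies in both domains, and uniqueness on the respective side gives f' =
      f.\<close>
    obtain f' h' where f': "weak_dx f' (\<kappa> *\<^sub>C f' + (?c *\<^sub>C g - \<kappa> *\<^sub>C f))" "slice_x f' 0 h'" "slice_x f' 1 (U h')"
      and E: "\<And>m n. cinner (\<kappa> *\<^sub>C f' + (?c *\<^sub>C g - \<kappa> *\<^sub>C f)) (E m n) = ?c * of_real (\<beta> m + of_int n) * cinner f' (E m n)"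
      using solution[of "?c *\<^sub>C g - \<kappa> *\<^sub>C f"] by blast
    show ?thesis
    proof
      assume "(f, g) \<in> P_op U"
      then obtain h where h: "weak_dx f (?c *\<^sub>C g)" "slice_x f 0 h" "slice_x f 1 (U h)"
        by (rule P_opE)
      have "f - f' = 0"
      proof (rule eigenvalue_solution_zero[OF U])
        have "?c *\<^sub>C g - (\<kappa> *\<^sub>C f' + (?c *\<^sub>C g - \<kappa> *\<^sub>C f)) = \<kappa> *\<^sub>C (f - f')"
          by (simp add: scaleC_diff_right)
        then show "weak_dx (f - f') (\<kappa> *\<^sub>C (f - f'))"
          using weak_dx_diff[OF h(1) f'(1)] by simp
        show "slice_x (f - f') 0 (h - h')" by (rule slice_x_diff[OF h(2) f'(2)])
        show "slice_x (f - f') 1 (U (h - h'))"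
          using slice_x_diff[OF h(3) f'(3)] by (simp add: unitary_diff[OF U])
      qed (simp add: \<kappa>_def)
      then have "f' = f" by simp
      then show "(f, g) \<in> ?D" unfolding D using E by (simp add: cinner_simps mult.assoc)
    next
      assume "(f, g) \<in> ?D"
      then have fg: "cinner g (E m n) = of_real (\<beta> m + of_int n) * cinner f (E m n)" for m n
        unfolding D by blast
      have "f' - f = 0"
      proof (rule exp_fun_tensor_total_snd[of _ \<beta> \<gamma>])
        fix m n
        let ?\<mu> = "of_real (\<beta> m + of_int n) :: complex"
        have "(?c * ?\<mu> - \<kappa>) * cinner (f' - f) (E m n) = 0"
          using E[of m n] by (simp only: cinner_simps fg) (simp add: algebra_simps)
        moreover have "Re (?c * ?\<mu> - \<kappa>) \<noteq> 0" by (simp add: \<kappa>_def)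
        then have "?c * ?\<mu> - \<kappa> \<noteq> 0" by (metis zero_complex.sel(1))
        ultimately show "cinner (f' - f) (exp_fun (\<beta> m + of_int n) \<otimes>\<^sub>L exp_fun (\<gamma> + of_int m)) = 0"
          by (simp add: E_def)
      qed
      then have "f' = f" by simp
      then show "(f, g) \<in> P_op U" using f' by (intro P_opI[of f g h']) simp_all
    qed
  qed
  then show ?thesis by auto
qed

lemma P_op_exp_group:
  assumes U: "unitary_op U"
    and eig: "\<And>m. U (exp_fun (\<gamma> + of_int m)) = unit_exp (\<beta> m) *\<^sub>C exp_fun (\<gamma> + of_int m)"
  shows "\<exists>W. is_exp_group (P_op U) W"
proof -
  \<comment> \<open>An enumeration of pairs of integers turns the doubly indexed eigenbasis into a
    sequence for \<open>diag_exp_group\<close>.\<close>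
  define d where "d i = (int_decode (fst (prod_decode i)), int_decode (snd (prod_decode i)))" for i
  have d: "\<exists>i. d i = p" for p :: "int \<times> int"
    by (rule exI[of _ "prod_encode (int_encode (fst p), int_encode (snd p))"]) (simp add: d_def)
  have d_inj: "d i = d j \<longleftrightarrow> i = j" for i j
    by (auto simp: d_def prod_eq_iff[symmetric])
       (metis int_decode_inverse prod.collapse prod_decode_inverse)
  define E where "E m n = exp_fun (\<beta> m + of_int n) \<otimes>\<^sub>L exp_fun (\<gamma> + of_int m)" for m n :: int
  define \<mu> where "\<mu> i = \<beta> (fst (d i)) + of_int (snd (d i))" for i
  have "is_exp_group {(f, g). \<forall>i. cinner g (case_prod E (d i)) = of_real (\<mu> i) * cinner f (case_prod E (d i))}
     (\<lambda>t. diag_op (\<lambda>i. case_prod E (d i)) (\<lambda>i. unit_exp (\<mu> i * t)))"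
  proof (rule diag_exp_group)
    fix i j
    show "cinner (case_prod E (d i)) (case_prod E (d j)) = (if i = j then 1 else 0)"
    proof (cases "fst (d i) = fst (d j)")
      case True
      then show ?thesis
        using d_inj[of i j] by (auto simp: case_prod_beta E_def cinner_tensor cinner_exp_fun_int prod_eq_iff)
    next
      case False
      then show ?thesis by (auto simp: case_prod_beta E_def cinner_tensor cinner_exp_fun_int)
    qed
  next
    fix f assume 0: "\<And>i. cinner f (case_prod E (d i)) = 0"
    show "f = 0"
    proof (rule exp_fun_tensor_total_snd[of _ \<beta> \<gamma>])
      show "cinner f (exp_fun (\<beta> m + of_int n) \<otimes>\<^sub>L exp_fun (\<gamma> + of_int m)) = 0" for m n
      proof -
        obtain i where "d i = (m, n)" using d by blast
        with 0[of i] show ?thesis by (simp add: E_def)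
      qed
    qed
  qed
  moreover have "{(f, g). \<forall>i. cinner g (case_prod E (d i)) = of_real (\<mu> i) * cinner f (case_prod E (d i))} = P_op U"
  proof -
    have "(\<forall>i. cinner g (case_prod E (d i)) = of_real (\<mu> i) * cinner f (case_prod E (d i))) \<longleftrightarrow>
      (\<forall>m n. cinner g (E m n) = of_real (\<beta> m + of_int n) * cinner f (E m n))" for f g
    proof safe
      fix m n assume 0: "\<forall>i. cinner g (case_prod E (d i)) = of_real (\<mu> i) * cinner f (case_prod E (d i))"
      obtain i where "d i = (m, n)" using d by blast
      with 0[rule_format, of i] show "cinner g (E m n) = of_real (\<beta> m + of_int n) * cinner f (E m n)"
        by (simp add: \<mu>_def)
    qed (simp add: \<mu>_def case_prod_beta)
    then show ?thesis unfolding P_op_diagonal[OF U eig] E_def by auto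
  qed
  ultimately show ?thesis by auto
qed


section \<open>The time one map\<close>

lemma dx_swap: "dx (\<lambda>p. \<phi> (snd p, fst p)) = (\<lambda>p. dy \<phi> (snd p, fst p))"
  and dy_swap: "dy (\<lambda>p. \<phi> (snd p, fst p)) = (\<lambda>p. dx \<phi> (snd p, fst p))"
  by (auto simp: dx_def dy_def fun_eq_iff)

text \<open>The exchange turns \<open>dx\<close> into \<open>dy\<close> and conversely, so the
  exchanged smooth functions form a coinductive invariant.\<close>

lemma smooth_fun_swap:
  assumes "smooth_fun \<phi>"
  shows "smooth_fun (\<lambda>p. \<phi> (snd p, fst p))"
proof -
  define X where "X \<psi> \<longleftrightarrow> (\<exists>\<phi>. smooth_fun \<phi> \<and> \<psi> = (\<lambda>p. \<phi> (snd p, fst p)))" for \<psi> :: "real \<times> real \<Rightarrow> complex"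
  have "X (\<lambda>p. \<phi> (snd p, fst p))" using assms unfolding X_def by blast
  then show ?thesis
  proof (rule smooth_fun.coinduct[where X = X])
    fix \<psi> assume "X \<psi>"
    then obtain \<phi> where s: "smooth_fun \<phi>" and \<psi>: "\<psi> = (\<lambda>p. \<phi> (snd p, fst p))"
      unfolding X_def by blast
    have "continuous_on UNIV \<psi>" unfolding \<psi>
      by (intro continuous_on_compose2[OF smooth_funD(1)[OF s]] continuous_intros) simp
    moreover have "(\<lambda>s. \<psi> (s, y)) differentiable (at x)" "(\<lambda>s. \<psi> (x, s)) differentiable (at y)" for x y
      using smooth_funD(5)[OF s, of y x] smooth_funD(4)[OF s, of x y]
      unfolding \<psi> by (auto simp: has_vector_derivative_def differentiable_def)
    moreover have "X (dx \<psi>)" "X (dy \<psi>)"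
      unfolding \<psi> dx_swap dy_swap X_def using smooth_funD(2,3)[OF s] by blast+
    ultimately show "\<exists>\<phi>'. \<psi> = \<phi>' \<and> continuous_on UNIV \<phi>' \<and>
        (\<forall>x y. (\<lambda>s. \<phi>' (s, y)) differentiable (at x)) \<and> (\<forall>x y. (\<lambda>s. \<phi>' (x, s)) differentiable (at y)) \<and>
        (X (dx \<phi>') \<or> smooth_fun (dx \<phi>')) \<and> (X (dy \<phi>') \<or> smooth_fun (dy \<phi>'))"
      by blast
  qed
qed

lemma test_fun_swap:
  assumes "test_fun \<phi>"
  shows "test_fun (\<lambda>p. \<phi> (snd p, fst p))"
proof -
  obtain K where K: "compact K" "K \<subseteq> {0<..<1} \<times> {0<..<1}" "\<And>p. p \<notin> K \<Longrightarrow> \<phi> p = 0"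
    using assms by (auto simp: test_fun_def)
  show ?thesis unfolding test_fun_def
  proof (intro conjI exI[of _ "(\<lambda>p. (snd p, fst p)) ` K"] allI impI)
    show "smooth_fun (\<lambda>p. \<phi> (snd p, fst p))"
      using assms by (intro smooth_fun_swap) (simp add: test_fun_def)
    show "compact ((\<lambda>p. (snd p, fst p)) ` K)"
      by (intro compact_continuous_image continuous_intros K)
    show "(\<lambda>p. (snd p, fst p)) ` K \<subseteq> {0<..<1} \<times> {0<..<1}" using K(2) by auto
    show "\<phi> (snd p, fst p) = 0" if "p \<notin> (\<lambda>p. (snd p, fst p)) ` K" for p
      using that by (intro K(3)) (force simp: image_iff)
  qed
qed

lemma weak_dy_cinner:
  "weak_dy f g \<longleftrightarrow> (\<forall>\<phi>. test_fun \<phi> \<longrightarrow>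
     cinner f (abs_L2 (\<lambda>p. cnj (dy \<phi> p))) = - cinner g (abs_L2 (\<lambda>p. cnj (\<phi> p))))"
  unfolding weak_dy_def
  by (intro all_cong1 imp_cong refl)
    (simp add: test_fun_def integral_rep_eq_cinner sq_int_continuous_cube smooth_funD(1,3))

lemma sq_int_cnj:
  assumes "sq_int f" shows "sq_int (\<lambda>p. cnj (f p))"
  using assms borel_measurable_cnj[OF sq_int_measurable[OF assms]] by (simp add: sq_int_def)

lemma cinner_swap_abs:
  assumes "sq_int k"
  shows "cinner (swap_L2 f) (abs_L2 k) = cinner f (abs_L2 (\<lambda>p. k (snd p, fst p)))"
  using cinner_swap[of f "abs_L2 (\<lambda>p. k (snd p, fst p))"] by (simp add: swap_abs[OF sq_int_swap[OF assms]])

lemma weak_dy_swap: "weak_dy (swap_L2 f) (swap_L2 g) \<longleftrightarrow> weak_dx f g"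
proof -
  have 1: "cinner (swap_L2 f) (abs_L2 (\<lambda>p. cnj (dy \<phi> p))) = cinner f (abs_L2 (\<lambda>p. cnj (dx (\<lambda>p. \<phi> (snd p, fst p)) p)))"
    "cinner (swap_L2 f) (abs_L2 (\<lambda>p. cnj (\<phi> p))) = cinner f (abs_L2 (\<lambda>p. cnj (\<phi> (snd p, fst p))))"
    if "test_fun \<phi>" for f and \<phi> :: "real \<times> real \<Rightarrow> complex"
    using that unfolding test_fun_def
    by (auto simp: cinner_swap_abs sq_int_cnj sq_int_continuous_cube smooth_funD(1,3) dx_swap)
  show ?thesis
  proof
    assume w: "weak_dx f g"
    show "weak_dy (swap_L2 f) (swap_L2 g)"
      unfolding weak_dy_cinner
    proof (intro allI impI)
      fix \<phi> assume t: "test_fun \<phi>"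
      show "cinner (swap_L2 f) (abs_L2 (\<lambda>p. cnj (dy \<phi> p))) = - cinner (swap_L2 g) (abs_L2 (\<lambda>p. cnj (\<phi> p)))"
        unfolding 1[OF t] using w test_fun_swap[OF t] unfolding weak_dx_cinner by blast
    qed
  next
    assume w: "weak_dy (swap_L2 f) (swap_L2 g)"
    show "weak_dx f g"
      unfolding weak_dx_cinner
    proof (intro allI impI)
      fix \<phi> assume t: "test_fun \<phi>"
      show "cinner f (abs_L2 (\<lambda>p. cnj (dx \<phi> p))) = - cinner g (abs_L2 (\<lambda>p. cnj (\<phi> p)))"
        using w[unfolded weak_dy_cinner, rule_format, OF test_fun_swap[OF t]]
        unfolding 1[OF test_fun_swap[OF t]] by simp
    qed
  qed
qed

lemma slice_y_swap: "slice_y (swap_L2 f) b h \<longleftrightarrow> slice_x f b h"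
proof
  assume "slice_x f b h"
  then obtain F where F: "sq_int F" "abs_L2 F = f" "AE y in I01. continuous_on {0..1} (\<lambda>x. F (x, y))"
      "sq_int (\<lambda>y. F (b, y))" "abs_L2 (\<lambda>y. F (b, y)) = h"
    unfolding slice_x_def by blast
  then show "slice_y (swap_L2 f) b h"
    unfolding slice_y_def by (intro exI[of _ "\<lambda>p. F (snd p, fst p)"]) (auto simp: swap_abs[symmetric] sq_int_swap)
next
  assume "slice_y (swap_L2 f) b h"
  then obtain F where F: "sq_int F" "abs_L2 F = swap_L2 f" "AE x in I01. continuous_on {0..1} (\<lambda>y. F (x, y))"
      "sq_int (\<lambda>x. F (x, b))" "abs_L2 (\<lambda>x. F (x, b)) = h"
    unfolding slice_y_def by blast
  then show "slice_x f b h"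
    unfolding slice_x_def by (intro exI[of _ "\<lambda>p. F (snd p, fst p)"]) (auto simp: swap_abs[symmetric] sq_int_swap)
qed

lemma Q_op_swap: "Q_op V = {(f, g). (swap_L2 f, swap_L2 g) \<in> P_op V}"
proof -
  have "(f, g) \<in> Q_op V \<longleftrightarrow> (swap_L2 f, swap_L2 g) \<in> P_op V" for f g
  proof
    assume "(f, g) \<in> Q_op V"
    then obtain g' h where g: "g = (1 / (2 * pi * \<i>)) *\<^sub>C g'" and w: "weak_dy f g'" "slice_y f 0 h" "slice_y f 1 (V h)"
      unfolding Q_op_def by blast
    have "weak_dx (swap_L2 f) (swap_L2 g')" "slice_x (swap_L2 f) 0 h" "slice_x (swap_L2 f) 1 (V h)"
      using w weak_dy_swap[of "swap_L2 f" "swap_L2 g'"] slice_y_swap[of "swap_L2 f"] by simp_all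
    then show "(swap_L2 f, swap_L2 g) \<in> P_op V"
      unfolding P_op_def g swap_scaleC by blast
  next
    assume "(swap_L2 f, swap_L2 g) \<in> P_op V"
    then obtain g' h where g: "swap_L2 g = (1 / (2 * pi * \<i>)) *\<^sub>C g'"
      and w: "weak_dx (swap_L2 f) g'" "slice_x (swap_L2 f) 0 h" "slice_x (swap_L2 f) 1 (V h)"
      unfolding P_op_def by blast
    have "weak_dy f (swap_L2 g')" "slice_y f 0 h" "slice_y f 1 (V h)"
      using w weak_dy_swap[of "swap_L2 f" "g'"] slice_y_swap[of "swap_L2 f"] by simp_all
    moreover have "g = (1 / (2 * pi * \<i>)) *\<^sub>C swap_L2 g'"
      using arg_cong[OF g, of swap_L2] by (simp only: swap_swap swap_scaleC)
    ultimately show "(f, g) \<in> Q_op V" unfolding Q_op_def by blast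
  qed
  then show ?thesis by auto
qed

lemma exp_group_swap:
  assumes W: "is_exp_group A W"
  shows "is_exp_group {(f, g). (swap_L2 f, swap_L2 g) \<in> A} (\<lambda>t f. swap_L2 (W t (swap_L2 f)))"
  unfolding is_exp_group_def
proof (intro conjI allI)
  note u = exp_group_unitary[OF W]
  show "unitary_op (\<lambda>f. swap_L2 (W t (swap_L2 f)))" for t
    unfolding unitary_op_def
  proof (intro conjI allI)
    show "surj (\<lambda>f. swap_L2 (W t (swap_L2 f)))"
      by (rule surjI[of _ "\<lambda>f. swap_L2 (W (- t) (swap_L2 f))"]) (simp add: exp_group_inverse[OF W])
  qed (simp_all add: swap_add swap_scaleC cinner_swap unitary_add[OF u] unitary_scaleC[OF u] unitary_cinner[OF u])
  show "(\<lambda>f. swap_L2 (W 0 (swap_L2 f))) = id"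
    by (auto simp: exp_group_0[OF W])
  show "(\<lambda>f. swap_L2 (W (s + t) (swap_L2 f))) = (\<lambda>f. swap_L2 (W s (swap_L2 f))) \<circ> (\<lambda>f. swap_L2 (W t (swap_L2 f)))" for s t
    by (auto simp: exp_group_add[OF W])
  show "continuous_on UNIV (\<lambda>t. swap_L2 (W t (swap_L2 f)))" for f
    using W by (intro bounded_linear.continuous_on[OF bounded_linear_swap]) (simp add: is_exp_group_def)
  have "(swap_L2 f, swap_L2 g) \<in> A \<longleftrightarrow>
     ((\<lambda>t. swap_L2 (W t (swap_L2 f))) has_vector_derivative (2 * pi * \<i>) *\<^sub>C g) (at 0)" for f g
    unfolding exp_group_generator[OF W]
    using bounded_linear.has_vector_derivative[OF bounded_linear_swap, of "\<lambda>t. W t (swap_L2 f)" "(2 * pi * \<i>) *\<^sub>C swap_L2 g"]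
      bounded_linear.has_vector_derivative[OF bounded_linear_swap, of "\<lambda>t. swap_L2 (W t (swap_L2 f))" "(2 * pi * \<i>) *\<^sub>C g"]
    by (auto simp only: swap_scaleC swap_swap)
  then show "{(f, g). (swap_L2 f, swap_L2 g) \<in> A} = {(f, g).
     ((\<lambda>t. swap_L2 (W t (swap_L2 f))) has_vector_derivative (2 * pi * \<i>) *\<^sub>C g) (at 0)}"
    by (simp only:)
qed

lemma P_op_swap: "P_op U = {(f, g). (swap_L2 f, swap_L2 g) \<in> Q_op U}"
  by (simp add: Q_op_swap)

text \<open>Conjugation by the exchange of coordinates carries each group to the other direction.
  This symmetry accounts for the two alternatives of the theorem.\<close>

lemma op_commute_swap:
  assumes "op_commute (P_op U) (Q_op V)"
  shows "op_commute (P_op V) (Q_op U)"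
proof -
  obtain W Z where W: "is_exp_group (P_op U) W" and Z: "is_exp_group (Q_op V) Z" and c: "\<And>a b. W a \<circ> Z b = Z b \<circ> W a"
    using assms unfolding op_commute_def by blast
  have c': "W a (Z b f) = Z b (W a f)" for a b f using c[of a b] by (metis comp_apply)
  show ?thesis
    unfolding op_commute_def
    using exp_group_swap[OF W, folded Q_op_swap] exp_group_swap[OF Z, folded P_op_swap]
    by (intro exI[of _ "\<lambda>t f. swap_L2 (Z t (swap_L2 f))"] exI[of _ "\<lambda>t f. swap_L2 (W t (swap_L2 f))"])
       (auto simp: c')
qed

section \<open>Translations and the boundary unitary\<close>

lemma norm_abs_L2_le:
  fixes f :: "real \<Rightarrow> complex"
  assumes f: "sq_int f" and B: "\<And>x. x \<in> {0..1} \<Longrightarrow> cmod (f x) \<le> B" "0 \<le> B"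
  shows "norm (abs_L2 f) \<le> B"
proof (rule power2_le_imp_le[OF _ B(2)])
  have "(LINT x|I01. (cmod (f x))\<^sup>2) \<le> (LINT x|I01. B\<^sup>2)"
    using f B(1) by (intro integral_mono) (auto simp: sq_int_def intro: power_mono)
  also have "\<dots> = B\<^sup>2" using measure_space_unit_cube[where 'a = real] by simp
  finally show "(norm (abs_L2 f))\<^sup>2 \<le> B\<^sup>2" by (simp add: norm_abs_L2[OF f])
qed

text \<open>Uniform continuity of \<open>\<phi>'\<close> on a compact interval bounds the
  linearization error uniformly in x, and the supremum bounds the norm.\<close>

lemma translation_has_vector_derivative:
  fixes \<phi> :: "real \<Rightarrow> complex"
  assumes \<phi>: "\<And>x. (\<phi> has_vector_derivative \<phi>' x) (at x)" and \<phi>': "continuous_on UNIV \<phi>'"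
  shows "((\<lambda>b. abs_L2 (\<lambda>x. \<phi> (x + b)) :: real L2) has_vector_derivative abs_L2 (\<lambda>x. \<phi>' (x + b))) (at b)"
proof -
  have c: "continuous_on UNIV \<phi>"
    using \<phi> has_vector_derivative_continuous by (blast intro: continuous_at_imp_continuous_on)
  have s: "sq_int (\<lambda>x. \<phi> (x + b))" "sq_int (\<lambda>x. \<phi>' (x + b))" for b
    by (intro sq_int_continuous continuous_on_compose2[OF c] continuous_on_compose2[OF \<phi>'] continuous_intros; simp)+
  let ?R = "\<lambda>h. abs_L2 (\<lambda>x. \<phi> (x + (b + h))) - abs_L2 (\<lambda>x. \<phi> (x + b)) - h *\<^sub>R abs_L2 (\<lambda>x. \<phi>' (x + b)) :: real L2"
  have "((\<lambda>h. norm (?R h) / norm h) \<longlongrightarrow> 0) (at 0)"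
  proof (rule tendstoI)
    fix e :: real assume e: "e > 0"
    \<comment> \<open>This interval contains x + b and x + b + h for all x in [0, 1] and all h of
      modulus at most 1.\<close>
    have "uniformly_continuous_on {b - 1..b + 2} \<phi>'"
      by (intro compact_uniformly_continuous continuous_on_subset[OF \<phi>']) auto
    then obtain \<delta> where \<delta>: "\<delta> > 0"
      "\<And>x x'. x \<in> {b - 1..b + 2} \<Longrightarrow> x' \<in> {b - 1..b + 2} \<Longrightarrow> dist x' x < \<delta> \<Longrightarrow> dist (\<phi>' x') (\<phi>' x) < e / 2"
      using e unfolding uniformly_continuous_on_def by (meson half_gt_zero)
    have "norm (?R h) / norm h < e" if h: "h \<noteq> 0" "\<bar>h\<bar> < min \<delta> 1" for h
    proof -
      have "norm (?R h) \<le> \<bar>h\<bar> * (e / 2)"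
      proof -
        have eq: "?R h = abs_L2 (\<lambda>x. \<phi> (x + (b + h)) - \<phi> (x + b) - complex_of_real h * \<phi>' (x + b))"
          by (simp add: scaleR_scaleC scaleC_abs s minus_abs sq_int_cmult sq_int_diff)
        show ?thesis unfolding eq
        proof (rule norm_abs_L2_le)
          show "sq_int (\<lambda>x. \<phi> (x + (b + h)) - \<phi> (x + b) - complex_of_real h * \<phi>' (x + b))"
            by (intro sq_int_diff sq_int_cmult s)
          fix x :: real assume x: "x \<in> {0..1}"
          let ?S = "closed_segment (x + b) (x + (b + h))"
          have S: "z \<in> {b - 1..b + 2} \<and> dist z (x + b) < \<delta>" if "z \<in> ?S" for z
            using that h x by (auto simp: closed_segment_eq_real_ivl dist_real_def split: if_splits)
          have "norm (\<phi> (x + (b + h)) - \<phi> (x + b) - ((x + (b + h)) - (x + b)) *\<^sub>R \<phi>' (x + b))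
              \<le> norm ((x + (b + h)) - (x + b)) * (e / 2)"
          proof (rule vector_differentiable_bound_linearization[where S = ?S])
            show "(\<phi> has_vector_derivative \<phi>' z) (at z within ?S)" for z
              by (rule has_vector_derivative_at_within[OF \<phi>])
            show "norm (\<phi>' z - \<phi>' (x + b)) \<le> e / 2" if "z \<in> ?S" for z
              using \<delta>(2)[of "x + b" z] S[OF that] S[of "x + b"] by (simp add: dist_norm less_imp_le)
          qed auto
          then show "cmod (\<phi> (x + (b + h)) - \<phi> (x + b) - complex_of_real h * \<phi>' (x + b)) \<le> \<bar>h\<bar> * (e / 2)"
            by (simp add: scaleR_conv_of_real)
        qed (use e in simp)
      qed
      then have "norm (?R h) / norm h \<le> e / 2" using h by (simp add: divide_le_eq mult.commute)
      then show ?thesis using e by linarith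
    qed
    then show "eventually (\<lambda>h. dist (norm (?R h) / norm h) 0 < e) (at 0)"
      unfolding eventually_at using \<delta>(1)
      by (intro exI[of _ "min \<delta> 1"]) (auto simp: dist_real_def)
  qed
  then show ?thesis
    unfolding has_vector_derivative_def has_derivative_at
    by (auto intro: bounded_linear_scaleR_left simp: add.assoc)
qed

text \<open>The bump vanishes with all derivatives at both ends, so the translated function has no
  break where the part before and the part after the boundary meet. The curve is thus differentiable
  and stays in the domain.\<close>

lemma exp_group_1_bump:
  fixes r :: real
  assumes U: "unitary_op U" and W: "is_exp_group (P_op U) W"
  defines "\<phi> \<equiv> \<lambda>x. complex_of_real (bump 0 x) * unit_exp (r * x)"
  shows "W 1 (abs_L2 \<phi> \<otimes>\<^sub>L u) = abs_L2 \<phi> \<otimes>\<^sub>L U u"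
proof -
  have "smooth1 \<phi>" unfolding \<phi>_def by (intro smooth1.mult bump_smooth1 smooth1_unit_exp)
  then obtain \<phi>' where "smooth1 \<phi>'" and d: "\<And>x. (\<phi> has_vector_derivative \<phi>' x) (at x)"
    using smooth1_deriv by blast
  note \<phi>' = d smooth1_continuous[OF \<open>smooth1 \<phi>'\<close>, of UNIV]
  have \<phi>0: "\<phi> x = 0" if "x \<notin> {0<..<1}" for x
    using that bump_nonneg[of 0 x] bump_pos[of 0 x] by (auto simp: \<phi>_def)
  define T where "T k b = (abs_L2 (\<lambda>x. k (x + b)) :: real L2)" for k :: "real \<Rightarrow> complex" and b
  have C1: "C1_pair (\<lambda>x. \<phi> (x + b)) (\<lambda>x. \<phi>' (x + b))" for b
    unfolding C1_pair_def
  proof (intro conjI ballI)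
    show "continuous_on {0..1} (\<lambda>x. \<phi>' (x + b))"
      by (intro continuous_on_compose2[OF \<phi>'(2)] continuous_intros) simp
    fix x
    have "((\<lambda>x. x + b) has_vector_derivative 1) (at x)" by (auto intro!: derivative_eq_intros)
    from vector_diff_chain_at[OF this \<phi>'(1)]
    show "((\<lambda>x. \<phi> (x + b)) has_vector_derivative \<phi>' (x + b)) (at x within {0..1})"
      by (simp add: o_def has_vector_derivative_at_within)
  qed
  have Td: "((\<lambda>b. T \<phi> (b + c)) has_vector_derivative T \<phi>' (b + c)) (at b within S)" for b c S
  proof -
    have "((\<lambda>b. b + c) has_vector_derivative 1) (at b)" by (auto intro!: derivative_eq_intros)
    from vector_diff_chain_at[OF this translation_has_vector_derivative[OF \<phi>'], folded T_def]
    show ?thesis by (simp add: o_def has_vector_derivative_at_within)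
  qed
  \<comment> \<open>The first summand is what has not yet left through x = 0, the second what has
    reentered at x = 1. At b = 0 only the first is present, at b = 1 only the second.\<close>
  define F where "F b = T \<phi> (b + 0) \<otimes>\<^sub>L u + T \<phi> (b + (- 1)) \<otimes>\<^sub>L U u" for b
  define F' where "F' b = T \<phi>' (b + 0) \<otimes>\<^sub>L u + T \<phi>' (b + (- 1)) \<otimes>\<^sub>L U u" for b
  have "F 1 = W 1 (F 0)"
  proof (rule exp_group_curve[OF W, of "{0..1}" 1 F "\<lambda>b. (1 / (2 * pi * \<i>)) *\<^sub>C F' b"])
    fix b :: real assume b: "b \<in> {0..1}"
    have "(F has_vector_derivative F' b) (at b within {0..1})"
      unfolding F_def F'_def
      by (intro has_vector_derivative_add bounded_linear.has_vector_derivative[OF bounded_linear_tensor_left] Td)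
    then show "(F has_vector_derivative (2 * pi * \<i>) *\<^sub>C (1 / (2 * pi * \<i>)) *\<^sub>C F' b) (at b within {0..1})"
      by simp
    show "(F b, (1 / (2 * pi * \<i>)) *\<^sub>C F' b) \<in> P_op U"
    proof (rule P_opI)
      have "weak_dx (F b) (F' b)"
        unfolding F_def F'_def T_def by (intro weak_dx_add weak_dx_tensor C1)
      then show "weak_dx (F b) ((2 * pi * \<i>) *\<^sub>C (1 / (2 * pi * \<i>)) *\<^sub>C F' b)" by simp
      have sl: "slice_x (F b) a (\<phi> (a + b) *\<^sub>C u + \<phi> (a + (b - 1)) *\<^sub>C U u)" for a
        using slice_x_add[OF slice_x_tensor[OF C1[of "b + 0"], of u a] slice_x_tensor[OF C1[of "b + (- 1)"], of "U u" a]]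
        by (simp add: F_def T_def)
      show "slice_x (F b) 0 (\<phi> b *\<^sub>C u)"
        using sl[of 0] \<phi>0[of "b - 1"] b by simp
      show "slice_x (F b) 1 (U (\<phi> b *\<^sub>C u))"
        using sl[of 1] \<phi>0[of "1 + b"] b by (simp add: unitary_scaleC[OF U])
    qed
  qed auto
  moreover have z: "T \<phi> 1 = 0" "T \<phi> (- 1) = 0"
  proof -
    have s: "sq_int (\<lambda>x. \<phi> (x + b))" for b by (rule sq_int_C1(1)[OF C1])
    show "T \<phi> 1 = 0" "T \<phi> (- 1) = 0"
      unfolding T_def zero_abs
      by (rule abs_L2_eq_iff[OF s sq_int_zero, THEN iffD2], rule AE_I2, rule \<phi>0, simp)+
  qed
  moreover have "T \<phi> 0 = abs_L2 \<phi>" by (simp add: T_def)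
  ultimately show ?thesis by (simp add: F_def)
qed

lemma L1_total_bump: "L1_total (\<lambda>m x. complex_of_real (bump 0 x) * unit_exp (of_int m * x))"
proof (rule L1_total_mult[OF L1_total_unit_exp_int])
  show "(\<lambda>x. complex_of_real (bump 0 x)) \<in> borel_measurable I01"
    by (rule continuous_on_I01_measurable[OF smooth1_continuous[OF bump_smooth1]])
  have "bump 0 x \<le> 1" for x
    by (auto simp: bump_def flat_def intro!: mult_le_one)
  then show "cmod (complex_of_real (bump 0 x)) \<le> 1" for x
    using bump_nonneg[of 0 x] by simp
  show "AE x in I01. complex_of_real (bump 0 x) \<noteq> 0"
    using null_singleton_I01[of 0] null_singleton_I01[of 1] AE_space
  proof eventually_elim
    case (elim x)
    then have "bump 0 x > 0" by (auto simp: bump_pos)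
    then show ?case by simp
  qed
qed

text \<open>\<open>W 1\<close> is known on bump products. Its isometry determines the inner products
  of any \<open>W 1 (v \<otimes>\<^sub>L u)\<close> with their images, and these images are total
  because \<open>U\<close> is surjective.\<close>

lemma exp_group_1:
  assumes U: "unitary_op U" and W: "is_exp_group (P_op U) W"
  shows "W 1 (v \<otimes>\<^sub>L u) = v \<otimes>\<^sub>L U u"
proof -
  let ?\<phi> = "\<lambda>m x. complex_of_real (bump 0 x) * unit_exp (of_int m * x)"
  have "W 1 (v \<otimes>\<^sub>L u) - v \<otimes>\<^sub>L U u = 0"
  proof (rule L1_total_tensor[OF L1_total_bump L1_total_unit_exp_int])
    fix m n :: int
    obtain w where w: "abs_L2 (\<lambda>x. unit_exp (of_int n * x)) = U w"
      using unitary_surj[OF U] by metis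
    have "cinner (W 1 (v \<otimes>\<^sub>L u)) (abs_L2 (?\<phi> m) \<otimes>\<^sub>L U w) = cinner (W 1 (v \<otimes>\<^sub>L u)) (W 1 (abs_L2 (?\<phi> m) \<otimes>\<^sub>L w))"
      by (simp only: exp_group_1_bump[OF U W])
    also have "\<dots> = cinner (v \<otimes>\<^sub>L u) (abs_L2 (?\<phi> m) \<otimes>\<^sub>L w)"
      by (rule unitary_cinner[OF exp_group_unitary[OF W]])
    also have "\<dots> = cinner (v \<otimes>\<^sub>L U u) (abs_L2 (?\<phi> m) \<otimes>\<^sub>L U w)"
      by (simp only: cinner_tensor unitary_cinner[OF U])
    finally show "cinner (W 1 (v \<otimes>\<^sub>L u) - v \<otimes>\<^sub>L U u) (abs_L2 (?\<phi> m) \<otimes>\<^sub>L abs_L2 (\<lambda>x. unit_exp (of_int n * x))) = 0"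
      by (simp add: cinner_diff_left w)
  qed
  then show ?thesis by simp
qed


section \<open>Commuting momentum operators\<close>

text \<open>The witness is \<open>Z 1\<close>, identified on products by \<open>exp_group_1\<close>
  after exchanging coordinates. It commutes with the group of \<open>P_op U\<close>, hence maps its
  graph into itself, where symmetry applies.\<close>

lemma commuting_invariant:
  assumes V: "unitary_op V" and c: "op_commute (P_op U) (Q_op V)"
  shows "\<exists>T. (\<forall>u v. T (u \<otimes>\<^sub>L v) = V u \<otimes>\<^sub>L v) \<and>
    (\<forall>f g f' g'. (f, g) \<in> P_op U \<longrightarrow> (f', g') \<in> P_op U \<longrightarrow> cinner (T g) f' = cinner (T f) g')"
proof -
  obtain W Z where W: "is_exp_group (P_op U) W" and Z: "is_exp_group (Q_op V) Z" and c: "\<And>a b. W a \<circ> Z b = Z b \<circ> W a"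
    using c unfolding op_commute_def by blast
  have c': "Z 1 (W a f) = W a (Z 1 f)" for a f using c[of a 1] by (metis comp_apply)
  note u = exp_group_unitary[OF Z, of 1]
  have S: "is_exp_group (P_op V) (\<lambda>t f. swap_L2 (Z t (swap_L2 f)))"
    using exp_group_swap[OF Z] by (simp add: P_op_swap[symmetric])
  show ?thesis
  proof (intro exI[of _ "Z 1"] conjI allI impI)
    show "Z 1 (x \<otimes>\<^sub>L v) = V x \<otimes>\<^sub>L v" for x v
      using arg_cong[OF exp_group_1[OF V S, of v x], of swap_L2] by (simp add: swap_tensor)
    show "cinner (Z 1 g) f' = cinner (Z 1 f) g'"
      if fg: "(f, g) \<in> P_op U" "(f', g') \<in> P_op U" for f g f' g'
    proof -
      have "(Z 1 f, Z 1 g) \<in> P_op U"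
        by (rule exp_group_invariant[OF W unitary_bounded_linear[OF u] unitary_scaleC[OF u] c' fg(1)])
      from exp_group_symmetric[OF W this fg(2)] show ?thesis .
    qed
  qed
qed

section \<open>Exponential vectors and eigenvectors\<close>

lemma weak_dx_exp_fun: "weak_dx (exp_fun r \<otimes>\<^sub>L v) ((2 * pi * \<i> * r) *\<^sub>C (exp_fun r \<otimes>\<^sub>L v))"
  using weak_dx_tensor[OF C1_pair_unit_exp, of r v]
  by (simp add: exp_fun_def tensor_scaleC_left[symmetric] scaleC_abs)

lemma slice_x_exp_fun: "slice_x (exp_fun r \<otimes>\<^sub>L v) a (unit_exp (r * a) *\<^sub>C v)"
  using slice_x_tensor[OF C1_pair_unit_exp, of r v a] by (simp add: exp_fun_def)

text \<open>The boundary condition is required of the sum only, not of each summand; this supplies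
  domain elements for arbitrary \<open>U\<close>.\<close>

lemma P_op_exp_fun_sum:
  assumes "unit_exp r *\<^sub>C v + unit_exp s *\<^sub>C w = U (v + w)"
  shows "(exp_fun r \<otimes>\<^sub>L v + exp_fun s \<otimes>\<^sub>L w,
     complex_of_real r *\<^sub>C (exp_fun r \<otimes>\<^sub>L v) + complex_of_real s *\<^sub>C (exp_fun s \<otimes>\<^sub>L w)) \<in> P_op U"
proof (rule P_opI)
  show "weak_dx (exp_fun r \<otimes>\<^sub>L v + exp_fun s \<otimes>\<^sub>L w) ((2 * pi * \<i>) *\<^sub>C
     (complex_of_real r *\<^sub>C (exp_fun r \<otimes>\<^sub>L v) + complex_of_real s *\<^sub>C (exp_fun s \<otimes>\<^sub>L w)))"
    using weak_dx_add[OF weak_dx_exp_fun weak_dx_exp_fun, of r v s w] by (simp add: scaleC_add_right)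
  show "slice_x (exp_fun r \<otimes>\<^sub>L v + exp_fun s \<otimes>\<^sub>L w) 0 (v + w)"
    using slice_x_add[OF slice_x_exp_fun[of r v 0] slice_x_exp_fun[of s w 0]] by simp
  show "slice_x (exp_fun r \<otimes>\<^sub>L v + exp_fun s \<otimes>\<^sub>L w) 1 (U (v + w))"
    using slice_x_add[OF slice_x_exp_fun[of r v 1] slice_x_exp_fun[of s w 1]] assms by simp
qed

lemma P_op_exp_fun:
  assumes "U v = unit_exp r *\<^sub>C v"
  shows "(exp_fun r \<otimes>\<^sub>L v, complex_of_real r *\<^sub>C (exp_fun r \<otimes>\<^sub>L v)) \<in> P_op U"
  using P_op_exp_fun_sum[of r v r 0 U] assms by simp

lemma unit_exp_arg_ex:
  assumes "cmod c = 1"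
  shows "\<exists>\<beta>\<in>{0..<1}. c = unit_exp \<beta>"
proof (intro bexI)
  show "Arg2pi c / (2 * pi) \<in> {0..<1}" using Arg2pi_ge_0[of c] Arg2pi_lt_2pi[of c] by simp
  show "c = unit_exp (Arg2pi c / (2 * pi))"
    using Arg2pi_eq[of c] assms by (simp add: unit_exp_def mult_ac)
qed

text \<open>By totality of the shifted exponentials the image equals its component along the m-th
  one, and isometry makes the coefficient unimodular.\<close>

lemma eigenvector_if_orthogonal:
  assumes V: "unitary_op V" and orth: "\<And>n. n \<noteq> m \<Longrightarrow> cinner (V (exp_fun (r + of_int m))) (exp_fun (r + of_int n)) = 0"
  shows "\<exists>\<beta>\<in>{0..<1}. V (exp_fun (r + of_int m)) = unit_exp \<beta> *\<^sub>C exp_fun (r + of_int m)"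
proof -
  let ?e = "\<lambda>n. exp_fun (r + of_int n)"
  define c where "c = cinner (V (?e m)) (?e m)"
  have "V (?e m) - c *\<^sub>C ?e m = 0"
  proof (rule L1_total_exp_fun)
    show "cinner (V (?e m) - c *\<^sub>C ?e m) (?e n) = 0" for n
      using orth[of n] by (cases "n = m") (auto simp: cinner_simps cinner_exp_fun_int c_def)
  qed
  then have Ve: "V (?e m) = c *\<^sub>C ?e m" by simp
  then have "cmod c = 1" using unitary_norm[OF V, of "?e m"] by (simp add: norm_scaleC)
  with Ve unit_exp_arg_ex show ?thesis by metis
qed

lemma commuting_scalar_imp_diagonal:
  assumes V: "unitary_op V" and c: "op_commute (P_op (\<lambda>f. unit_exp \<alpha> *\<^sub>C f)) (Q_op V)"
  shows "\<exists>\<beta>\<in>{0..<1}. V (exp_fun (\<alpha> + of_int m)) = unit_exp \<beta> *\<^sub>C exp_fun (\<alpha> + of_int m)"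
proof (rule eigenvector_if_orthogonal[OF V])
  fix n assume n: "n \<noteq> m"
  obtain T where "(\<forall>u v. T (u \<otimes>\<^sub>L v) = V u \<otimes>\<^sub>L v) \<and>
    (\<forall>f g f' g'. (f, g) \<in> P_op (\<lambda>f. unit_exp \<alpha> *\<^sub>C f) \<longrightarrow> (f', g') \<in> P_op (\<lambda>f. unit_exp \<alpha> *\<^sub>C f) \<longrightarrow>
      cinner (T g) f' = cinner (T f) g')"
    using commuting_invariant[OF V c] by (rule exE)
  note T = this[THEN conjunct1, rule_format] and sym = this[THEN conjunct2, rule_format]
  \<comment> \<open>The constant function 1, a unit vector; for scalar \<open>U\<close> the second
    factor is arbitrary.\<close>
  let ?v = "exp_fun 0"
  have P: "(exp_fun (\<alpha> + of_int k) \<otimes>\<^sub>L ?v, (complex_of_real (\<alpha> + of_int k) *\<^sub>C exp_fun (\<alpha> + of_int k)) \<otimes>\<^sub>L ?v)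
      \<in> P_op (\<lambda>f. unit_exp \<alpha> *\<^sub>C f)" for k
    unfolding tensor_scaleC_left by (rule P_op_exp_fun) simp
  from sym[OF P[of m] P[of n]]
  have "of_real (\<alpha> + of_int m) * cinner (V (exp_fun (\<alpha> + of_int m))) (exp_fun (\<alpha> + of_int n))
     = of_real (\<alpha> + of_int n) * cinner (V (exp_fun (\<alpha> + of_int m))) (exp_fun (\<alpha> + of_int n))"
    unfolding T by (simp add: unitary_scaleC[OF V] tensor_scaleC_left cinner_simps cinner_tensor cinner_self)
  then show "cinner (V (exp_fun (\<alpha> + of_int m))) (exp_fun (\<alpha> + of_int n)) = 0"
    using n by simp
qed

text \<open>A nonzero inner product preserved by \<open>V\<close> forces equal eigenvalues. Integer
  frequencies are mutually orthogonal and cannot be compared directly, but each overlaps with the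
  frequency 1/2, whose eigenvalue is therefore shared by an orthonormal basis.\<close>

lemma scalar_if_all_eigenvectors:
  assumes V: "unitary_op V" and eig: "\<And>r. \<exists>\<beta>\<in>{0..<1}. V (exp_fun r) = unit_exp \<beta> *\<^sub>C exp_fun r"
  shows "\<exists>\<alpha>\<in>{0..<1}. V = (\<lambda>f. unit_exp \<alpha> *\<^sub>C f)"
proof -
  obtain \<beta> where \<beta>: "\<And>r. \<beta> r \<in> {0..<1}" and Ve: "\<And>r. V (exp_fun r) = unit_exp (\<beta> r) *\<^sub>C exp_fun r"
    using eig by metis
  have eq: "unit_exp (\<beta> r) = unit_exp (\<beta> s)" if "unit_exp (r - s) \<noteq> 1" for r s
  proof -
    have rs: "r \<noteq> s" using that by auto
    have "cinner (V (exp_fun r)) (V (exp_fun s)) = cinner (exp_fun r) (exp_fun s)"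
      by (rule unitary_cinner[OF V])
    then have "(unit_exp (\<beta> r) * cnj (unit_exp (\<beta> s)) - 1) * cinner (exp_fun r) (exp_fun s) = 0"
      by (simp add: Ve cinner_simps algebra_simps)
    moreover have "cinner (exp_fun r) (exp_fun s) \<noteq> 0"
      using that rs by (simp add: cinner_exp_fun)
    ultimately have "unit_exp (\<beta> r) * cnj (unit_exp (\<beta> s)) = 1" by simp
    then have "unit_exp (\<beta> r) * cnj (unit_exp (\<beta> s)) * unit_exp (\<beta> s) = unit_exp (\<beta> s)" by simp
    then show ?thesis by (simp add: mult.assoc)
  qed
  have half: "unit_exp (of_int m - 1/2) \<noteq> 1" for m :: int
  proof -
    have "unit_exp (- (1/2) + of_int m) = unit_exp (- (1/2))" by (rule unit_exp_add_int)
    also have "\<dots> = - 1" using exp_minus[of "pi * \<i>"] exp_pi_i' by (simp add: unit_exp_def)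
    finally show ?thesis by simp
  qed
  define \<alpha> where "\<alpha> = \<beta> (1/2)"
  have Vm: "V (exp_fun (0 + of_int m)) = unit_exp \<alpha> *\<^sub>C exp_fun (0 + of_int m)" for m :: int
    using eq[OF half[of m]] Ve by (simp add: \<alpha>_def)
  have "V f = unit_exp \<alpha> *\<^sub>C f" for f
  proof -
    have "V f - unit_exp \<alpha> *\<^sub>C f = 0"
    proof (rule L1_total_exp_fun[of _ 0])
      fix m :: int
      have "cnj (unit_exp \<alpha>) * cinner (V f) (exp_fun (0 + of_int m)) = cinner (V f) (V (exp_fun (0 + of_int m)))"
        by (simp only: Vm cinner_scaleC_right)
      also have "\<dots> = cinner f (exp_fun (0 + of_int m))" by (rule unitary_cinner[OF V])
      finally have "unit_exp \<alpha> * cnj (unit_exp \<alpha>) * cinner (V f) (exp_fun (0 + of_int m))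
          = unit_exp \<alpha> * cinner f (exp_fun (0 + of_int m))"
        by (simp only: mult.assoc)
      then show "cinner (V f - unit_exp \<alpha> *\<^sub>C f) (exp_fun (0 + of_int m)) = 0"
        by (simp add: cinner_simps)
    qed
    then show ?thesis by simp
  qed
  then show ?thesis using \<beta>[of "1/2"] unfolding \<alpha>_def by blast
qed

lemma scalar_if_all_multiples:
  fixes U :: "real L2 \<Rightarrow> real L2"
  assumes U: "unitary_op U" and mult: "\<And>v. \<exists>c. U v = c *\<^sub>C v"
  shows "\<exists>\<alpha>\<in>{0..<1}. U = (\<lambda>f. unit_exp \<alpha> *\<^sub>C f)"
proof (rule scalar_if_all_eigenvectors[OF U])
  fix r
  obtain c where c: "U (exp_fun r) = c *\<^sub>C exp_fun r" using mult by blast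
  then have "cmod c = 1" using unitary_norm[OF U, of "exp_fun r"] by (simp add: norm_scaleC)
  with c unit_exp_arg_ex show "\<exists>\<beta>\<in>{0..<1}. U (exp_fun r) = unit_exp \<beta> *\<^sub>C exp_fun r" by metis
qed

text \<open>
  Let \<open>v\<close> and \<open>U v\<close> be linearly independent. Since $e_{r+n} - e_r$ vanishes at \<open>0\<close> and \<open>1\<close>, its
  product with \<open>v\<close> lies in the domain of $P_U$, and so does $p \otimes w + q \otimes w'$ with
  $p, q = (e_r \pm e_{r+1/2})/2$ and $w' = e(-r) U w$, as \<open>q\<close> vanishes at \<open>0\<close> and \<open>p\<close> at \<open>1\<close>.
  Symmetry of $P_U$ after applying $V \otimes I$, for all \<open>w\<close>, separates the parts with \<open>p\<close> and \<open>q\<close>.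
  Adding them gives the orthogonality of $V e_{r+n}$ and $e_r$.
\<close>

lemma commuting_nonscalar_imp_scalar:
  assumes U: "unitary_op U" and V: "unitary_op V" and c: "op_commute (P_op U) (Q_op V)"
    and v: "\<And>c. U v \<noteq> c *\<^sub>C v"
  shows "\<exists>\<alpha>\<in>{0..<1}. V = (\<lambda>f. unit_exp \<alpha> *\<^sub>C f)"
proof -
  obtain T where "(\<forall>u v. T (u \<otimes>\<^sub>L v) = V u \<otimes>\<^sub>L v) \<and>
    (\<forall>f g f' g'. (f, g) \<in> P_op U \<longrightarrow> (f', g') \<in> P_op U \<longrightarrow> cinner (T g) f' = cinner (T f) g')"
    using commuting_invariant[OF V c] by (rule exE)
  note T = this[THEN conjunct1, rule_format] and sym = this[THEN conjunct2, rule_format]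
  have orth: "cinner (V (exp_fun (r + of_int n))) (exp_fun r) = 0" if n: "n \<noteq> 0" for r and n :: int
  proof -
    define s where "s = r + 1/2"
    \<comment> \<open>Primed vectors, here and below, are the derivatives divided by 2 pi i.\<close>
    define u where "u = exp_fun (r + of_int n) + (-1) *\<^sub>C exp_fun r"
    define u' where "u' = complex_of_real (r + of_int n) *\<^sub>C exp_fun (r + of_int n) + (complex_of_real r * (-1)) *\<^sub>C exp_fun r"
    have u: "(u \<otimes>\<^sub>L v, u' \<otimes>\<^sub>L v) \<in> P_op U"
    proof -
      have v0: "v + (-1) *\<^sub>C v = 0" by (simp add: scaleC_minus_left)
      have "unit_exp (r + of_int n) *\<^sub>C v + unit_exp r *\<^sub>C (-1) *\<^sub>C v = unit_exp r *\<^sub>C (v + (-1) *\<^sub>C v)"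
        by (simp only: unit_exp_add_int scaleC_add_right)
      also have "\<dots> = U (v + (-1) *\<^sub>C v)"
        unfolding v0 using unitary_scaleC[OF U, of 0 0] by simp
      finally have "(exp_fun (r + of_int n) \<otimes>\<^sub>L v + exp_fun r \<otimes>\<^sub>L ((-1) *\<^sub>C v),
         complex_of_real (r + of_int n) *\<^sub>C (exp_fun (r + of_int n) \<otimes>\<^sub>L v)
           + complex_of_real r *\<^sub>C (exp_fun r \<otimes>\<^sub>L ((-1) *\<^sub>C v))) \<in> P_op U"
        by (rule P_op_exp_fun_sum)
      then show ?thesis
        by (simp only: u_def u'_def tensor_add_left tensor_scaleC_left tensor_scaleC_right scaleC_scaleC)
    qed
    define p p' q q' where "p = (1/2) *\<^sub>C (exp_fun r + exp_fun s)"
      and "p' = (1/2) *\<^sub>C (complex_of_real r *\<^sub>C exp_fun r + complex_of_real s *\<^sub>C exp_fun s)"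
      and "q = (1/2) *\<^sub>C (exp_fun r + (-1) *\<^sub>C exp_fun s)"
      and "q' = (1/2) *\<^sub>C (complex_of_real r *\<^sub>C exp_fun r + (- complex_of_real s) *\<^sub>C exp_fun s)"
    have es: "unit_exp s = - unit_exp r"
      unfolding s_def unit_exp_add using exp_pi_i' by (simp add: unit_exp_def)
    have pq: "(p \<otimes>\<^sub>L w + q \<otimes>\<^sub>L (cnj (unit_exp r) *\<^sub>C U w), p' \<otimes>\<^sub>L w + q' \<otimes>\<^sub>L (cnj (unit_exp r) *\<^sub>C U w)) \<in> P_op U" for w
    proof -
      define w' where "w' = cnj (unit_exp r) *\<^sub>C U w"
      have Uw: "U w = unit_exp r *\<^sub>C w'" by (simp add: w'_def)
      \<comment> \<open>Sorting the combination of \<open>p\<close> and \<open>q\<close> by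
        exponentials instead gives the second factors a and b, the form treated by
        \<open>P_op_exp_fun_sum\<close>.\<close>
      define a where "a = (1/2) *\<^sub>C (w + w')"
      define b where "b = (1/2) *\<^sub>C (w - w')"
      have "a + b = w"
        unfolding a_def b_def by (rule L2_eqI) (simp add: cinner_simps field_simps)
      moreover have "unit_exp r *\<^sub>C a + unit_exp s *\<^sub>C b = U w"
        unfolding Uw es a_def b_def by (rule L2_eqI) (simp add: cinner_simps field_simps)
      ultimately have "(exp_fun r \<otimes>\<^sub>L a + exp_fun s \<otimes>\<^sub>L b,
        complex_of_real r *\<^sub>C (exp_fun r \<otimes>\<^sub>L a) + complex_of_real s *\<^sub>C (exp_fun s \<otimes>\<^sub>L b)) \<in> P_op U"
        by (intro P_op_exp_fun_sum) simp
      moreover have "exp_fun r \<otimes>\<^sub>L a + exp_fun s \<otimes>\<^sub>L b = p \<otimes>\<^sub>L w + q \<otimes>\<^sub>L w'"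
        unfolding a_def b_def p_def q_def tensor_scaleC_left tensor_scaleC_right tensor_add_left tensor_add_right tensor_diff_right
        by (rule L2_eqI) (simp add: cinner_simps field_simps)
      moreover have "complex_of_real r *\<^sub>C (exp_fun r \<otimes>\<^sub>L a) + complex_of_real s *\<^sub>C (exp_fun s \<otimes>\<^sub>L b) = p' \<otimes>\<^sub>L w + q' \<otimes>\<^sub>L w'"
        unfolding a_def b_def p'_def q'_def tensor_scaleC_left tensor_scaleC_right tensor_add_left tensor_add_right tensor_diff_right
        by (rule L2_eqI) (simp add: cinner_simps field_simps)
      ultimately show ?thesis by (simp add: w'_def)
    qed
    define A where "A = cinner (V u') p - cinner (V u) p'"
    define B where "B = cinner (V u') q - cinner (V u) q'"
    have AB: "A * cinner v w + B * unit_exp r * cinner v (U w) = 0" for w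
      using sym[OF u pq[of w]] unfolding T
      by (simp add: cinner_add_right cinner_tensor cinner_scaleC_right A_def B_def algebra_simps)
    \<comment> \<open>Replacing \<open>cinner v w\<close> by \<open>cinner (U v) (U w)\<close> and
      using that \<open>U\<close> is surjective turns the scalar identities into a linear relation
      between \<open>U v\<close> and \<open>v\<close>.\<close>
    have "A *\<^sub>C U v + (B * unit_exp r) *\<^sub>C v = 0"
    proof -
      have "cinner (A *\<^sub>C U v + (B * unit_exp r) *\<^sub>C v) h = cinner 0 h" for h
      proof -
        obtain w where w: "h = U w" using unitary_surj[OF U] by metis
        have "cinner (U v) h = cinner v w" unfolding w by (rule unitary_cinner[OF U])
        then show ?thesis using AB[of w] by (simp add: cinner_simps w)
      qed
      then show ?thesis by (rule L2_eqI)
    qed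
    then have AB0: "A *\<^sub>C U v = (- (B * unit_exp r)) *\<^sub>C v"
      by (simp add: scaleC_minus_left eq_neg_iff_add_eq_0)
    have "A = 0"
    proof (rule ccontr)
      assume "A \<noteq> 0"
      then have "U v = (inverse A * (- (B * unit_exp r))) *\<^sub>C v"
        using arg_cong[OF AB0, of "\<lambda>f. inverse A *\<^sub>C f"] by simp
      then show False using v by blast
    qed
    moreover have "v \<noteq> 0" using v[of 0] unitary_scaleC[OF U, of 0 0] by auto
    ultimately have "B = 0"
      using AB0 scaleC_eq_0_iff[of "- (B * unit_exp r)" v] by simp
    \<comment> \<open>Here p + q is the exponential of frequency r and p' + q' is r times it, while
      in V u' - r V u only n times the image of the exponential of frequency r + n survives.\<close>
    have "0 = A + B" using \<open>A = 0\<close> \<open>B = 0\<close> by simp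
    also have "\<dots> = cinner (V u') (exp_fun r) - of_real r * cinner (V u) (exp_fun r)"
      by (simp add: A_def B_def p_def q_def p'_def q'_def cinner_simps field_simps)
    also have "\<dots> = of_int n * cinner (V (exp_fun (r + of_int n))) (exp_fun r)"
      by (simp add: u_def u'_def unitary_add[OF V] unitary_scaleC[OF V] cinner_simps algebra_simps)
    finally show ?thesis using n by simp
  qed
  show ?thesis
  proof (rule scalar_if_all_eigenvectors[OF V])
    fix r
    \<comment> \<open>\<open>orth\<close> is used at the base frequency r + n with shift -n, which
      makes the image of the exponential of frequency r orthogonal to the one of frequency r +
      n.\<close>
    show "\<exists>\<beta>\<in>{0..<1}. V (exp_fun r) = unit_exp \<beta> *\<^sub>C exp_fun r"
      using eigenvector_if_orthogonal[OF V, of 0 r] orth[of "- _" "r + of_int _"]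
      by (metis (no_types, lifting) add.right_neutral add_diff_cancel_right' neg_equal_0_iff_equal of_int_0 of_int_minus add_uminus_conv_diff)
  qed
qed

text \<open>Scalar \<open>U\<close> leaves the second tensor factor free, so it can be adapted to
  the phase \<open>\<beta> m\<close> of \<open>V\<close> on the first factor. Moving both groups to
  the other side of the inner product reduces commutation to these common eigenvectors.\<close>

lemma diagonal_imp_commuting:
  assumes V: "unitary_op V"
    and eig: "\<And>m. V (exp_fun (\<alpha> + of_int m)) = unit_exp (\<beta> m) *\<^sub>C exp_fun (\<alpha> + of_int m)"
    and U: "unitary_op (\<lambda>f. unit_exp \<alpha> *\<^sub>C f :: real L2)"
  shows "op_commute (P_op (\<lambda>f. unit_exp \<alpha> *\<^sub>C f)) (Q_op V)"
proof -
  let ?U = "\<lambda>f :: real L2. unit_exp \<alpha> *\<^sub>C f"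
  \<comment> \<open>Every exponential is an eigenvector of the scalar \<open>U\<close>; integer
    frequencies with constant phase are one admissible basis.\<close>
  obtain W where W: "is_exp_group (P_op ?U) W"
    using P_op_exp_group[OF U, of 0 "\<lambda>m. \<alpha>"] by blast
  obtain Z' where "is_exp_group (P_op V) Z'"
    using P_op_exp_group[OF V eig] by blast
  then obtain Z where Z: "is_exp_group (Q_op V) Z"
    unfolding Q_op_swap using exp_group_swap by blast
  let ?E = "\<lambda>m n. exp_fun (\<alpha> + of_int m) \<otimes>\<^sub>L exp_fun (\<beta> m + of_int n)"
  have We: "W t (?E m n) = unit_exp ((\<alpha> + of_int m) * t) *\<^sub>C ?E m n" for t m n
    by (rule exp_group_eigenvector[OF W]) (rule P_op_exp_fun, simp)
  have Ze: "Z t (?E m n) = unit_exp ((\<beta> m + of_int n) * t) *\<^sub>C ?E m n" for t m n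
  proof (rule exp_group_eigenvector[OF Z])
    have "(exp_fun (\<beta> m + of_int n) \<otimes>\<^sub>L exp_fun (\<alpha> + of_int m),
       complex_of_real (\<beta> m + of_int n) *\<^sub>C (exp_fun (\<beta> m + of_int n) \<otimes>\<^sub>L exp_fun (\<alpha> + of_int m))) \<in> P_op V"
      by (rule P_op_exp_fun) (simp add: eig)
    then show "(?E m n, complex_of_real (\<beta> m + of_int n) *\<^sub>C ?E m n) \<in> Q_op V"
      unfolding Q_op_swap by (simp only: swap_scaleC swap_tensor mem_Collect_eq case_prod_conv)
  qed
  have "W a (Z b f) = Z b (W a f)" for a b f
  proof -
    have "W a (Z b f) - Z b (W a f) = 0"
    proof (rule exp_fun_tensor_total)
      fix m n
      show "cinner (W a (Z b f) - Z b (W a f)) (?E m n) = 0"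
        unfolding cinner_diff_left exp_group_adjoint[OF W] exp_group_adjoint[OF Z] We Ze
        by (simp only: unitary_scaleC[OF exp_group_unitary[OF W]] unitary_scaleC[OF exp_group_unitary[OF Z]]
            exp_group_adjoint[OF W] exp_group_adjoint[OF Z] cinner_scaleC_right We Ze) simp
    qed
    then show ?thesis by simp
  qed
  then show ?thesis
    unfolding op_commute_def using W Z by (intro exI[of _ W] exI[of _ Z]) auto
qed

theorem theorem5p5:
  fixes U V :: "real L2 \<Rightarrow> real L2"
  assumes "unitary_op U" and "unitary_op V"
  shows "op_commute (P_op U) (Q_op V) \<longleftrightarrow>
    (\<exists>\<alpha>\<in>{0..<1}. \<exists>\<beta> :: int \<Rightarrow> real. (\<forall>m. \<beta> m \<in> {0..<1}) \<and>
      (((\<forall>m. V (exp_fun (\<alpha> + of_int m)) = unit_exp (\<beta> m) *\<^sub>C exp_fun (\<alpha> + of_int m)) \<and>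
         U = (\<lambda>f. unit_exp \<alpha> *\<^sub>C f)) \<or>
       (V = (\<lambda>f. unit_exp \<alpha> *\<^sub>C f) \<and>
         (\<forall>m. U (exp_fun (\<alpha> + of_int m)) = unit_exp (\<beta> m) *\<^sub>C exp_fun (\<alpha> + of_int m)))))"
    (is "?L \<longleftrightarrow> ?R")
proof
  assume L: ?L
  show ?R
  proof (cases "\<forall>v. \<exists>c. U v = c *\<^sub>C v")
    case True
    then obtain \<alpha> where \<alpha>: "\<alpha> \<in> {0..<1}" and U: "U = (\<lambda>f. unit_exp \<alpha> *\<^sub>C f)"
      using scalar_if_all_multiples[OF assms(1)] by blast
    obtain \<beta> where "\<forall>m. \<beta> m \<in> {0..<1} \<and> V (exp_fun (\<alpha> + of_int m)) = unit_exp (\<beta> m) *\<^sub>C exp_fun (\<alpha> + of_int m)"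
      using commuting_scalar_imp_diagonal[OF assms(2) L[unfolded U]] by metis
    then show ?thesis using \<alpha> U by blast
  next
    case False
    then obtain v where "\<And>c. U v \<noteq> c *\<^sub>C v" by blast
    then obtain \<alpha> where \<alpha>: "\<alpha> \<in> {0..<1}" and V: "V = (\<lambda>f. unit_exp \<alpha> *\<^sub>C f)"
      using commuting_nonscalar_imp_scalar[OF assms L] by blast
    \<comment> \<open>With the coordinates exchanged, the scalar \<open>V\<close> takes the place of
      \<open>U\<close>, so the scalar case yields the phases of \<open>U\<close>.\<close>
    obtain \<beta> where "\<forall>m. \<beta> m \<in> {0..<1} \<and> U (exp_fun (\<alpha> + of_int m)) = unit_exp (\<beta> m) *\<^sub>C exp_fun (\<alpha> + of_int m)"
      using commuting_scalar_imp_diagonal[OF assms(1) op_commute_swap[OF L, unfolded V]] by metis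
    then show ?thesis using \<alpha> V by blast
  qed
next
  assume ?R
  then obtain \<alpha> \<beta> where
    "((\<forall>m. V (exp_fun (\<alpha> + of_int m)) = unit_exp (\<beta> m) *\<^sub>C exp_fun (\<alpha> + of_int m)) \<and>
         U = (\<lambda>f. unit_exp \<alpha> *\<^sub>C f)) \<or>
       (V = (\<lambda>f. unit_exp \<alpha> *\<^sub>C f) \<and>
         (\<forall>m. U (exp_fun (\<alpha> + of_int m)) = unit_exp (\<beta> m) *\<^sub>C exp_fun (\<alpha> + of_int m)))"
    by blast
  then show ?L
  proof (elim disjE conjE)
    assume V: "\<forall>m. V (exp_fun (\<alpha> + of_int m)) = unit_exp (\<beta> m) *\<^sub>C exp_fun (\<alpha> + of_int m)"
      and U: "U = (\<lambda>f. unit_exp \<alpha> *\<^sub>C f)"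
    show ?L using diagonal_imp_commuting[OF assms(2), of \<alpha> \<beta>] V assms(1) unfolding U by blast
  next
    assume V: "V = (\<lambda>f. unit_exp \<alpha> *\<^sub>C f)"
      and U: "\<forall>m. U (exp_fun (\<alpha> + of_int m)) = unit_exp (\<beta> m) *\<^sub>C exp_fun (\<alpha> + of_int m)"
    have "op_commute (P_op V) (Q_op U)"
      using diagonal_imp_commuting[OF assms(1), of \<alpha> \<beta>] U assms(2) unfolding V by blast
    then show ?L by (rule op_commute_swap)
  qed
qed


end
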